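(* Let $\Psi, E, E', P, N, k, \sigma, \eta, \tau_2$ and $k'$ be as in the context; that is, the standing structural conditions hold, the collision kernel satisfies $$\Psi(\mu,\nu)\le\frac{k}{(\mu+\nu)^\sigma}\quad\text{for all }\mu,\nu>0,\ \text{ with constants } k\ge0,\ \sigma\in(0,1/2),$$ and hypotheses (H2)–(H6) of the context are satisfied with this $\sigma$. Suppose $g_{in}\in\mathcal{S}^+$. Then the continuous coagulation equation with collisional breakage $$\frac{\partial g}{\partial t}=\mathcal{B}_c(g)-\mathcal{D}_{cb}(g)+\mathcal{B}_b(g),\qquad g(\mu,0)=g_{in}(\mu)\ \text{ for a.e. } \mu\in\mathbb{R}_+$$ has a unique weak solution on $[0,\infty)$.
   Context: Notation: $\mathbb{R}_+=(0,\infty)$; $|A|$ is Lebesgue measure and $\chi_A$ the characteristic function of a set $A$. Standing structural conditions. The collision kernel $\Psi:\mathbb{R}_+\times\mathbb{R}_+\to[0,\infty)$ is measurable and symmetric. $E,E':\mathbb{R}_+\times\mathbb{R}_+\to[0,1]$ are symmetric measurable functions with $E+E'=1$. The distribution function $P(\mu|\nu;\tau)\ge 0$ ($\mu,\nu,\tau>0$) is measurable, symmetric in its second and third variables ($P(\mu|\nu;\tau)=P(\mu|\tau;\nu)$), satisfies $P(\mu|\nu;\tau)=0$ if $\mu>\nu+\tau$, and, for all $\nu,\tau>0$, $$\int_0^{\nu+\tau}\mu P(\mu|\nu;\tau)\,d\mu=\nu+\tau,\qquad \int_0^{\nu+\tau}P(\mu|\nu;\tau)\,d\mu=N,$$ where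 $N\ge 2$ is a finite constant. Operators: $$\mathcal{B}_c(g)(\mu,t)=\tfrac12\int_0^\mu E(\mu-\nu,\nu)\Psi(\mu-\nu,\nu)g(\mu-\nu,t)g(\nu,t)\,d\nu,$$ $$\mathcal{D}_{cb}(g)(\mu,t)=\int_0^\infty\Psi(\mu,\nu)g(\mu,t)g(\nu,t)\,d\nu,$$ $$\mathcal{B}_b(g)(\mu,t)=\tfrac12\int_\mu^\infty\int_0^\nu P(\mu|\nu-\tau;\tau)E'(\nu-\tau,\tau)\Psi(\nu-\tau,\tau)g(\nu-\tau,t)g(\tau,t)\,d\tau\,d\nu.$$ Hypotheses. (H2) There is a real-valued function $\eta$ on $[0,1)$ with $\eta(r)\ge N\ge2$ for $0\le r<1$, such that $E(\mu,\nu)\ge\dfrac{\eta(r)-2}{\eta(r)-1}$ for all $(\mu,\nu)\in(0,1)\times(0,1)$ and $r\in[0,1)$. (H3) With the same $\eta$, $\int_0^\nu\mu^{-r}P(\mu|\nu-\tau;\tau)\,d\mu\le\eta(r)\nu^{-r}$ for all $0<\tau<\nu$ and $r\in[0,1)$. (H4), (H5) For every $\lambda>0$ there exist $\theta_1,\theta_2\in(0,2\sigma]$ and nonnegative functions $\Omega_1,\Omega_2$ with $\lim_{\delta\to0}\Omega_1(\delta)=\lim_{\delta\to0}\Omega_2(\delta)=0$ such that for all $\nu\in(0,\lambda)$, $0<\tau<\nu$, and all measurable $A\subset(0,\lambda)$ of sufficiently small measure, $$\text{(H4)}\ \int_0^\nu\chi_A(\mu)P(\mu|\nu-\tau;\tau)\,d\mu\le\Omega_1(|A|)\nu^{-\theta_1},\qquad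 \text{(H5)}\ \int_0^\nu\chi_A(\mu)\mu^{-\sigma}P(\mu|\nu-\tau;\tau)\,d\mu\le\Omega_2(|A|)\nu^{-\theta_2}.$$ (H6) There is $\tau_2\in[0,1)$ with $\tau_2+\sigma<1$ such that for every $\lambda>0$ there is $k'(\lambda)>0$ with $P(\mu|\nu;\tau)\le k'(\lambda)\mu^{-\tau_2}$ whenever $\nu+\tau>\lambda$ and $\mu\in(0,\lambda)$. Function space: $\mathcal{S}=L^1(\mathbb{R}_+;(1+\mu+\mu^{-2\sigma})\,d\mu)$ with norm $\|g\|_{\mathcal{S}}=\int_0^\infty(1+\mu+\mu^{-2\sigma})|g(\mu)|\,d\mu$; $\mathcal{S}^+$ is its positive cone (a.e. nonnegative elements). Weak solution. For $T\in\mathbb{R}_+$, a weak solution on $[0,T]$ is a nonnegative continuous function $g:[0,T]\to\mathcal{S}^+$ such that, for a.e. $\mu\in\mathbb{R}_+$ and all $t\in[0,T]$: (i) $\int_0^t\int_0^\infty\Psi(\mu,\nu)g(\nu,s)\,d\nu\,ds<\infty$ and $\int_0^t\mathcal{B}_b(g)(\mu,s)\,ds<\infty$; (ii) $g(\mu,t)=g_{in}(\mu)+\int_0^t[\mathcal{B}_c(g)(\mu,s)-\mathcal{D}_{cb}(g)(\mu,s)+\mathcal{B}_b(g)(\mu,s)]\,ds$. A weak solution on $[0,\infty)$ is a function whose restriction to $[0,T]$ is a weak solution on $[0,T]$ for every $T>0$. *)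

theory Defs
  imports "HOL-Analysis.Analysis"
begin

text \<open>
  Functions on the positive half line (quadrant, octant) are total functions on the reals that are
  only constrained, and only used, for positive arguments. ``Measurable'' means Lebesgue
  measurable throughout. \<open>P \<mu> \<nu> \<tau>\<close> stands for \<open>P(\<mu>|\<nu>;\<tau>)\<close>.
\<close>

definition collision_kernel :: "(real \<Rightarrow> real \<Rightarrow> real) \<Rightarrow> bool" where
  "collision_kernel \<Psi> \<longleftrightarrow>
     (\<lambda>(\<mu>, \<nu>). \<Psi> \<mu> \<nu>) \<in> borel_measurable (lebesgue_on ({0<..} \<times> {0<..})) \<and>
     (\<forall>\<mu>>0. \<forall>\<nu>>0. 0 \<le> \<Psi> \<mu> \<nu> \<and> \<Psi> \<mu> \<nu> = \<Psi> \<nu> \<mu>)"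

definition coagulation_breakage_probabilities ::
    "(real \<Rightarrow> real \<Rightarrow> real) \<Rightarrow> (real \<Rightarrow> real \<Rightarrow> real) \<Rightarrow> bool" where
  "coagulation_breakage_probabilities E E' \<longleftrightarrow>
     (\<lambda>(\<mu>, \<nu>). E \<mu> \<nu>) \<in> borel_measurable (lebesgue_on ({0<..} \<times> {0<..})) \<and>
     (\<lambda>(\<mu>, \<nu>). E' \<mu> \<nu>) \<in> borel_measurable (lebesgue_on ({0<..} \<times> {0<..})) \<and>
     (\<forall>\<mu>>0. \<forall>\<nu>>0. E \<mu> \<nu> \<in> {0..1} \<and> E' \<mu> \<nu> \<in> {0..1} \<and>
        E \<mu> \<nu> = E \<nu> \<mu> \<and> E' \<mu> \<nu> = E' \<nu> \<mu> \<and> E \<mu> \<nu> + E' \<mu> \<nu> = 1)"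

text \<open>
  The right-hand sides of the two integral identities are nonzero, so the identities entail that
  the integrands are integrable (the integral of a non-integrable function is \<open>0\<close>).
\<close>

definition distribution_function :: "(real \<Rightarrow> real \<Rightarrow> real \<Rightarrow> real) \<Rightarrow> real \<Rightarrow> bool" where
  "distribution_function P N \<longleftrightarrow>
     (\<lambda>(\<mu>, \<nu>, \<tau>). P \<mu> \<nu> \<tau>)
        \<in> borel_measurable (lebesgue_on ({0<..} \<times> {0<..} \<times> {0<..})) \<and>
     (\<forall>\<mu>>0. \<forall>\<nu>>0. \<forall>\<tau>>0.
        0 \<le> P \<mu> \<nu> \<tau> \<and> P \<mu> \<nu> \<tau> = P \<mu> \<tau> \<nu> \<and> (\<mu> > \<nu> + \<tau> \<longrightarrow> P \<mu> \<nu> \<tau> = 0)) \<and>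
     2 \<le> N \<and>
     (\<forall>\<nu>>0. \<forall>\<tau>>0.
        (LINT \<mu>:{0<..<\<nu> + \<tau>}|lebesgue. \<mu> * P \<mu> \<nu> \<tau>) = \<nu> + \<tau> \<and>
        (LINT \<mu>:{0<..<\<nu> + \<tau>}|lebesgue. P \<mu> \<nu> \<tau>) = N)"


definition hyp_H2 :: "(real \<Rightarrow> real \<Rightarrow> real) \<Rightarrow> real \<Rightarrow> (real \<Rightarrow> real) \<Rightarrow> bool" where
  "hyp_H2 E N \<eta> \<longleftrightarrow>
     (\<forall>r\<in>{0..<1}. N \<le> \<eta> r) \<and>
     (\<forall>\<mu>\<in>{0<..<1}. \<forall>\<nu>\<in>{0<..<1}. \<forall>r\<in>{0..<1}. (\<eta> r - 2) / (\<eta> r - 1) \<le> E \<mu> \<nu>)"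

text \<open>
  Integrals whose convergence is part of the claim are taken in the extended nonnegative reals.
\<close>

definition hyp_H3 :: "(real \<Rightarrow> real \<Rightarrow> real \<Rightarrow> real) \<Rightarrow> (real \<Rightarrow> real) \<Rightarrow> bool" where
  "hyp_H3 P \<eta> \<longleftrightarrow>
     (\<forall>\<nu> \<tau>. \<forall>r\<in>{0..<1}. 0 < \<tau> \<and> \<tau> < \<nu> \<longrightarrow>
        (\<integral>\<^sup>+\<mu>\<in>{0<..<\<nu>}. ennreal (\<mu> powr (- r) * P \<mu> (\<nu> - \<tau>) \<tau>) \<partial>lebesgue)
          \<le> ennreal (\<eta> r * \<nu> powr (- r)))"

text \<open>
  In \<open>hyp_H4\<close> and \<open>hyp_H5\<close>, the threshold \<open>\<epsilon>\<close> making precise ``sufficiently small measure'' may depend on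
  \<open>l\<close>, but not on \<open>\<nu>\<close> and \<open>\<tau>\<close>.
\<close>

definition hyp_H4 :: "real \<Rightarrow> (real \<Rightarrow> real \<Rightarrow> real \<Rightarrow> real) \<Rightarrow> bool" where
  "hyp_H4 \<sigma> P \<longleftrightarrow>
     (\<forall>l>0. \<exists>\<theta>\<in>{0<..2 * \<sigma>}. \<exists>\<Omega>::real \<Rightarrow> real.
        (\<forall>\<delta>\<ge>0. 0 \<le> \<Omega> \<delta>) \<and> (\<Omega> \<longlongrightarrow> 0) (at_right 0) \<and>
        (\<exists>\<epsilon>>0. \<forall>\<nu> \<tau>. \<forall>A\<in>sets lebesgue.
           0 < \<nu> \<and> \<nu> < l \<and> 0 < \<tau> \<and> \<tau> < \<nu> \<and> A \<subseteq> {0<..<l} \<and> measure lebesgue A < \<epsilon> \<longrightarrow>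
           (\<integral>\<^sup>+\<mu>\<in>{0<..<\<nu>}. ennreal (indicator A \<mu> * P \<mu> (\<nu> - \<tau>) \<tau>) \<partial>lebesgue)
             \<le> ennreal (\<Omega> (measure lebesgue A) * \<nu> powr (- \<theta>))))"

definition hyp_H5 :: "real \<Rightarrow> (real \<Rightarrow> real \<Rightarrow> real \<Rightarrow> real) \<Rightarrow> bool" where
  "hyp_H5 \<sigma> P \<longleftrightarrow>
     (\<forall>l>0. \<exists>\<theta>\<in>{0<..2 * \<sigma>}. \<exists>\<Omega>::real \<Rightarrow> real.
        (\<forall>\<delta>\<ge>0. 0 \<le> \<Omega> \<delta>) \<and> (\<Omega> \<longlongrightarrow> 0) (at_right 0) \<and>
        (\<exists>\<epsilon>>0. \<forall>\<nu> \<tau>. \<forall>A\<in>sets lebesgue.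
           0 < \<nu> \<and> \<nu> < l \<and> 0 < \<tau> \<and> \<tau> < \<nu> \<and> A \<subseteq> {0<..<l} \<and> measure lebesgue A < \<epsilon> \<longrightarrow>
           (\<integral>\<^sup>+\<mu>\<in>{0<..<\<nu>}. ennreal (indicator A \<mu> * \<mu> powr (- \<sigma>) * P \<mu> (\<nu> - \<tau>) \<tau>)
                \<partial>lebesgue)
             \<le> ennreal (\<Omega> (measure lebesgue A) * \<nu> powr (- \<theta>))))"

definition hyp_H6 ::
    "real \<Rightarrow> (real \<Rightarrow> real \<Rightarrow> real \<Rightarrow> real) \<Rightarrow> real \<Rightarrow> (real \<Rightarrow> real) \<Rightarrow> bool" where
  "hyp_H6 \<sigma> P \<tau>2 k' \<longleftrightarrow>
     \<tau>2 \<in> {0..<1} \<and> \<tau>2 + \<sigma> < 1 \<and>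
     (\<forall>l>0. 0 < k' l \<and>
        (\<forall>\<nu>>0. \<forall>\<tau>>0. \<forall>\<mu>\<in>{0<..<l}. l < \<nu> + \<tau> \<longrightarrow> P \<mu> \<nu> \<tau> \<le> k' l * \<mu> powr (- \<tau>2)))"


text \<open>
  Elements of the space are represented by functions; two functions represent the same element
  iff they agree almost everywhere on the positive half line.
\<close>

definition S_weight :: "real \<Rightarrow> real \<Rightarrow> real" where
  "S_weight \<sigma> \<mu> = 1 + \<mu> + \<mu> powr (- 2 * \<sigma>)"

definition S_space :: "real \<Rightarrow> (real \<Rightarrow> real) set" where
  "S_space \<sigma> = {f. set_integrable lebesgue {0<..} (\<lambda>\<mu>. S_weight \<sigma> \<mu> * f \<mu>)}"

definition S_norm :: "real \<Rightarrow> (real \<Rightarrow> real) \<Rightarrow> real" where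
  "S_norm \<sigma> f = (LINT \<mu>:{0<..}|lebesgue. S_weight \<sigma> \<mu> * \<bar>f \<mu>\<bar>)"

definition S_cone :: "real \<Rightarrow> (real \<Rightarrow> real) set" where
  "S_cone \<sigma> = {f \<in> S_space \<sigma>. AE \<mu> in lebesgue. 0 < \<mu> \<longrightarrow> 0 \<le> f \<mu>}"

definition S_eq :: "(real \<Rightarrow> real) \<Rightarrow> (real \<Rightarrow> real) \<Rightarrow> bool" where
  "S_eq f h \<longleftrightarrow> (AE \<mu> in lebesgue. 0 < \<mu> \<longrightarrow> f \<mu> = h \<mu>)"


text \<open>
  The operators act on the spatial profile \<open>f = g(\<cdot>,t)\<close> at a fixed time. They are only applied to
  elements of the positive cone, so their integrands are nonnegative (almost everywhere) and their
  values are well defined in \<open>[0,\<infinity>]\<close>.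
\<close>

definition op_Bc ::
    "(real \<Rightarrow> real \<Rightarrow> real) \<Rightarrow> (real \<Rightarrow> real \<Rightarrow> real) \<Rightarrow> (real \<Rightarrow> real) \<Rightarrow> real \<Rightarrow> ennreal" where
  "op_Bc \<Psi> E f \<mu> =
     1/2 * (\<integral>\<^sup>+\<nu>\<in>{0<..<\<mu>}.
        ennreal (E (\<mu> - \<nu>) \<nu> * \<Psi> (\<mu> - \<nu>) \<nu> * f (\<mu> - \<nu>) * f \<nu>) \<partial>lebesgue)"

definition op_Dcb ::
    "(real \<Rightarrow> real \<Rightarrow> real) \<Rightarrow> (real \<Rightarrow> real) \<Rightarrow> real \<Rightarrow> ennreal" where
  "op_Dcb \<Psi> f \<mu> = (\<integral>\<^sup>+\<nu>\<in>{0<..}. ennreal (\<Psi> \<mu> \<nu> * f \<mu> * f \<nu>) \<partial>lebesgue)"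

definition op_Bb ::
    "(real \<Rightarrow> real \<Rightarrow> real) \<Rightarrow> (real \<Rightarrow> real \<Rightarrow> real) \<Rightarrow> (real \<Rightarrow> real \<Rightarrow> real \<Rightarrow> real) \<Rightarrow>
      (real \<Rightarrow> real) \<Rightarrow> real \<Rightarrow> ennreal" where
  "op_Bb \<Psi> E' P f \<mu> =
     1/2 * (\<integral>\<^sup>+\<nu>\<in>{\<mu><..}. (\<integral>\<^sup>+\<tau>\<in>{0<..<\<nu>}.
        ennreal (P \<mu> (\<nu> - \<tau>) \<tau> * E' (\<nu> - \<tau>) \<tau> * \<Psi> (\<nu> - \<tau>) \<tau> * f (\<nu> - \<tau>) * f \<tau>)
        \<partial>lebesgue) \<partial>lebesgue)"


text \<open>
  A function from a time interval into the space is given by representatives: \<open>g t \<mu>\<close> stands for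
  \<open>g(\<mu>,t)\<close>. In the integral equation, the finiteness and integrability conditions say that its
  right-hand side is meaningful.
\<close>

definition S_continuous_on :: "real \<Rightarrow> real set \<Rightarrow> (real \<Rightarrow> real \<Rightarrow> real) \<Rightarrow> bool" where
  "S_continuous_on \<sigma> I g \<longleftrightarrow>
     (\<forall>t\<in>I. ((\<lambda>s. S_norm \<sigma> (\<lambda>\<mu>. g s \<mu> - g t \<mu>)) \<longlongrightarrow> 0) (at t within I))"

definition weak_solution_on ::
    "real \<Rightarrow> (real \<Rightarrow> real \<Rightarrow> real) \<Rightarrow> (real \<Rightarrow> real \<Rightarrow> real) \<Rightarrow> (real \<Rightarrow> real \<Rightarrow> real) \<Rightarrow>
      (real \<Rightarrow> real \<Rightarrow> real \<Rightarrow> real) \<Rightarrow> (real \<Rightarrow> real) \<Rightarrow> real \<Rightarrow> (real \<Rightarrow> real \<Rightarrow> real) \<Rightarrow> bool" where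
  "weak_solution_on \<sigma> \<Psi> E E' P g_in T g \<longleftrightarrow>
     (\<forall>t\<in>{0..T}. g t \<in> S_cone \<sigma>) \<and>
     S_continuous_on \<sigma> {0..T} g \<and>
     (AE \<mu> in lebesgue. 0 < \<mu> \<longrightarrow> (\<forall>t\<in>{0..T}.
        (\<integral>\<^sup>+s\<in>{0..t}. (\<integral>\<^sup>+\<nu>\<in>{0<..}. ennreal (\<Psi> \<mu> \<nu> * g s \<nu>) \<partial>lebesgue) \<partial>lebesgue) < \<infinity> \<and>
        (\<integral>\<^sup>+s\<in>{0..t}. op_Bb \<Psi> E' P (g s) \<mu> \<partial>lebesgue) < \<infinity> \<and>
        (AE s in lebesgue. s \<in> {0..t} \<longrightarrow>
           op_Bc \<Psi> E (g s) \<mu> < \<infinity> \<and> op_Dcb \<Psi> (g s) \<mu> < \<infinity> \<and> op_Bb \<Psi> E' P (g s) \<mu> < \<infinity>) \<and>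
        set_integrable lebesgue {0..t}
          (\<lambda>s. enn2real (op_Bc \<Psi> E (g s) \<mu>) - enn2real (op_Dcb \<Psi> (g s) \<mu>)
                + enn2real (op_Bb \<Psi> E' P (g s) \<mu>)) \<and>
        g t \<mu> = g_in \<mu> +
          (LINT s:{0..t}|lebesgue.
             enn2real (op_Bc \<Psi> E (g s) \<mu>) - enn2real (op_Dcb \<Psi> (g s) \<mu>)
               + enn2real (op_Bb \<Psi> E' P (g s) \<mu>))))"

definition global_weak_solution ::
    "real \<Rightarrow> (real \<Rightarrow> real \<Rightarrow> real) \<Rightarrow> (real \<Rightarrow> real \<Rightarrow> real) \<Rightarrow> (real \<Rightarrow> real \<Rightarrow> real) \<Rightarrow>
      (real \<Rightarrow> real \<Rightarrow> real \<Rightarrow> real) \<Rightarrow> (real \<Rightarrow> real) \<Rightarrow> (real \<Rightarrow> real \<Rightarrow> real) \<Rightarrow> bool" where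
  "global_weak_solution \<sigma> \<Psi> E E' P g_in g \<longleftrightarrow>
     (\<forall>T>0. weak_solution_on \<sigma> \<Psi> E E' P g_in T g)"

end

theory Submission imports Defs begin

text \<open>
  Write \<open>w(x) = 1 + x + x powr (-2 \<sigma>)\<close> for the weight of the space. The theorem holds because the collision
  operators are bounded quadratic maps of the space into itself, so that the equation is an ordinary
  differential equation with a locally Lipschitz right-hand side, and because the moments that make
  up \<open>w\<close> obey a linear growth estimate, so that solutions do not blow up.

  Boundedness. The kernel satisfies \<open>\<Psi>(x,y) \<le> k w(y)\<close> and \<open>\<Psi>(x,y) w(x+y) \<le> 2 k w(x) w(y)\<close>. Conservation of
  mass and the fragment bound (H3) at the exponents \<open>0\<close> and \<open>2 \<sigma>\<close> show that the fragments of a pair \<open>(x,y)\<close>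
  have \<open>w\<close>-moment at most \<open>\<eta> w(x+y)\<close>. Together these give \<open>bilin_weight_bound\<close>.

  Existence. The loss term destroys monotonicity, but adding \<open>k (\<integral> w g) g\<close> to the right-hand side turns it
  into \<open>Q(g) = B\<^sub>c(g) + B\<^sub>b(g) + g \<integral> (k w(y) - \<Psi>(\<cdot>,y)) g(y) dy\<close>, a quadratic form with nonnegative coefficients.
  The equation \<open>\<partial>u = Q(u)\<close> is solved by an increasing iteration in \<open>[0,\<infinity>]\<close>, which always
  converges (locale \<open>monotone_evolution\<close>). The added term is then removed by rescaling. If
  \<open>U(\<tau>) = \<integral> w u(\<tau>)\<close>, \<open>\<phi> = exp(-k \<integral> U)\<close> and \<open>\<theta>(\<tau>) = \<integral> 1/\<phi>\<close>, then \<open>g(t) = \<phi>(\<tau>) u(\<tau>)\<close> at \<open>t = \<theta>(\<tau>)\<close> satisfies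
  \<open>\<partial>g = \<phi>\<^sup>2 Q(u) - k (\<phi> U) (\<phi> u) = Q(g) - k (\<integral> w g) g\<close>, which is the original equation. For almost every
  \<open>x\<close> this holds classically in \<open>t\<close>.

  Global existence. It remains to see that \<open>\<theta>\<close> is unbounded on the interval where \<open>U\<close> is finite
  (\<open>\<theta>_unbounded\<close>). For \<open>r \<in> {0, -2 \<sigma>}\<close> a collision replaces \<open>x powr r + y powr r\<close> by at most
  \<open>(E + \<eta> (1 - E)) (x + y) powr r\<close>. On the unit square (H2) says that \<open>E + \<eta> (1 - E) \<le> 2\<close>, and
  \<open>(x + y) powr r\<close> is at most the mean of \<open>x powr r\<close> and \<open>y powr r\<close>, so nothing is gained. Off the square
  either \<open>x\<close> or \<open>y\<close> is at least \<open>1\<close>, and the gain is at most a multiple of \<open>x + y\<close>; integrated against \<open>g g\<close> this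
  is mass times number. As the mass does not grow, number and singular moment grow at most
  exponentially in \<open>t\<close>.

  Uniqueness. The difference of two solutions satisfies a Gronwall inequality in the weighted norm.
  Exchanging the integrals in \<open>x\<close> and \<open>t\<close> requires joint measurability, which a continuous curve of
  equivalence classes does not offer by itself; it is recovered from the continuity in \<open>t\<close> that the
  integral equation forces for almost every \<open>x\<close> (\<open>weak_solution_joint_version\<close>).

  The coefficients are Lebesgue measurable and their bounds on integrals hold only for the given
  representatives. They are replaced by Borel functions that satisfy all bounds everywhere; for almost
  every \<open>x\<close> the operators at \<open>x\<close> stay the same for all profiles at once (\<open>AE_operators_agree\<close>).
\<close>

section \<open>Measurability and integration\<close>

abbreviation joint_borel :: "(real \<Rightarrow> real \<Rightarrow> 'b::topological_space) \<Rightarrow> bool" where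
  "joint_borel u \<equiv> case_prod u \<in> borel_measurable (borel \<Otimes>\<^sub>M borel)"

abbreviation enn :: "(real \<Rightarrow> real) \<Rightarrow> real \<Rightarrow> ennreal" where "enn f \<equiv> (\<lambda>x. ennreal (f x))"

lemma pred_mem_Icc [measurable (raw)]:
  fixes f g h :: "'a \<Rightarrow> real"
  assumes [measurable]: "f \<in> borel_measurable M" "g \<in> borel_measurable M" "h \<in> borel_measurable M"
  shows "Measurable.pred M (\<lambda>x. f x \<in> {g x..h x})"
  unfolding atLeastAtMost_iff by measurable

lemma measurable_section_fst:
  assumes "case_prod f \<in> measurable (borel \<Otimes>\<^sub>M borel) N"
  shows "(\<lambda>s. f s x) \<in> measurable borel N"
  using measurable_compose[OF _ assms, of "\<lambda>s. (s, x)" borel] by simp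

lemma nn_integral_shift_lborel:
  fixes f :: "real \<Rightarrow> ennreal"
  assumes [measurable]: "f \<in> borel_measurable borel"
  shows "(\<integral>\<^sup>+x. f (c + x) \<partial>lborel) = (\<integral>\<^sup>+x. f x \<partial>lborel)"
proof -
  have "(\<integral>\<^sup>+x. f x \<partial>lborel) = (\<integral>\<^sup>+x. f x \<partial>distr lborel borel ((+) c))"
    by (simp add: lborel_distr_plus)
  also have "\<dots> = (\<integral>\<^sup>+x. f (c + x) \<partial>lborel)"
    by (subst nn_integral_distr) auto
  finally show ?thesis by simp
qed

lemma SUP_Suc_eq_SUP:
  fixes f :: "nat \<Rightarrow> ennreal"
  assumes "incseq f" shows "(SUP n. f (Suc n)) = (SUP n. f n)"
proof (rule antisym)
  show "(SUP n. f (Suc n)) \<le> (SUP n. f n)" by (rule SUP_least) (auto intro: SUP_upper)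
  show "(SUP n. f n) \<le> (SUP n. f (Suc n))"
    by (rule SUP_mono) (use assms in \<open>auto simp: incseq_Suc_iff\<close>)
qed

section \<open>Monotone quadratic evolution equations\<close>

text \<open>
  The ordinary differential equation \<open>\<partial>u = Q(u)\<close> for a monotone \<open>Q\<close> on functions with values in
  \<open>[0,\<infinity>]\<close> that is continuous along increasing sequences. Its least solution exists for all times, but it is meaningful only as long as its
  weighted integral is finite; \<open>Q_bound\<close> controls that.
\<close>

locale monotone_evolution =
  fixes Q :: "(real \<Rightarrow> ennreal) \<Rightarrow> real \<Rightarrow> ennreal"
    and w :: "real \<Rightarrow> ennreal" and C :: real
  assumes Q_mono: "\<And>f g x. (\<And>y. f y \<le> g y) \<Longrightarrow> Q f x \<le> Q g x"
    and Q_measurable: "\<And>u :: real \<Rightarrow> real \<Rightarrow> ennreal. joint_borel u \<Longrightarrow>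
          (\<lambda>(s, x). Q (u s) x) \<in> borel_measurable (borel \<Otimes>\<^sub>M borel)"
    and Q_SUP: "\<And>F x. incseq F \<Longrightarrow> (\<And>n. F n \<in> borel_measurable borel) \<Longrightarrow>
          Q (\<lambda>y. SUP n::nat. F n y) x = (SUP n. Q (F n) x)"
    and w_measurable [measurable]: "w \<in> borel_measurable borel"
    and Q_bound: "\<And>f. f \<in> borel_measurable borel \<Longrightarrow>
          (\<integral>\<^sup>+x. w x * Q f x \<partial>lborel) \<le> ennreal C * (\<integral>\<^sup>+x. w x * f x \<partial>lborel)\<^sup>2"
    and C_nonneg: "0 \<le> C"
begin

text \<open>
  Picard iteration from the constant curve. It is increasing in the number of steps, so its supremum
  solves the equation without any estimate.
\<close>

primrec iter :: "(real \<Rightarrow> ennreal) \<Rightarrow> nat \<Rightarrow> real \<Rightarrow> real \<Rightarrow> ennreal" where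
  "iter f0 0 = (\<lambda>\<tau> x. f0 x)"
| "iter f0 (Suc n) = (\<lambda>\<tau> x. f0 x + (\<integral>\<^sup>+s\<in>{0..\<tau>}. Q (iter f0 n s) x \<partial>lborel))"

definition flow :: "(real \<Rightarrow> ennreal) \<Rightarrow> real \<Rightarrow> real \<Rightarrow> ennreal" where
  "flow f0 \<tau> x = (SUP n. iter f0 n \<tau> x)"

lemma iter_measurable:
  assumes [measurable]: "f0 \<in> borel_measurable borel"
  shows "joint_borel (iter f0 n)"
proof (induction n)
  case 0
  show ?case by simp
next
  case (Suc n)
  have [measurable]: "(\<lambda>(s, x). Q (iter f0 n s) x) \<in> borel_measurable (borel \<Otimes>\<^sub>M borel)"
    by (rule Q_measurable) (rule Suc)
  show ?case by simp measurable
qed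

lemma iter_le_Suc: "iter f0 n \<tau> x \<le> iter f0 (Suc n) \<tau> x"
proof (induction n arbitrary: \<tau> x)
  case 0
  show ?case by simp
next
  case (Suc n)
  show ?case
    apply (subst (1 2) iter.simps)
    by (intro add_left_mono nn_integral_mono mult_right_mono Q_mono Suc) auto
qed

lemma iter_incseq: "incseq (\<lambda>n. iter f0 n \<tau> x)"
  by (rule incseq_SucI) (rule iter_le_Suc)

lemma iter_le_flow: "iter f0 n \<tau> x \<le> flow f0 \<tau> x"
  unfolding flow_def by (rule SUP_upper) simp

lemma iter_section_measurable:
  assumes [measurable]: "f0 \<in> borel_measurable borel"
  shows "iter f0 n \<tau> \<in> borel_measurable borel"
  using measurable_compose_Pair1[OF _ iter_measurable[OF assms], of \<tau> n]
  by (simp add: )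

lemma flow_measurable:
  assumes "f0 \<in> borel_measurable borel"
  shows "joint_borel (flow f0)"
proof -
  have "case_prod (flow f0) = (\<lambda>z. SUP n. case_prod (iter f0 n) z)"
    by (auto simp: flow_def)
  then show ?thesis using iter_measurable[OF assms] by simp
qed

lemma flow_section_measurable:
  assumes [measurable]: "f0 \<in> borel_measurable borel"
  shows "flow f0 \<tau> \<in> borel_measurable borel"
  using measurable_compose_Pair1[OF _ flow_measurable[OF assms], of \<tau>] by simp

lemma Q_flow_measurable:
  assumes "f0 \<in> borel_measurable borel"
  shows "(\<lambda>(s, x). Q (flow f0 s) x) \<in> borel_measurable (borel \<Otimes>\<^sub>M borel)"
  by (rule Q_measurable) (rule flow_measurable[OF assms])

lemma Q_flow_section_measurable:
  assumes "f0 \<in> borel_measurable borel"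
  shows "(\<lambda>x. Q (flow f0 s) x) \<in> borel_measurable borel"
        "(\<lambda>s. Q (flow f0 s) x) \<in> borel_measurable borel"
  using measurable_compose_Pair1[OF _ Q_flow_measurable[OF assms], of s]
    measurable_section_fst[OF Q_flow_measurable[OF assms], of x] by auto

lemma flow_equation:
  assumes [measurable]: "f0 \<in> borel_measurable borel"
  shows "flow f0 \<tau> x = f0 x + (\<integral>\<^sup>+s\<in>{0..\<tau>}. Q (flow f0 s) x \<partial>lborel)"
proof -
  have m: "(\<lambda>s. Q (iter f0 n s) x) \<in> borel_measurable borel" for n
    using measurable_section_fst[OF Q_measurable[OF iter_measurable[OF assms, of n]], of x]
    by auto
  have inc: "incseq (\<lambda>n s. Q (iter f0 n s) x * indicator {0..\<tau>} s)"
    by (intro incseq_SucI le_funI mult_right_mono Q_mono iter_le_Suc) auto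
  have "flow f0 \<tau> x = (SUP n. iter f0 (Suc n) \<tau> x)"
    unfolding flow_def by (rule SUP_Suc_eq_SUP[symmetric]) (rule iter_incseq)
  also have "\<dots> = (SUP n. f0 x + (\<integral>\<^sup>+s\<in>{0..\<tau>}. Q (iter f0 n s) x \<partial>lborel))" by simp
  also have "\<dots> = f0 x + (SUP n. (\<integral>\<^sup>+s\<in>{0..\<tau>}. Q (iter f0 n s) x \<partial>lborel))"
    by (subst ennreal_SUP_add_right) auto
  also have "(SUP n. (\<integral>\<^sup>+s\<in>{0..\<tau>}. Q (iter f0 n s) x \<partial>lborel))
      = (\<integral>\<^sup>+s. (SUP n. Q (iter f0 n s) x * indicator {0..\<tau>} s) \<partial>lborel)"
    by (rule nn_integral_monotone_convergence_SUP[symmetric, OF inc]) (use m in measurable)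
  also have "\<dots> = (\<integral>\<^sup>+s\<in>{0..\<tau>}. Q (flow f0 s) x \<partial>lborel)"
  proof (rule nn_integral_cong)
    fix s
    have "(\<lambda>y. SUP n. iter f0 n s y) = flow f0 s" by (auto simp: flow_def)
    moreover have "Q (\<lambda>y. SUP n. iter f0 n s y) x = (SUP n. Q (iter f0 n s) x)"
      by (rule Q_SUP) (use iter_section_measurable[OF assms] in \<open>auto intro!: incseq_SucI le_funI iter_le_Suc\<close>)
    ultimately show "(SUP n. Q (iter f0 n s) x * indicator {0..\<tau>} s) = Q (flow f0 s) x * indicator {0..\<tau>} s"
      by (simp add: SUP_mult_right_ennreal)
  qed
  finally show ?thesis .
qed

lemma flow_split:
  assumes [measurable]: "f0 \<in> borel_measurable borel" and "0 \<le> a" "a \<le> b"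
  shows "flow f0 b x = flow f0 a x + (\<integral>\<^sup>+s\<in>{a..b}. Q (flow f0 s) x \<partial>lborel)"
proof -
  note [measurable] = Q_flow_section_measurable(2)[OF assms(1)]
  have "(\<integral>\<^sup>+s\<in>{0..b}. Q (flow f0 s) x \<partial>lborel)
      = (\<integral>\<^sup>+s. Q (flow f0 s) x * indicator {0..a} s + Q (flow f0 s) x * indicator {a..b} s \<partial>lborel)"
  proof (rule nn_integral_cong_AE)
    have "AE s in lborel. s \<noteq> a" by (rule AE_lborel_singleton)
    then show "AE s in lborel. Q (flow f0 s) x * indicator {0..b} s
        = Q (flow f0 s) x * indicator {0..a} s + Q (flow f0 s) x * indicator {a..b} s"
      by eventually_elim (use assms in \<open>auto simp: indicator_def\<close>)
  qed
  also have "\<dots> = (\<integral>\<^sup>+s\<in>{0..a}. Q (flow f0 s) x \<partial>lborel) + (\<integral>\<^sup>+s\<in>{a..b}. Q (flow f0 s) x \<partial>lborel)"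
    by (rule nn_integral_add) measurable
  finally show ?thesis
    by (simp add: flow_equation[OF assms(1), of b x] flow_equation[OF assms(1), of a x] add.assoc)
qed

lemma flow_mono:
  assumes "f0 \<in> borel_measurable borel" and "0 \<le> a" "a \<le> b"
  shows "flow f0 a x \<le> flow f0 b x"
  by (subst flow_split[OF assms]) simp

lemma flow_0: 
  assumes "f0 \<in> borel_measurable borel" shows "flow f0 0 x = f0 x"
proof -
  have "AE s in lborel. s \<noteq> (0::real)" by (rule AE_lborel_singleton)
  then have "(\<integral>\<^sup>+s\<in>{0..0}. Q (flow f0 s) x \<partial>lborel) = (\<integral>\<^sup>+s. 0 \<partial>(lborel::real measure))"
    by (intro nn_integral_cong_AE) (auto elim!: eventually_mono)
  then show ?thesis by (subst flow_equation[OF assms]) simp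
qed

lemma moment_split:
  assumes f0: "f0 \<in> borel_measurable borel" and [measurable]: "\<omega> \<in> borel_measurable borel"
    and ab: "0 \<le> a" "a \<le> b"
  shows "(\<integral>\<^sup>+x. \<omega> x * flow f0 b x \<partial>lborel)
    = (\<integral>\<^sup>+x. \<omega> x * flow f0 a x \<partial>lborel)
      + (\<integral>\<^sup>+s\<in>{a..b}. (\<integral>\<^sup>+x. \<omega> x * Q (flow f0 s) x \<partial>lborel) \<partial>lborel)"
proof -
  note [measurable] = Q_flow_section_measurable[OF f0] flow_section_measurable[OF f0]
    Q_flow_measurable[OF f0]
  have "(\<integral>\<^sup>+x. \<omega> x * flow f0 b x \<partial>lborel)
      = (\<integral>\<^sup>+x. \<omega> x * flow f0 a x + \<omega> x * (\<integral>\<^sup>+s\<in>{a..b}. Q (flow f0 s) x \<partial>lborel) \<partial>lborel)"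
    by (subst flow_split[OF f0 ab]) (simp add: distrib_left)
  also have "\<dots> = (\<integral>\<^sup>+x. \<omega> x * flow f0 a x \<partial>lborel)
      + (\<integral>\<^sup>+x. \<omega> x * (\<integral>\<^sup>+s\<in>{a..b}. Q (flow f0 s) x \<partial>lborel) \<partial>lborel)"
    by (rule nn_integral_add) measurable
  also have "(\<integral>\<^sup>+x. \<omega> x * (\<integral>\<^sup>+s\<in>{a..b}. Q (flow f0 s) x \<partial>lborel) \<partial>lborel)
      = (\<integral>\<^sup>+x. (\<integral>\<^sup>+s. \<omega> x * (Q (flow f0 s) x * indicator {a..b} s) \<partial>lborel) \<partial>lborel)"
    by (intro nn_integral_cong nn_integral_cmult[symmetric]) measurable
  also have "\<dots> = (\<integral>\<^sup>+s. (\<integral>\<^sup>+x. \<omega> x * (Q (flow f0 s) x * indicator {a..b} s) \<partial>lborel) \<partial>lborel)"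
    by (rule lborel_pair.Fubini') measurable
  also have "\<dots> = (\<integral>\<^sup>+s\<in>{a..b}. (\<integral>\<^sup>+x. \<omega> x * Q (flow f0 s) x \<partial>lborel) \<partial>lborel)"
    by (intro nn_integral_cong) (auto simp: indicator_def)
  finally show ?thesis .
qed

text \<open>
  The flow is the least solution: every iterate stays below any curve that solves the integral
  equation from time \<open>a\<close> on and dominates it at time \<open>a\<close>. The curve restarted at \<open>flow f0 a\<close> is such a curve.
\<close>

lemma flow_restart:
  assumes f0: "f0 \<in> borel_measurable borel" and "0 \<le> a" "0 \<le> s"
  shows "flow f0 (a + s) x \<le> flow (flow f0 a) s x"
proof -
  note [measurable] = Q_flow_section_measurable[OF f0] flow_section_measurable[OF f0]
    Q_flow_measurable[OF f0]
  have f1: "flow f0 a \<in> borel_measurable borel" by measurable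
  have "iter f0 n (a + s) x \<le> flow (flow f0 a) s x" if "0 \<le> s" for n s x
    using that
  proof (induction n arbitrary: s x)
    case 0
    have "f0 x = iter f0 0 a x" by simp
    also have "\<dots> \<le> flow f0 a x" by (rule iter_le_flow)
    also have "\<dots> = flow (flow f0 a) 0 x" by (rule flow_0[OF f1, symmetric])
    also have "\<dots> \<le> flow (flow f0 a) s x" by (rule flow_mono[OF f1 _ 0]) simp
    finally show ?case by simp
  next
    case (Suc n)
    have [measurable]: "(\<lambda>(s, x). Q (iter f0 n s) x) \<in> borel_measurable (borel \<Otimes>\<^sub>M borel)"
      by (rule Q_measurable) (rule iter_measurable[OF f0])
    have "(\<integral>\<^sup>+r\<in>{0..a+s}. Q (iter f0 n r) x \<partial>lborel)
        \<le> (\<integral>\<^sup>+r. Q (iter f0 n r) x * indicator {0..a} r + Q (iter f0 n r) x * indicator {a..a+s} r \<partial>lborel)"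
      by (intro nn_integral_mono) (auto simp: indicator_def)
    also have "\<dots> = (\<integral>\<^sup>+r\<in>{0..a}. Q (iter f0 n r) x \<partial>lborel) + (\<integral>\<^sup>+r\<in>{a..a+s}. Q (iter f0 n r) x \<partial>lborel)"
      by (rule nn_integral_add) measurable
    also have "(\<integral>\<^sup>+r\<in>{a..a+s}. Q (iter f0 n r) x \<partial>lborel)
        = (\<integral>\<^sup>+r. Q (iter f0 n (a + r)) x * indicator {a..a+s} (a + r) \<partial>lborel)"
      by (rule nn_integral_shift_lborel[symmetric]) measurable
    also have "\<dots> \<le> (\<integral>\<^sup>+r\<in>{0..s}. Q (flow (flow f0 a) r) x \<partial>lborel)"
      by (intro nn_integral_mono) (auto simp: indicator_def intro!: Q_mono Suc.IH)
    also have "(\<integral>\<^sup>+r\<in>{0..a}. Q (iter f0 n r) x \<partial>lborel) \<le> (\<integral>\<^sup>+r\<in>{0..a}. Q (flow f0 r) x \<partial>lborel)"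
      by (intro nn_integral_mono mult_right_mono Q_mono iter_le_flow) auto
    finally have *: "(\<integral>\<^sup>+r\<in>{0..a+s}. Q (iter f0 n r) x \<partial>lborel)
        \<le> (\<integral>\<^sup>+r\<in>{0..a}. Q (flow f0 r) x \<partial>lborel) + (\<integral>\<^sup>+r\<in>{0..s}. Q (flow (flow f0 a) r) x \<partial>lborel)"
      by (simp add: add_mono)
    have "iter f0 (Suc n) (a + s) x = f0 x + (\<integral>\<^sup>+r\<in>{0..a+s}. Q (iter f0 n r) x \<partial>lborel)" by simp
    also have "\<dots> \<le> f0 x + ((\<integral>\<^sup>+r\<in>{0..a}. Q (flow f0 r) x \<partial>lborel) + (\<integral>\<^sup>+r\<in>{0..s}. Q (flow (flow f0 a) r) x \<partial>lborel))"
      by (rule add_left_mono[OF *])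
    also have "\<dots> = flow (flow f0 a) s x"
      by (simp add: flow_equation[OF f1, of s x] flow_equation[OF f0, of a x] add.assoc)
    finally show ?case .
  qed
  then show ?thesis
    unfolding flow_def[of f0 "a + s"] using assms by (auto intro: SUP_least)
qed

abbreviation weight :: "(real \<Rightarrow> ennreal) \<Rightarrow> ennreal" where
  "weight f \<equiv> (\<integral>\<^sup>+x. w x * f x \<partial>lborel)"

text \<open>
  The quadratic bound lets the weighted integral at most double in a time proportional to the inverse
  of its initial value. The length of this time depends on \<open>A\<close> alone, which is what makes continuation
  possible.
\<close>

lemma weight_flow_bound:
  assumes f0: "f0 \<in> borel_measurable borel" and A: "weight f0 \<le> ennreal A" "0 \<le> A"
    and \<tau>: "0 \<le> \<tau>" "4 * C * A * \<tau> \<le> 1"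
  shows "weight (flow f0 \<tau>) \<le> ennreal (2 * A)"
proof -
  have iter_bound: "weight (iter f0 n s) \<le> ennreal (2 * A)" if "0 \<le> s" "s \<le> \<tau>" for n s
    using that
  proof (induction n arbitrary: s)
    case 0
    have "ennreal A \<le> ennreal (2 * A)" using A by (intro ennreal_leI) auto
    then show ?case using A by (auto intro: order_trans)
  next
    case (Suc n)
    have [measurable]: "(\<lambda>(s, x). Q (iter f0 n s) x) \<in> borel_measurable (borel \<Otimes>\<^sub>M borel)"
      by (rule Q_measurable) (rule iter_measurable[OF f0])
    note [measurable] = f0
    have "weight (iter f0 (Suc n) s) = (\<integral>\<^sup>+x. w x * f0 x + w x * (\<integral>\<^sup>+r\<in>{0..s}. Q (iter f0 n r) x \<partial>lborel) \<partial>lborel)"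
      by (simp add: distrib_left)
    also have "\<dots> = weight f0 + (\<integral>\<^sup>+x. w x * (\<integral>\<^sup>+r\<in>{0..s}. Q (iter f0 n r) x \<partial>lborel) \<partial>lborel)"
      by (rule nn_integral_add) measurable
    also have "(\<integral>\<^sup>+x. w x * (\<integral>\<^sup>+r\<in>{0..s}. Q (iter f0 n r) x \<partial>lborel) \<partial>lborel)
        = (\<integral>\<^sup>+x. (\<integral>\<^sup>+r. w x * (Q (iter f0 n r) x * indicator {0..s} r) \<partial>lborel) \<partial>lborel)"
      by (intro nn_integral_cong nn_integral_cmult[symmetric]) measurable
    also have "\<dots> = (\<integral>\<^sup>+r. (\<integral>\<^sup>+x. w x * (Q (iter f0 n r) x * indicator {0..s} r) \<partial>lborel) \<partial>lborel)"
      by (rule lborel_pair.Fubini') measurable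
    also have "\<dots> = (\<integral>\<^sup>+r\<in>{0..s}. weight (Q (iter f0 n r)) \<partial>lborel)"
      by (intro nn_integral_cong) (auto simp: indicator_def)
    also have "\<dots> \<le> (\<integral>\<^sup>+r\<in>{0..s}. ennreal (C * (2 * A)\<^sup>2) \<partial>lborel)"
    proof (rule nn_integral_mono)
      fix r
      have "weight (Q (iter f0 n r)) \<le> ennreal (C * (2 * A)\<^sup>2)" if "r \<in> {0..s}"
      proof -
        have "weight (Q (iter f0 n r)) \<le> ennreal C * (weight (iter f0 n r))\<^sup>2"
          by (rule Q_bound) (rule iter_section_measurable[OF f0])
        also have "\<dots> \<le> ennreal C * (ennreal (2 * A))\<^sup>2"
          by (intro mult_left_mono power_mono Suc.IH) (use that Suc.prems in auto)
        also have "\<dots> = ennreal (C * (2 * A)\<^sup>2)"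
          using A C_nonneg by (simp add: ennreal_power ennreal_mult)
        finally show ?thesis .
      qed
      then show "weight (Q (iter f0 n r)) * indicator {0..s} r \<le> ennreal (C * (2 * A)\<^sup>2) * indicator {0..s} r"
        by (auto simp: indicator_def)
    qed
    also have "\<dots> = ennreal (C * (2 * A)\<^sup>2 * s)"
      using Suc.prems A C_nonneg by (simp add: nn_integral_cmult_indicator ennreal_mult)
    also have "weight f0 + ennreal (C * (2 * A)\<^sup>2 * s) \<le> ennreal A + ennreal (C * (2 * A)\<^sup>2 * s)"
      using A by (intro add_right_mono) auto
    also have "\<dots> = ennreal (A + C * (2 * A)\<^sup>2 * s)"
      using Suc.prems A C_nonneg by (intro ennreal_plus[symmetric]) auto
    also have "\<dots> \<le> ennreal (2 * A)"
    proof (rule ennreal_leI)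
      have "C * A * s \<le> C * A * \<tau>" using Suc.prems A C_nonneg by (intro mult_left_mono) auto
      then have "4 * C * A * s \<le> 1" using \<tau> by simp
      then have "A * (4 * C * A * s) \<le> A * 1" using A by (intro mult_left_mono) auto
      then show "A + C * (2 * A)\<^sup>2 * s \<le> 2 * A" by (simp add: power2_eq_square algebra_simps)
    qed
    finally show ?case by (simp add: add_left_mono)
  qed
  have "weight (flow f0 \<tau>) = (\<integral>\<^sup>+x. (SUP n. w x * iter f0 n \<tau> x) \<partial>lborel)"
    by (simp add: flow_def SUP_mult_left_ennreal)
  also have "\<dots> = (SUP n. weight (iter f0 n \<tau>))"
    using iter_section_measurable[OF f0]
    by (intro nn_integral_monotone_convergence_SUP incseq_SucI le_funI mult_left_mono iter_le_Suc) auto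
  also have "\<dots> \<le> ennreal (2 * A)"
    by (rule SUP_least) (use iter_bound \<tau> in auto)
  finally show ?thesis .
qed

end


section \<open>The weight and the collision operators\<close>

lemma SUP_mult_incseq_ennreal:
  fixes f g :: "nat \<Rightarrow> ennreal"
  assumes "incseq f" "incseq g"
  shows "(SUP n. f n * g n) = (SUP n. f n) * (SUP n. g n)"
proof (rule antisym)
  show "(SUP n. f n * g n) \<le> (SUP n. f n) * (SUP n. g n)"
    by (intro SUP_least mult_mono SUP_upper) auto
  have "f n * g m \<le> (SUP n. f n * g n)" for n m
  proof (rule SUP_upper2[of "max n m"])
    show "f n * g m \<le> f (max n m) * g (max n m)"
      by (intro mult_mono incseqD[OF assms(1)] incseqD[OF assms(2)]) auto
  qed simp
  then show "(SUP n. f n) * (SUP n. g n) \<le> (SUP n. f n * g n)"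
    by (simp add: SUP_mult_left_ennreal SUP_mult_right_ennreal SUP_le_iff)
qed

lemma S_weight_ge_one: "0 \<le> x \<Longrightarrow> 1 \<le> S_weight \<sigma> x"
  by (simp add: S_weight_def)

lemma powr_neg_le_S_weight:
  assumes "0 < \<sigma>" "0 < x" shows "x powr (-\<sigma>) \<le> S_weight \<sigma> x"
proof (cases "1 \<le> x")
  case True
  then have "x powr (-\<sigma>) \<le> 1 powr (-\<sigma>)" using assms by (intro powr_mono2') auto
  then show ?thesis using S_weight_ge_one[of x \<sigma>] assms by simp
next
  case False
  then have "x powr (-\<sigma>) \<le> x powr (-2 * \<sigma>)" using assms by (intro powr_mono') auto
  then show ?thesis using assms by (simp add: S_weight_def)
qed

text \<open>
  As \<open>w(x+y) \<le> w(x) + y\<close>, the negative power of \<open>x + y\<close> may be bounded by \<open>w(y)\<close> next to \<open>w(x)\<close>, and by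
  \<open>w(x)\<close> next to \<open>y\<close>.
\<close>

lemma kernel_S_weight_bound:
  assumes "0 < \<sigma>" "0 < x" "0 < y"
  shows "(x + y) powr (-\<sigma>) * S_weight \<sigma> (x + y) \<le> 2 * (S_weight \<sigma> x * S_weight \<sigma> y)"
proof -
  have x: "(x + y) powr (-\<sigma>) \<le> S_weight \<sigma> x"
    using powr_mono2'[of "-\<sigma>" x "x + y"] powr_neg_le_S_weight[of \<sigma> x] assms by simp
  have y: "(x + y) powr (-\<sigma>) \<le> S_weight \<sigma> y"
    using powr_mono2'[of "-\<sigma>" y "x + y"] powr_neg_le_S_weight[of \<sigma> y] assms by simp
  have "S_weight \<sigma> (x + y) \<le> S_weight \<sigma> x + y"
    using powr_mono2'[of "-2 * \<sigma>" x "x + y"] assms by (simp add: S_weight_def)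
  then have "(x + y) powr (-\<sigma>) * S_weight \<sigma> (x + y)
      \<le> (x + y) powr (-\<sigma>) * S_weight \<sigma> x + (x + y) powr (-\<sigma>) * y"
    by (metis distrib_left mult_left_mono powr_ge_zero)
  also have "\<dots> \<le> S_weight \<sigma> y * S_weight \<sigma> x + S_weight \<sigma> x * S_weight \<sigma> y"
    using x y S_weight_ge_one[of x \<sigma>] assms
    by (intro add_mono mult_mono) (auto simp: S_weight_def)
  finally show ?thesis by (simp add: mult.commute)
qed

text \<open>
  The powers are cut off at \<open>0\<close>, so that moments are integrals over the real line. The exponent \<open>0\<close> gives the
  indicator function of the half line.
\<close>

definition pos_powr :: "real \<Rightarrow> real \<Rightarrow> real" where
  "pos_powr r x = (if 0 < x then x powr r else 0)"

lemma pos_powr_measurable [measurable]: "pos_powr r \<in> borel_measurable borel"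
  unfolding pos_powr_def by measurable

lemma pos_powr_nonneg [simp]: "0 \<le> pos_powr r x" by (simp add: pos_powr_def)

definition half_line_weight :: "real \<Rightarrow> real \<Rightarrow> real" where
  "half_line_weight \<sigma> x = (if 0 < x then S_weight \<sigma> x else 0)"

lemma half_line_weight_measurable [measurable]: "half_line_weight \<sigma> \<in> borel_measurable borel"
  unfolding half_line_weight_def S_weight_def by measurable

lemma half_line_weight_nonneg [simp]: "0 \<le> half_line_weight \<sigma> x"
  by (simp add: half_line_weight_def S_weight_def)

lemma half_line_weight_eq_powers:
  "half_line_weight \<sigma> x = pos_powr 0 x + pos_powr 1 x + pos_powr (-2 * \<sigma>) x"
  by (simp add: half_line_weight_def S_weight_def pos_powr_def)

text \<open>
  Borel data for which all bounds hold at every pair of sizes, with \<open>\<Psi>\<close> extended by zero to sizes that are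
  not positive. The constant \<open>\<eta>\<close> serves both exponents \<open>0\<close> and \<open>-2 \<sigma>\<close>, and \<open>1 - E\<close> takes the place of the
  breakage probability.
\<close>

locale collision_model =
  fixes \<Psi> E :: "real \<Rightarrow> real \<Rightarrow> real" and P :: "real \<Rightarrow> real \<Rightarrow> real \<Rightarrow> real" and k \<sigma> \<eta> :: real
  assumes \<Psi>_measurable [measurable]: "joint_borel \<Psi>"
    and E_measurable [measurable]: "joint_borel E"
    and P_measurable: "(\<lambda>(m, x, y). P m x y) \<in> borel_measurable (borel \<Otimes>\<^sub>M borel \<Otimes>\<^sub>M borel)"
    and k_nonneg: "0 \<le> k" and \<sigma>_pos: "0 < \<sigma>" and \<sigma>_less: "\<sigma> < 1/2" and \<eta>_ge: "2 \<le> \<eta>"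
    and \<Psi>_nonneg [simp]: "0 \<le> \<Psi> x y" and \<Psi>_sym: "\<Psi> x y = \<Psi> y x"
    and \<Psi>_outside: "\<not> (0 < x \<and> 0 < y) \<Longrightarrow> \<Psi> x y = 0"
    and \<Psi>_le: "0 < x \<Longrightarrow> 0 < y \<Longrightarrow> \<Psi> x y \<le> k * (x + y) powr (-\<sigma>)"
    and E_nonneg [simp]: "0 \<le> E x y" and E_le_1 [simp]: "E x y \<le> 1"
    and E_unit_square: "0 < x \<Longrightarrow> x < 1 \<Longrightarrow> 0 < y \<Longrightarrow> y < 1 \<Longrightarrow> E x y + \<eta> * (1 - E x y) \<le> 2"
    and P_nonneg [simp]: "0 \<le> P m x y"
    and P_outside: "\<not> (0 < m \<and> m < x + y) \<Longrightarrow> P m x y = 0"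
    and P_number: "0 < x \<Longrightarrow> 0 < y \<Longrightarrow> (\<integral>\<^sup>+m. ennreal (P m x y) \<partial>lborel) \<le> ennreal \<eta>"
    and P_mass: "0 < x \<Longrightarrow> 0 < y \<Longrightarrow> (\<integral>\<^sup>+m. ennreal (m * P m x y) \<partial>lborel) \<le> ennreal (x + y)"
    and P_singular: "0 < x \<Longrightarrow> 0 < y \<Longrightarrow>
      (\<integral>\<^sup>+m. ennreal (m powr (-2 * \<sigma>) * P m x y) \<partial>lborel) \<le> ennreal (\<eta> * (x + y) powr (-2 * \<sigma>))"
begin

lemma P_measurable' [measurable (raw)]:
  assumes [measurable]: "a \<in> borel_measurable M" "b \<in> borel_measurable M" "c \<in> borel_measurable M"
  shows "(\<lambda>z. P (a z) (b z) (c z)) \<in> borel_measurable M"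
  using measurable_compose[OF _ P_measurable, of "\<lambda>z. (a z, b z, c z)" M] by simp

definition fragment_moment :: "(real \<Rightarrow> ennreal) \<Rightarrow> real \<Rightarrow> real \<Rightarrow> ennreal" where
  "fragment_moment \<omega> x y = (\<integral>\<^sup>+m. \<omega> m * ennreal (P m x y) \<partial>lborel)"

lemma fragment_moment_measurable [measurable]:
  assumes [measurable]: "\<omega> \<in> borel_measurable borel"
  shows "joint_borel (fragment_moment \<omega>)"
  unfolding fragment_moment_def by measurable

definition coag :: "(real \<Rightarrow> ennreal) \<Rightarrow> (real \<Rightarrow> ennreal) \<Rightarrow> real \<Rightarrow> ennreal" where
  "coag f h x = (\<integral>\<^sup>+y. ennreal (E (x - y) y * \<Psi> (x - y) y / 2) * (f (x - y) * h y) \<partial>lborel)"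

definition breakage :: "(real \<Rightarrow> ennreal) \<Rightarrow> (real \<Rightarrow> ennreal) \<Rightarrow> real \<Rightarrow> ennreal" where
  "breakage f h x =
     (\<integral>\<^sup>+y. \<integral>\<^sup>+z. ennreal (P x y z * (1 - E y z) * \<Psi> y z / 2) * (f y * h z) \<partial>lborel \<partial>lborel)"

text \<open>
  With \<open>K = \<Psi>\<close> this is the death term. With the kernel \<open>compensator\<close> below it takes the place of the
  death term in the monotone equation.
\<close>

definition lin :: "(real \<Rightarrow> real \<Rightarrow> real) \<Rightarrow> (real \<Rightarrow> ennreal) \<Rightarrow> (real \<Rightarrow> ennreal) \<Rightarrow> real \<Rightarrow> ennreal" where
  "lin K f h x = f x * (\<integral>\<^sup>+y. ennreal (K x y) * h y \<partial>lborel)"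

definition bilin :: "(real \<Rightarrow> real \<Rightarrow> real) \<Rightarrow> (real \<Rightarrow> ennreal) \<Rightarrow> (real \<Rightarrow> ennreal) \<Rightarrow> real \<Rightarrow> ennreal" where
  "bilin K f h x = coag f h x + breakage f h x + lin K f h x"

text \<open>
  The kernel of the quadratic form obtained by testing \<open>bilin\<close> with \<open>\<omega>\<close>: a pair \<open>(y,z)\<close> merges, breaks into
  fragments, or contributes locally at \<open>y\<close>.
\<close>

definition weak_kernel :: "(real \<Rightarrow> real \<Rightarrow> real) \<Rightarrow> (real \<Rightarrow> ennreal) \<Rightarrow> real \<Rightarrow> real \<Rightarrow> ennreal" where
  "weak_kernel K \<omega> y z = \<omega> (y + z) * ennreal (E y z * \<Psi> y z / 2)
     + fragment_moment \<omega> y z * ennreal ((1 - E y z) * \<Psi> y z / 2) + \<omega> y * ennreal (K y z)"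

lemma coag_measurable:
  assumes [measurable]: "joint_borel f" "joint_borel h"
  shows "(\<lambda>(s, x). coag (f s) (h s) x) \<in> borel_measurable (borel \<Otimes>\<^sub>M borel)"
  unfolding coag_def by measurable

lemma breakage_measurable:
  assumes [measurable]: "joint_borel f" "joint_borel h"
  shows "(\<lambda>(s, x). breakage (f s) (h s) x) \<in> borel_measurable (borel \<Otimes>\<^sub>M borel)"
  unfolding breakage_def by measurable

lemma lin_measurable:
  assumes [measurable]: "joint_borel f" "joint_borel h"
    "joint_borel K"
  shows "(\<lambda>(s, x). lin K (f s) (h s) x) \<in> borel_measurable (borel \<Otimes>\<^sub>M borel)"
  unfolding lin_def by measurable

lemma bilin_measurable:
  assumes [measurable]: "joint_borel f" "joint_borel h"
    "joint_borel K"
  shows "(\<lambda>(s, x). bilin K (f s) (h s) x) \<in> borel_measurable (borel \<Otimes>\<^sub>M borel)"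
proof -
  note [measurable] = coag_measurable[OF assms(1,2)] breakage_measurable[OF assms(1,2)] lin_measurable[OF assms]
  show ?thesis unfolding bilin_def by measurable
qed

text \<open>
  The change of variables \<open>x = y + z\<close> in the coagulation term, and Tonelli in the breakage term.
\<close>

lemma weak_form:
  assumes [measurable]: "f \<in> borel_measurable borel" "h \<in> borel_measurable borel"
    "\<omega> \<in> borel_measurable borel" "joint_borel K"
  shows "(\<integral>\<^sup>+x. \<omega> x * bilin K f h x \<partial>lborel)
    = (\<integral>\<^sup>+y. \<integral>\<^sup>+z. weak_kernel K \<omega> y z * (f y * h z) \<partial>lborel \<partial>lborel)"
proof -
  have coag': "(\<integral>\<^sup>+x. \<omega> x * coag f h x \<partial>lborel)
      = (\<integral>\<^sup>+y. \<integral>\<^sup>+z. \<omega> (y + z) * ennreal (E y z * \<Psi> y z / 2) * (f y * h z) \<partial>lborel \<partial>lborel)"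
  proof -
    have "(\<integral>\<^sup>+x. \<omega> x * coag f h x \<partial>lborel)
        = (\<integral>\<^sup>+x. \<integral>\<^sup>+z. \<omega> x * (ennreal (E (x - z) z * \<Psi> (x - z) z / 2) * (f (x - z) * h z)) \<partial>lborel \<partial>lborel)"
      unfolding coag_def by (intro nn_integral_cong nn_integral_cmult[symmetric]) measurable
    also have "\<dots> = (\<integral>\<^sup>+z. \<integral>\<^sup>+x. \<omega> x * (ennreal (E (x - z) z * \<Psi> (x - z) z / 2) * (f (x - z) * h z)) \<partial>lborel \<partial>lborel)"
      by (rule lborel_pair.Fubini'[symmetric]) measurable
    also have "\<dots> = (\<integral>\<^sup>+z. \<integral>\<^sup>+y. \<omega> (z + y) * (ennreal (E (z + y - z) z * \<Psi> (z + y - z) z / 2) * (f (z + y - z) * h z)) \<partial>lborel \<partial>lborel)"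
      by (intro nn_integral_cong nn_integral_shift_lborel[symmetric]) measurable
    also have "\<dots> = (\<integral>\<^sup>+z. \<integral>\<^sup>+y. \<omega> (y + z) * ennreal (E y z * \<Psi> y z / 2) * (f y * h z) \<partial>lborel \<partial>lborel)"
      by (simp add: add.commute mult.assoc)
    also have "\<dots> = (\<integral>\<^sup>+y. \<integral>\<^sup>+z. \<omega> (y + z) * ennreal (E y z * \<Psi> y z / 2) * (f y * h z) \<partial>lborel \<partial>lborel)"
      by (rule lborel_pair.Fubini') measurable
    finally show ?thesis .
  qed
  have breakage': "(\<integral>\<^sup>+x. \<omega> x * breakage f h x \<partial>lborel)
      = (\<integral>\<^sup>+y. \<integral>\<^sup>+z. fragment_moment \<omega> y z * ennreal ((1 - E y z) * \<Psi> y z / 2) * (f y * h z) \<partial>lborel \<partial>lborel)"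
  proof -
    have "(\<integral>\<^sup>+x. \<omega> x * breakage f h x \<partial>lborel)
        = (\<integral>\<^sup>+x. \<integral>\<^sup>+y. \<omega> x * (\<integral>\<^sup>+z. ennreal (P x y z * (1 - E y z) * \<Psi> y z / 2) * (f y * h z) \<partial>lborel) \<partial>lborel \<partial>lborel)"
      unfolding breakage_def by (intro nn_integral_cong nn_integral_cmult[symmetric]) measurable
    also have "\<dots> = (\<integral>\<^sup>+y. \<integral>\<^sup>+x. \<omega> x * (\<integral>\<^sup>+z. ennreal (P x y z * (1 - E y z) * \<Psi> y z / 2) * (f y * h z) \<partial>lborel) \<partial>lborel \<partial>lborel)"
      by (rule lborel_pair.Fubini'[symmetric]) measurable
    also have "\<dots> = (\<integral>\<^sup>+y. \<integral>\<^sup>+x. \<integral>\<^sup>+z. \<omega> x * (ennreal (P x y z * (1 - E y z) * \<Psi> y z / 2) * (f y * h z)) \<partial>lborel \<partial>lborel \<partial>lborel)"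
      by (intro nn_integral_cong nn_integral_cmult[symmetric]) measurable
    also have "\<dots> = (\<integral>\<^sup>+y. \<integral>\<^sup>+z. \<integral>\<^sup>+x. \<omega> x * (ennreal (P x y z * (1 - E y z) * \<Psi> y z / 2) * (f y * h z)) \<partial>lborel \<partial>lborel \<partial>lborel)"
      by (intro nn_integral_cong lborel_pair.Fubini'[symmetric]) measurable
    also have "\<dots> = (\<integral>\<^sup>+y. \<integral>\<^sup>+z. \<integral>\<^sup>+x. (\<omega> x * ennreal (P x y z)) * (ennreal ((1 - E y z) * \<Psi> y z / 2) * (f y * h z)) \<partial>lborel \<partial>lborel \<partial>lborel)"
      by (intro nn_integral_cong) (simp add: ennreal_mult'' mult.assoc flip: times_divide_eq_right)
    also have "\<dots> = (\<integral>\<^sup>+y. \<integral>\<^sup>+z. fragment_moment \<omega> y z * (ennreal ((1 - E y z) * \<Psi> y z / 2) * (f y * h z)) \<partial>lborel \<partial>lborel)"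
      unfolding fragment_moment_def by (intro nn_integral_cong nn_integral_multc) measurable
    finally show ?thesis by (simp add: mult.assoc)
  qed
  have lin': "(\<integral>\<^sup>+x. \<omega> x * lin K f h x \<partial>lborel)
      = (\<integral>\<^sup>+y. \<integral>\<^sup>+z. \<omega> y * ennreal (K y z) * (f y * h z) \<partial>lborel \<partial>lborel)"
  proof -
    have "\<omega> x * lin K f h x = (\<integral>\<^sup>+z. (\<omega> x * f x) * (ennreal (K x z) * h z) \<partial>lborel)" for x
      unfolding lin_def mult.assoc[symmetric, of "\<omega> x" "f x" "integral\<^sup>N _ _"]
      by (intro nn_integral_cmult[symmetric]) measurable
    then show ?thesis by (simp add: mult_ac)
  qed
  have [measurable]: "coag f h \<in> borel_measurable borel" "breakage f h \<in> borel_measurable borel"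
    "lin K f h \<in> borel_measurable borel"
    unfolding coag_def breakage_def lin_def by measurable
  have "(\<integral>\<^sup>+x. \<omega> x * bilin K f h x \<partial>lborel)
      = (\<integral>\<^sup>+x. \<omega> x * coag f h x + \<omega> x * breakage f h x + \<omega> x * lin K f h x \<partial>lborel)"
    by (simp add: bilin_def distrib_left)
  also have "\<dots> = (\<integral>\<^sup>+x. \<omega> x * coag f h x \<partial>lborel) + (\<integral>\<^sup>+x. \<omega> x * breakage f h x \<partial>lborel)
      + (\<integral>\<^sup>+x. \<omega> x * lin K f h x \<partial>lborel)"
    by (simp add: nn_integral_add)
  also have "\<dots> = (\<integral>\<^sup>+y. \<integral>\<^sup>+z. \<omega> (y + z) * ennreal (E y z * \<Psi> y z / 2) * (f y * h z)
       + fragment_moment \<omega> y z * ennreal ((1 - E y z) * \<Psi> y z / 2) * (f y * h z)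
       + \<omega> y * ennreal (K y z) * (f y * h z) \<partial>lborel \<partial>lborel)"
    unfolding coag' breakage' lin'
    by (simp add: nn_integral_add)
  also have "\<dots> = (\<integral>\<^sup>+y. \<integral>\<^sup>+z. weak_kernel K \<omega> y z * (f y * h z) \<partial>lborel \<partial>lborel)"
    by (simp add: weak_kernel_def distrib_right)
  finally show ?thesis .
qed

abbreviation w :: "real \<Rightarrow> ennreal" where "w x \<equiv> ennreal (half_line_weight \<sigma> x)"

text \<open>
  The class of local kernels for which \<open>bilin K\<close> is bounded. It contains the collision kernel and its
  complement \<open>compensator\<close>, so one estimate serves existence and uniqueness.
\<close>

definition "admissible K \<longleftrightarrow> joint_borel K \<and>
  (\<forall>x y. 0 \<le> K x y \<and> K x y \<le> k * half_line_weight \<sigma> y \<and> (\<not> (0 < x \<and> 0 < y) \<longrightarrow> K x y = 0))"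

lemma \<Psi>_le_weight: "\<Psi> x y \<le> k * half_line_weight \<sigma> y"
proof (cases "0 < x \<and> 0 < y")
  case True
  have "\<Psi> x y \<le> k * (x + y) powr (-\<sigma>)" using \<Psi>_le True by simp
  also have "\<dots> \<le> k * S_weight \<sigma> y"
    using powr_mono2'[of "-\<sigma>" y "x + y"] powr_neg_le_S_weight[of \<sigma> y] True \<sigma>_pos k_nonneg
    by (intro mult_left_mono) auto
  finally show ?thesis using True by (simp add: half_line_weight_def)
qed (use k_nonneg in \<open>auto simp: \<Psi>_outside\<close>)

definition compensator :: "real \<Rightarrow> real \<Rightarrow> real" where
  "compensator x y = (if 0 < x \<and> 0 < y then k * half_line_weight \<sigma> y - \<Psi> x y else 0)"

lemma compensator_measurable [measurable]: "joint_borel compensator"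
  unfolding compensator_def by measurable

lemma admissible_\<Psi>: "admissible \<Psi>"
  using \<Psi>_le_weight \<Psi>_outside by (auto simp: admissible_def)

lemma admissible_compensator: "admissible compensator"
  unfolding admissible_def using \<Psi>_le_weight k_nonneg by (auto simp: compensator_def)

lemma fragment_moment_powr:
  assumes "0 < x" "0 < y"
  shows "fragment_moment (enn (pos_powr 0)) x y \<le> ennreal (\<eta> * (x + y) powr 0)"
    and "fragment_moment (enn (pos_powr 1)) x y \<le> ennreal ((x + y) powr 1)"
    and "fragment_moment (\<lambda>m. ennreal (pos_powr (-2 * \<sigma>) m)) x y \<le> ennreal (\<eta> * (x + y) powr (-2 * \<sigma>))"
proof -
  have "ennreal (pos_powr r m) * ennreal (P m x y) = ennreal (m powr r * P m x y)" for r m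
    by (cases "0 < m") (auto simp: pos_powr_def ennreal_mult P_outside)
  then have *: "fragment_moment (enn (pos_powr r)) x y = (\<integral>\<^sup>+m. ennreal (m powr r * P m x y) \<partial>lborel)" for r
    by (simp add: fragment_moment_def)
  have 0: "m powr 0 * P m x y = P m x y" for m by (cases "0 < m") (auto simp: P_outside)
  have 1: "m powr 1 * P m x y = m * P m x y" for m by (cases "0 < m") (auto simp: P_outside)
  show "fragment_moment (enn (pos_powr 0)) x y \<le> ennreal (\<eta> * (x + y) powr 0)"
    unfolding * 0 using P_number[OF assms] assms by simp
  show "fragment_moment (enn (pos_powr 1)) x y \<le> ennreal ((x + y) powr 1)"
    unfolding * 1 using P_mass[OF assms] assms by simp
  show "fragment_moment (\<lambda>m. ennreal (pos_powr (-2 * \<sigma>) m)) x y \<le> ennreal (\<eta> * (x + y) powr (-2 * \<sigma>))"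
    unfolding * using P_singular[OF assms] by simp
qed

lemma w_eq_powers: "w x = ennreal (pos_powr 0 x) + ennreal (pos_powr 1 x) + ennreal (pos_powr (-2 * \<sigma>) x)"
  by (simp add: half_line_weight_eq_powers ennreal_plus)

text \<open>
  All three parts of the weight are covered by the moment bounds for fragments; the total mass of the
  fragments fits below \<open>\<eta> (x + y)\<close> because \<open>\<eta> \<ge> 1\<close>.
\<close>

lemma fragment_moment_w:
  assumes "0 < x" "0 < y"
  shows "fragment_moment w x y \<le> ennreal (\<eta> * S_weight \<sigma> (x + y))"
proof -
  have "fragment_moment w x y = fragment_moment (enn (pos_powr 0)) x y
     + fragment_moment (enn (pos_powr 1)) x y + fragment_moment (\<lambda>m. ennreal (pos_powr (-2 * \<sigma>) m)) x y"
    unfolding fragment_moment_def w_eq_powers distrib_right by (simp add: nn_integral_add)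
  also have "\<dots> \<le> ennreal (\<eta> * (x + y) powr 0) + ennreal ((x + y) powr 1) + ennreal (\<eta> * (x + y) powr (-2 * \<sigma>))"
    by (intro add_mono fragment_moment_powr assms)
  also have "\<dots> = ennreal (\<eta> + (x + y) + \<eta> * (x + y) powr (-2 * \<sigma>))"
    using assms \<eta>_ge by (simp add: ennreal_plus)
  also have "\<dots> \<le> ennreal (\<eta> * S_weight \<sigma> (x + y))"
  proof (rule ennreal_leI)
    have "1 * (x + y) \<le> \<eta> * (x + y)" using assms \<eta>_ge by (intro mult_right_mono) auto
    then show "\<eta> + (x + y) + \<eta> * (x + y) powr (-2 * \<sigma>) \<le> \<eta> * S_weight \<sigma> (x + y)"
      by (simp add: S_weight_def algebra_simps)
  qed
  finally show ?thesis .
qed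

definition "bound = (\<eta> + 1) * k"

lemma bound_nonneg: "0 \<le> bound" using \<eta>_ge k_nonneg by (simp add: bound_def)

lemma weak_kernel_w:
  assumes K: "admissible K"
  shows "weak_kernel K w y z \<le> ennreal bound * (w y * w z)"
proof (cases "0 < y \<and> 0 < z")
  case False
  then show ?thesis using K by (auto simp: weak_kernel_def \<Psi>_outside admissible_def)
next
  case True
  let ?W = "S_weight \<sigma>"
  have pos: "0 \<le> ?W y" "0 \<le> ?W z" "0 \<le> ?W (y + z)" using True by (auto simp: S_weight_def)
  have "weak_kernel K w y z \<le> ennreal (?W (y + z)) * ennreal (E y z * \<Psi> y z / 2)
      + ennreal (\<eta> * ?W (y + z)) * ennreal ((1 - E y z) * \<Psi> y z / 2) + ennreal (?W y) * ennreal (k * ?W z)"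
    unfolding weak_kernel_def
    using K True by (intro add_mono mult_mono fragment_moment_w) (auto simp: half_line_weight_def admissible_def intro!: ennreal_leI, metis)
  also have "\<dots> = ennreal (?W (y + z) * (E y z * \<Psi> y z / 2) + \<eta> * ?W (y + z) * ((1 - E y z) * \<Psi> y z / 2) + ?W y * (k * ?W z))"
    using pos \<eta>_ge k_nonneg by (simp add: ennreal_mult ennreal_plus del: times_divide_eq_right)
  also have "\<dots> \<le> ennreal (bound * (?W y * ?W z))"
  proof (rule ennreal_leI)
    have "E y z + \<eta> * (1 - E y z) \<le> \<eta>"
      using mult_right_mono[of 1 \<eta> "E y z"] \<eta>_ge E_nonneg[of y z] by (simp add: algebra_simps)
    then have "(E y z + \<eta> * (1 - E y z)) * (\<Psi> y z * ?W (y + z) / 2) \<le> \<eta> * (\<Psi> y z * ?W (y + z) / 2)"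
      using pos by (intro mult_right_mono) auto
    also have "\<dots> \<le> \<eta> * (k * (?W y * ?W z))"
    proof (intro mult_left_mono)
      have "\<Psi> y z * ?W (y + z) \<le> k * (y + z) powr (-\<sigma>) * ?W (y + z)"
        using \<Psi>_le True pos by (intro mult_right_mono) auto
      also have "\<dots> \<le> k * (2 * (?W y * ?W z))"
        using kernel_S_weight_bound[OF \<sigma>_pos, of y z] True k_nonneg
        by (simp add: mult.assoc mult_left_mono)
      finally show "\<Psi> y z * ?W (y + z) / 2 \<le> k * (?W y * ?W z)" by simp
    qed (use \<eta>_ge in auto)
    finally show "?W (y + z) * (E y z * \<Psi> y z / 2) + \<eta> * ?W (y + z) * ((1 - E y z) * \<Psi> y z / 2) + ?W y * (k * ?W z)
        \<le> bound * (?W y * ?W z)"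
      by (simp add: bound_def field_simps)
  qed
  also have "\<dots> = ennreal bound * (w y * w z)"
    using True pos bound_nonneg by (simp add: half_line_weight_def ennreal_mult)
  finally show ?thesis .
qed

text \<open>
  The boundedness of the collision operators on the weighted space, from the pointwise bound for the
  kernel.
\<close>

lemma bilin_weight_bound:
  assumes [measurable]: "f \<in> borel_measurable borel" "h \<in> borel_measurable borel" and K: "admissible K"
  shows "(\<integral>\<^sup>+x. w x * bilin K f h x \<partial>lborel)
    \<le> ennreal bound * ((\<integral>\<^sup>+x. w x * f x \<partial>lborel) * (\<integral>\<^sup>+x. w x * h x \<partial>lborel))"
proof -
  have [measurable]: "joint_borel K" using K by (simp add: admissible_def)
  have "(\<integral>\<^sup>+x. w x * bilin K f h x \<partial>lborel) = (\<integral>\<^sup>+y. \<integral>\<^sup>+z. weak_kernel K w y z * (f y * h z) \<partial>lborel \<partial>lborel)"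
    by (rule weak_form) measurable
  also have "\<dots> \<le> (\<integral>\<^sup>+y. \<integral>\<^sup>+z. ennreal bound * (w y * w z) * (f y * h z) \<partial>lborel \<partial>lborel)"
    by (intro nn_integral_mono mult_right_mono weak_kernel_w K) auto
  also have "\<dots> = (\<integral>\<^sup>+y. \<integral>\<^sup>+z. ennreal bound * (w y * f y) * (w z * h z) \<partial>lborel \<partial>lborel)"
    by (simp add: mult_ac)
  also have "\<dots> = (\<integral>\<^sup>+y. ennreal bound * (w y * f y) * (\<integral>\<^sup>+z. w z * h z \<partial>lborel) \<partial>lborel)"
    by (intro nn_integral_cong nn_integral_cmult) measurable
  also have "\<dots> = (\<integral>\<^sup>+y. ennreal bound * (w y * f y) \<partial>lborel) * (\<integral>\<^sup>+z. w z * h z \<partial>lborel)"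
    by (rule nn_integral_multc) measurable
  also have "(\<integral>\<^sup>+y. ennreal bound * (w y * f y) \<partial>lborel) = ennreal bound * (\<integral>\<^sup>+y. w y * f y \<partial>lborel)"
    by (rule nn_integral_cmult) measurable
  finally show ?thesis by (simp add: mult.assoc)
qed

lemma bilin_mono:
  assumes "\<And>y. f y \<le> f' y" "\<And>y. h y \<le> h' y"
  shows "bilin K f h x \<le> bilin K f' h' x"
  unfolding bilin_def coag_def breakage_def lin_def
  by (intro add_mono nn_integral_mono mult_mono assms) auto

lemma bilin_SUP:
  assumes F: "incseq F" and [measurable]: "\<And>n. F n \<in> borel_measurable borel"
    "joint_borel K"
  shows "bilin K (\<lambda>y. SUP n::nat. F n y) (\<lambda>y. SUP n. F n y) x = (SUP n. bilin K (F n) (F n) x)"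
proof -
  have F': "F m y \<le> F n y" if "m \<le> n" for m n y
    using F that by (auto simp: incseq_def le_fun_def)
  have prod: "(SUP n. F n y) * (SUP n. F n z) = (SUP n. F n y * F n z)" for y z
    by (rule SUP_mult_incseq_ennreal[symmetric]) (auto simp: incseq_def intro: F')
  have "coag (\<lambda>y. SUP n. F n y) (\<lambda>y. SUP n. F n y) x = (SUP n. coag (F n) (F n) x)"
  proof -
    have "coag (\<lambda>y. SUP n. F n y) (\<lambda>y. SUP n. F n y) x
        = (\<integral>\<^sup>+y. (SUP n. ennreal (E (x - y) y * \<Psi> (x - y) y / 2) * (F n (x - y) * F n y)) \<partial>lborel)"
      unfolding coag_def prod by (simp add: SUP_mult_left_ennreal)
    also have "\<dots> = (SUP n. coag (F n) (F n) x)"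
      unfolding coag_def
      by (rule nn_integral_monotone_convergence_SUP)
         (auto intro!: incseq_SucI le_funI mult_mono F')
    finally show ?thesis .
  qed
  moreover have "breakage (\<lambda>y. SUP n. F n y) (\<lambda>y. SUP n. F n y) x = (SUP n. breakage (F n) (F n) x)"
  proof -
    have "breakage (\<lambda>y. SUP n. F n y) (\<lambda>y. SUP n. F n y) x
        = (\<integral>\<^sup>+y. \<integral>\<^sup>+z. (SUP n. ennreal (P x y z * (1 - E y z) * \<Psi> y z / 2) * (F n y * F n z)) \<partial>lborel \<partial>lborel)"
      unfolding breakage_def prod by (simp add: SUP_mult_left_ennreal)
    also have "\<dots> = (\<integral>\<^sup>+y. (SUP n. \<integral>\<^sup>+z. ennreal (P x y z * (1 - E y z) * \<Psi> y z / 2) * (F n y * F n z) \<partial>lborel) \<partial>lborel)"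
      by (intro nn_integral_cong nn_integral_monotone_convergence_SUP)
         (auto intro!: incseq_SucI le_funI mult_mono F')
    also have "\<dots> = (SUP n. breakage (F n) (F n) x)"
      unfolding breakage_def
      by (rule nn_integral_monotone_convergence_SUP)
         (auto intro!: incseq_SucI le_funI nn_integral_mono mult_mono F')
    finally show ?thesis .
  qed
  moreover have "lin K (\<lambda>y. SUP n. F n y) (\<lambda>y. SUP n. F n y) x = (SUP n. lin K (F n) (F n) x)"
  proof -
    have "(\<integral>\<^sup>+y. ennreal (K x y) * (SUP n. F n y) \<partial>lborel) = (\<integral>\<^sup>+y. (SUP n. ennreal (K x y) * F n y) \<partial>lborel)"
      by (simp add: SUP_mult_left_ennreal)
    also have "\<dots> = (SUP n. \<integral>\<^sup>+y. ennreal (K x y) * F n y \<partial>lborel)"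
      by (rule nn_integral_monotone_convergence_SUP) (auto intro!: incseq_SucI le_funI mult_mono F')
    finally show ?thesis unfolding lin_def
      by (subst SUP_mult_incseq_ennreal) (auto intro!: incseq_SucI nn_integral_mono mult_mono F')
  qed
  moreover have c: "incseq (\<lambda>n. coag (F n) (F n) x)" "incseq (\<lambda>n. breakage (F n) (F n) x)" "incseq (\<lambda>n. lin K (F n) (F n) x)"
    by (auto intro!: incseq_SucI nn_integral_mono mult_mono F' simp: coag_def breakage_def lin_def)
  moreover have "incseq (\<lambda>n. coag (F n) (F n) x + breakage (F n) (F n) x)"
    using c by (auto simp: incseq_def intro: add_mono)
  ultimately show ?thesis
    unfolding bilin_def by (simp add: ennreal_SUP_add)
qed

text \<open>
  The compensated equation, in which the death term is replaced by its complement in \<open>k (\<integral> w f) f\<close>.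
\<close>

sublocale monotone_evolution "\<lambda>f. bilin compensator f f" w bound
proof
  show "bilin compensator f f x \<le> bilin compensator g g x" if "\<And>y. f y \<le> g y" for f g x
    by (rule bilin_mono) (rule that)+
  show "(\<lambda>(s, x). bilin compensator (u s) (u s) x) \<in> borel_measurable (borel \<Otimes>\<^sub>M borel)"
    if "joint_borel u" for u :: "real \<Rightarrow> real \<Rightarrow> ennreal"
    by (rule bilin_measurable) (use that in measurable)
  show "bilin compensator (\<lambda>y. SUP n. F n y) (\<lambda>y. SUP n. F n y) x = (SUP n. bilin compensator (F n) (F n) x)"
    if "incseq F" "\<And>n. F n \<in> borel_measurable borel" for F :: "nat \<Rightarrow> real \<Rightarrow> ennreal" and x
    by (rule bilin_SUP[OF that]) measurable
  show "(\<integral>\<^sup>+x. w x * bilin compensator f f x \<partial>lborel) \<le> ennreal bound * (\<integral>\<^sup>+x. w x * f x \<partial>lborel)\<^sup>2" if "f \<in> borel_measurable borel" for f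
    using bilin_weight_bound[OF that that admissible_compensator] by (simp add: power2_eq_square)
qed (auto simp: bound_nonneg)

end


section \<open>Growth of moments\<close>

lemma integral_has_derivative_interior:
  fixes f :: "real \<Rightarrow> real"
  assumes "continuous_on {0..b} f" "0 < t" "t < b"
  shows "((\<lambda>x. integral {0..x} f) has_real_derivative f t) (at t)"
  using integral_has_real_derivative[OF assms(1), of t] assms
  by (simp add: at_within_Icc_at)

lemma continuous_on_integral:
  fixes f :: "real \<Rightarrow> real"
  assumes "continuous_on {0..b} f"
  shows "continuous_on {0..b} (\<lambda>x. integral {0..x} f)"
  using assms by (intro indefinite_integral_continuous_1 integrable_continuous_interval)

text \<open>
  An integral inequality for \<open>m\<close> alone gives no derivative. Its right-hand side \<open>R\<close> is differentiable and
  dominates \<open>m\<close>, so the integrating factor is applied to \<open>R\<close>.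
\<close>

lemma integrating_factor:
  fixes U m \<beta> :: "real \<Rightarrow> real"
  assumes U: "continuous_on {0..b} U" and m: "continuous_on {0..b} m" and \<beta>: "continuous_on {0..b} \<beta>"
    and a: "0 \<le> a" and U0: "\<And>s. s \<in> {0..b} \<Longrightarrow> 0 \<le> U s"
    and le: "\<And>s. s \<in> {0..b} \<Longrightarrow> m s \<le> R0 + integral {0..s} (\<lambda>r. \<beta> r + a * U r * m r)"
    and \<tau>: "\<tau> \<in> {0..b}"
  shows "exp (- a * integral {0..\<tau>} U) * m \<tau>
    \<le> R0 + integral {0..\<tau>} (\<lambda>s. exp (- a * integral {0..s} U) * \<beta> s)"
proof -
  define R where "R s = R0 + integral {0..s} (\<lambda>r. \<beta> r + a * U r * m r)" for s
  define V where "V s = integral {0..s} U" for s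
  define F where "F s = exp (- a * V s) * R s - integral {0..s} (\<lambda>s. exp (- a * V s) * \<beta> s)" for s
  have cV: "continuous_on {0..b} V" unfolding V_def by (rule continuous_on_integral[OF U])
  have c1: "continuous_on {0..b} (\<lambda>r. \<beta> r + a * U r * m r)"
    by (intro continuous_intros U m \<beta>)
  have c2: "continuous_on {0..b} (\<lambda>s. exp (- a * V s) * \<beta> s)"
    by (intro continuous_intros cV \<beta>)
  have cF: "continuous_on {0..b} F"
    unfolding F_def R_def
    by (intro continuous_intros cV continuous_on_integral[OF c1] continuous_on_integral[OF c2])
  have dF: "(F has_real_derivative (exp (- a * V s) * (a * U s * (m s - R s)))) (at s)"
    if s: "0 < s" "s < b" for s
  proof -
    have dV: "(V has_real_derivative U s) (at s)"
      unfolding V_def by (rule integral_has_derivative_interior[OF U s])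
    have dR: "(R has_real_derivative (\<beta> s + a * U s * m s)) (at s)"
      unfolding R_def
      by (rule DERIV_cong[OF DERIV_add[OF DERIV_const integral_has_derivative_interior[OF c1 s]]]) simp
    have dI: "((\<lambda>s. integral {0..s} (\<lambda>s. exp (- a * V s) * \<beta> s)) has_real_derivative exp (- a * V s) * \<beta> s) (at s)"
      by (rule integral_has_derivative_interior[OF c2 s])
    show ?thesis unfolding F_def
      by (rule derivative_eq_intros dV dR dI refl)+ (simp add: algebra_simps)
  qed
  have "F \<tau> \<le> F 0"
  proof (cases "\<tau> = 0")
    case False
    then have "0 < \<tau>" using \<tau> by auto
    then obtain l z where lz: "0 < z" "z < \<tau>" "DERIV F z :> l" "F \<tau> - F 0 = (\<tau> - 0) * l"
      using MVT[of 0 \<tau> F] continuous_on_subset[OF cF, of "{0..\<tau>}"] dF \<tau>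
      by (force simp: real_differentiable_def)
    have "l = exp (- a * V z) * (a * U z * (m z - R z))"
      using DERIV_unique[OF lz(3) dF] lz \<tau> by auto
    also have "\<dots> \<le> 0"
      using le[of z] U0[of z] a lz \<tau> unfolding R_def
      by (intro mult_nonneg_nonpos) auto
    finally have "\<tau> * l \<le> 0" using \<open>0 < \<tau>\<close> by (simp add: mult_nonneg_nonpos)
    then show ?thesis using lz(4) by simp
  qed simp
  also have "F 0 = R0" by (simp add: F_def R_def V_def)
  finally have "exp (- a * V \<tau>) * R \<tau> \<le> R0 + integral {0..\<tau>} (\<lambda>s. exp (- a * V s) * \<beta> s)"
    by (simp add: F_def)
  moreover have "exp (- a * V \<tau>) * m \<tau> \<le> exp (- a * V \<tau>) * R \<tau>"
    using le[OF \<tau>] by (intro mult_left_mono) (auto simp: R_def)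
  ultimately show ?thesis unfolding V_def by linarith
qed

text \<open>
  The system satisfied by mass \<open>m1\<close>, number \<open>m0\<close> and singular moment \<open>ms\<close> of the compensated equation. After
  multiplication by \<open>\<phi>\<close> the mass stays below its initial value, and the remaining inequality for
  \<open>\<phi> m0\<close> is linear with respect to the measure \<open>d\<theta> = d\<tau> / \<phi>\<close>. The bound depends on \<open>\<tau>\<close> only through
  \<open>\<theta>\<close>, the time of the original equation.
\<close>

lemma moment_system_bound:
  fixes m1 m0 ms :: "real \<Rightarrow> real"
  assumes c: "continuous_on {0..b} m1" "continuous_on {0..b} m0" "continuous_on {0..b} ms"
    and nn: "\<And>s. 0 \<le> m1 s" "\<And>s. 0 \<le> m0 s" "\<And>s. 0 \<le> ms s"
    and kK: "0 \<le> k" "0 \<le> K"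
    and U: "U = (\<lambda>s. m0 s + m1 s + ms s)"
    and i1: "\<And>s. s \<in> {0..b} \<Longrightarrow> m1 s \<le> m1 0 + integral {0..s} (\<lambda>r. 0 + k * U r * m1 r)"
    and i0: "\<And>s. s \<in> {0..b} \<Longrightarrow> m0 s \<le> m0 0 + integral {0..s} (\<lambda>r. K * (m1 r * m0 r) + k * U r * m0 r)"
    and ims: "\<And>s. s \<in> {0..b} \<Longrightarrow> ms s \<le> ms 0 + integral {0..s} (\<lambda>r. K * (m1 r * m0 r) + k * U r * ms r)"
    and \<tau>: "\<tau> \<in> {0..b}"
  defines "\<phi> \<equiv> \<lambda>\<tau>. exp (- k * integral {0..\<tau>} U)"
  defines "\<theta> \<equiv> \<lambda>\<tau>. integral {0..\<tau>} (\<lambda>s. 1 / \<phi> s)"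
  shows "\<phi> \<tau> * U \<tau> \<le> m1 0 + ms 0 + 2 * (m0 0 * exp (K * m1 0 * \<theta> \<tau>))"
proof -
  let ?M = "m1 0" and ?Y = "\<lambda>s. \<phi> s * m0 s"
  have cU: "continuous_on {0..b} U" unfolding U by (intro continuous_intros c)
  have U0: "0 \<le> U s" for s unfolding U using nn by (simp add: add_nonneg_nonneg)
  have c\<phi>: "continuous_on {0..b} \<phi>" unfolding \<phi>_def by (intro continuous_intros continuous_on_integral cU)
  have \<phi>pos: "0 < \<phi> s" and \<phi>ne: "\<phi> s \<noteq> 0" for s by (simp_all add: \<phi>_def)
  have ci: "continuous_on {0..b} (\<lambda>s. 1 / \<phi> s)"
    by (intro continuous_intros c\<phi>) (simp add: \<phi>_def)
  have cm: "continuous_on {0..b} (\<lambda>r. K * (m1 r * m0 r))" by (intro continuous_intros c)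
  have b1: "\<phi> s * m1 s \<le> ?M" if "s \<in> {0..b}" for s
    using integrating_factor[OF cU c(1) continuous_on_const[of _ "0::real"] kK(1) U0 i1 that]
    by (simp add: \<phi>_def)
  have b: "\<phi> s * m s \<le> m 0 + integral {0..s} (\<lambda>r. K * ?M * m0 r)"
    if s: "s \<in> {0..b}" and m: "continuous_on {0..b} m"
      "\<And>s. s \<in> {0..b} \<Longrightarrow> m s \<le> m 0 + integral {0..s} (\<lambda>r. K * (m1 r * m0 r) + k * U r * m r)" for s m
  proof -
    have "\<phi> s * m s \<le> m 0 + integral {0..s} (\<lambda>r. \<phi> r * (K * (m1 r * m0 r)))"
      using integrating_factor[OF cU m(1) cm kK(1) U0 m(2) s] by (simp add: \<phi>_def)
    also have "integral {0..s} (\<lambda>r. \<phi> r * (K * (m1 r * m0 r))) \<le> integral {0..s} (\<lambda>r. K * ?M * m0 r)"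
    proof (rule integral_le)
      show "(\<lambda>r. \<phi> r * (K * (m1 r * m0 r))) integrable_on {0..s}" "(\<lambda>r. K * ?M * m0 r) integrable_on {0..s}"
        using s by (auto intro!: integrable_continuous_interval continuous_intros continuous_on_subset[OF c\<phi>]
            continuous_on_subset[OF c(1)] continuous_on_subset[OF c(2)])
      fix r assume r: "r \<in> {0..s}"
      have "(\<phi> r * m1 r) * (K * m0 r) \<le> ?M * (K * m0 r)"
        using b1[of r] r s nn kK by (intro mult_right_mono) auto
      then show "\<phi> r * (K * (m1 r * m0 r)) \<le> K * ?M * m0 r" by (simp add: mult_ac)
    qed
    finally show ?thesis by simp
  qed
  have cY: "continuous_on {0..b} ?Y" by (intro continuous_intros c c\<phi>)
  have Y: "?Y s \<le> m0 0 * exp (K * ?M * \<theta> s)" if "s \<in> {0..b}" for s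
  proof -
    have "exp (- (K * ?M) * integral {0..s} (\<lambda>s. 1 / \<phi> s)) * ?Y s
        \<le> m0 0 + integral {0..s} (\<lambda>r. exp (- (K * ?M) * integral {0..r} (\<lambda>s. 1 / \<phi> s)) * 0)"
    proof (rule integrating_factor[OF ci cY continuous_on_const _ _ _ that])
      show "0 \<le> K * ?M" using kK nn by simp
      show "0 \<le> 1 / \<phi> s" for s using \<phi>pos[of s] by simp
      show "?Y s \<le> m0 0 + integral {0..s} (\<lambda>r. 0 + K * ?M * (1 / \<phi> r) * ?Y r)" if "s \<in> {0..b}" for s
        using b[OF that c(2) i0] \<phi>ne by simp
    qed
    then show ?thesis by (simp add: \<theta>_def exp_minus field_simps)
  qed
  (* K M m0 is at most m0(0) K M exp(K M theta) theta', which is the derivative of m0(0) exp(K M theta). *)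
  have I: "integral {0..\<tau>} (\<lambda>r. K * ?M * m0 r) \<le> m0 0 * exp (K * ?M * \<theta> \<tau>) - m0 0"
  proof -
    have "((\<lambda>r. m0 0 * (exp (K * ?M * \<theta> r) * (K * ?M * (1 / \<phi> r)))) has_integral
        (m0 0 * exp (K * ?M * \<theta> \<tau>) - m0 0 * exp (K * ?M * \<theta> 0))) {0..\<tau>}"
    proof (rule fundamental_theorem_of_calculus)
      show "0 \<le> \<tau>" using \<tau> by simp
      fix x assume x: "x \<in> {0..\<tau>}"
      have "(\<theta> has_real_derivative 1 / \<phi> x) (at x within {0..b})"
        unfolding \<theta>_def by (rule integral_has_real_derivative[OF ci]) (use x \<tau> in auto)
      then have d: "(\<theta> has_real_derivative 1 / \<phi> x) (at x within {0..\<tau>})"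
        by (rule DERIV_subset) (use \<tau> in auto)
      show "((\<lambda>r. m0 0 * exp (K * ?M * \<theta> r)) has_vector_derivative
          m0 0 * (exp (K * ?M * \<theta> x) * (K * ?M * (1 / \<phi> x)))) (at x within {0..\<tau>})"
        unfolding has_real_derivative_iff_has_vector_derivative[symmetric]
        by (rule derivative_eq_intros d refl)+ simp
    qed
    then have h: "((\<lambda>r. m0 0 * (exp (K * ?M * \<theta> r) * (K * ?M * (1 / \<phi> r)))) has_integral
        (m0 0 * exp (K * ?M * \<theta> \<tau>) - m0 0)) {0..\<tau>}" by (simp add: \<theta>_def)
    have "integral {0..\<tau>} (\<lambda>r. K * ?M * m0 r) \<le> integral {0..\<tau>} (\<lambda>r. m0 0 * (exp (K * ?M * \<theta> r) * (K * ?M * (1 / \<phi> r))))"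
    proof (rule integral_le)
      show "(\<lambda>r. K * ?M * m0 r) integrable_on {0..\<tau>}"
        using \<tau> by (auto intro!: integrable_continuous_interval continuous_intros continuous_on_subset[OF c(2)])
      show "(\<lambda>r. m0 0 * (exp (K * ?M * \<theta> r) * (K * ?M * (1 / \<phi> r)))) integrable_on {0..\<tau>}"
        using h by blast
      fix r assume r: "r \<in> {0..\<tau>}"
      have "m0 r \<le> m0 0 * exp (K * ?M * \<theta> r) * (1 / \<phi> r)"
        using Y[of r] r \<tau> \<phi>pos[of r] by (simp add: field_simps)
      then have "K * ?M * m0 r \<le> K * ?M * (m0 0 * exp (K * ?M * \<theta> r) * (1 / \<phi> r))"
        using kK nn by (intro mult_left_mono) auto
      then show "K * ?M * m0 r \<le> m0 0 * (exp (K * ?M * \<theta> r) * (K * ?M * (1 / \<phi> r)))"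
        by (simp add: mult_ac)
    qed
    also have "\<dots> = m0 0 * exp (K * ?M * \<theta> \<tau>) - m0 0" using h by (rule integral_unique)
    finally show ?thesis .
  qed
  have "\<phi> \<tau> * U \<tau> = \<phi> \<tau> * m1 \<tau> + \<phi> \<tau> * m0 \<tau> + \<phi> \<tau> * ms \<tau>" by (simp add: U algebra_simps)
  also have "\<dots> \<le> ?M + m0 0 * exp (K * ?M * \<theta> \<tau>) + (ms 0 + (m0 0 * exp (K * ?M * \<theta> \<tau>) - m0 0))"
    using b1[OF \<tau>] Y[OF \<tau>] b[OF \<tau> c(3) ims] I by (intro add_mono) auto
  finally show ?thesis using nn(2)[of 0] by simp
qed

context collision_model begin

definition moment :: "real \<Rightarrow> (real \<Rightarrow> ennreal) \<Rightarrow> ennreal" where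
  "moment r f = (\<integral>\<^sup>+x. ennreal (pos_powr r x) * f x \<partial>lborel)"

text \<open>
  The compensator contributes \<open>k w(z) - \<Psi>(y,z)\<close>. Instead of subtracting in \<open>[0,\<infinity>]\<close>, the proof adds the
  integral of \<open>x powr r * \<Psi>\<close> to both sides, symmetrises it on the right, and cancels it at the end, where it
  is finite. What is left of the gain is \<open>c (x + y)\<close>, that is \<open>c\<close> times mass times number.
\<close>

lemma moment_growth_general:
  assumes [measurable]: "f \<in> borel_measurable borel" and fin: "weight f < \<infinity>" "moment r f < \<infinity>"
    and a: "0 \<le> a" and c: "0 \<le> c"
    and frag: "\<And>x y. 0 < x \<Longrightarrow> 0 < y \<Longrightarrow> fragment_moment (enn (pos_powr r)) x y \<le> ennreal (a * (x + y) powr r)"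
    and pw: "\<And>x y. 0 < x \<Longrightarrow> 0 < y \<Longrightarrow>
      \<Psi> x y * (E x y + a * (1 - E x y)) * (x + y) powr r \<le> \<Psi> x y * (x powr r + y powr r) + c * (x + y)"
  shows "(\<integral>\<^sup>+x. ennreal (pos_powr r x) * bilin compensator f f x \<partial>lborel)
    \<le> ennreal c * (moment 1 f * moment 0 f) + ennreal k * (weight f * moment r f)"
proof -
  let ?\<omega> = "\<lambda>x. ennreal (pos_powr r x)"
  let ?p = "\<lambda>r x. ennreal (pos_powr r x)"
  (* X is half of the integral of the loss term against the moment function; X + X is added and cancelled. *)
  define X where "X = (\<integral>\<^sup>+y. \<integral>\<^sup>+z. ?\<omega> y * ennreal (\<Psi> y z / 2) * (f y * f z) \<partial>lborel \<partial>lborel)"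
  have X_sym: "(\<integral>\<^sup>+y. \<integral>\<^sup>+z. ?\<omega> z * ennreal (\<Psi> y z / 2) * (f y * f z) \<partial>lborel \<partial>lborel) = X"
  proof -
    have "(\<integral>\<^sup>+y. \<integral>\<^sup>+z. ?\<omega> z * ennreal (\<Psi> y z / 2) * (f y * f z) \<partial>lborel \<partial>lborel)
      = (\<integral>\<^sup>+z. \<integral>\<^sup>+y. ?\<omega> z * ennreal (\<Psi> y z / 2) * (f y * f z) \<partial>lborel \<partial>lborel)"
      by (rule lborel_pair.Fubini') measurable
    also have "\<dots> = X" unfolding X_def by (subst \<Psi>_sym) (simp add: mult_ac)
    finally show ?thesis .
  qed
  have split: "(\<integral>\<^sup>+y. \<integral>\<^sup>+z. ennreal d * (g y * h z) * (f y * f z) \<partial>lborel \<partial>lborel)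
      = ennreal d * ((\<integral>\<^sup>+y. g y * f y \<partial>lborel) * (\<integral>\<^sup>+z. h z * f z \<partial>lborel))"
    if [measurable]: "g \<in> borel_measurable borel" "h \<in> borel_measurable borel" for d and g h :: "real \<Rightarrow> ennreal"
  proof -
    have "(\<integral>\<^sup>+y. \<integral>\<^sup>+z. ennreal d * (g y * h z) * (f y * f z) \<partial>lborel \<partial>lborel)
        = (\<integral>\<^sup>+y. \<integral>\<^sup>+z. ennreal d * (g y * f y) * (h z * f z) \<partial>lborel \<partial>lborel)"
      by (simp add: mult_ac)
    also have "\<dots> = (\<integral>\<^sup>+y. ennreal d * (g y * f y) * (\<integral>\<^sup>+z. h z * f z \<partial>lborel) \<partial>lborel)"
      by (intro nn_integral_cong nn_integral_cmult) measurable
    also have "\<dots> = (\<integral>\<^sup>+y. ennreal d * (g y * f y) \<partial>lborel) * (\<integral>\<^sup>+z. h z * f z \<partial>lborel)"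
      by (rule nn_integral_multc) measurable
    also have "(\<integral>\<^sup>+y. ennreal d * (g y * f y) \<partial>lborel) = ennreal d * (\<integral>\<^sup>+y. g y * f y \<partial>lborel)"
      by (rule nn_integral_cmult) measurable
    finally show ?thesis by (simp add: mult.assoc)
  qed
  have "X \<le> (\<integral>\<^sup>+y. \<integral>\<^sup>+z. ennreal k * (?\<omega> y * w z) * (f y * f z) \<partial>lborel \<partial>lborel)"
    unfolding X_def
  proof (intro nn_integral_mono mult_right_mono)
    fix y z
    have "?\<omega> y * ennreal (\<Psi> y z / 2) \<le> ?\<omega> y * ennreal (k * half_line_weight \<sigma> z)"
      using \<Psi>_le_weight[of y z] \<Psi>_nonneg[of y z] by (intro mult_left_mono ennreal_leI) (linarith | simp)+
    then show "?\<omega> y * ennreal (\<Psi> y z / 2) \<le> ennreal k * (?\<omega> y * w z)"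
      using k_nonneg by (simp add: ennreal_mult mult_ac)
  qed auto
  also have "\<dots> = ennreal k * (moment r f * weight f)" by (subst split) (auto simp: moment_def)
  also have "\<dots> < \<infinity>" using fin by (simp add: ennreal_mult_less_top)
  finally have Xfin: "X < \<infinity>" .
  have point: "weak_kernel compensator ?\<omega> y z + (?\<omega> y * ennreal (\<Psi> y z / 2) + ?\<omega> y * ennreal (\<Psi> y z / 2))
     \<le> (?\<omega> y * ennreal (\<Psi> y z / 2) + ?\<omega> z * ennreal (\<Psi> y z / 2))
       + (ennreal (c / 2) * (?p 1 y * ?p 0 z) + ennreal (c / 2) * (?p 0 y * ?p 1 z)) + ennreal k * (?\<omega> y * w z)" for y z
  proof (cases "0 < y \<and> 0 < z")
    case False
    then show ?thesis by (auto simp: weak_kernel_def \<Psi>_outside compensator_def)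
  next
    case True
    then have yz: "0 < y" "0 < z" "0 < y + z" by auto
    have "weak_kernel compensator ?\<omega> y z \<le> ennreal ((y + z) powr r) * ennreal (E y z * \<Psi> y z / 2)
       + ennreal (a * (y + z) powr r) * ennreal ((1 - E y z) * \<Psi> y z / 2) + ennreal (y powr r) * ennreal (compensator y z)"
      unfolding weak_kernel_def using yz by (intro add_mono mult_right_mono frag) (auto simp: pos_powr_def)
    also have "\<dots> = ennreal ((y + z) powr r * (E y z * \<Psi> y z / 2) + a * (y + z) powr r * ((1 - E y z) * \<Psi> y z / 2)
        + y powr r * compensator y z)"
      using a admissible_compensator by (simp add: ennreal_mult ennreal_plus admissible_def del: times_divide_eq_right)
    finally have "weak_kernel compensator ?\<omega> y z + (?\<omega> y * ennreal (\<Psi> y z / 2) + ?\<omega> y * ennreal (\<Psi> y z / 2))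
       \<le> ennreal ((y + z) powr r * (E y z * \<Psi> y z / 2) + a * (y + z) powr r * ((1 - E y z) * \<Psi> y z / 2)
        + y powr r * compensator y z) + (?\<omega> y * ennreal (\<Psi> y z / 2) + ?\<omega> y * ennreal (\<Psi> y z / 2))"
      by (rule add_right_mono)
    also have "\<dots> = ennreal (((y + z) powr r * (E y z * \<Psi> y z / 2) + a * (y + z) powr r * ((1 - E y z) * \<Psi> y z / 2)
        + y powr r * compensator y z) + (y powr r * (\<Psi> y z / 2) + y powr r * (\<Psi> y z / 2)))"
      using a admissible_compensator yz
      by (simp add: ennreal_mult[symmetric] ennreal_plus[symmetric] admissible_def pos_powr_def
        del: times_divide_eq_right ennreal_plus)
    also have "\<dots> \<le> ennreal ((y powr r * (\<Psi> y z / 2) + z powr r * (\<Psi> y z / 2))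
        + (c / 2 * (y * 1) + c / 2 * (1 * z)) + k * (y powr r * half_line_weight \<sigma> z))"
    proof (rule ennreal_leI)
      have d: "compensator y z = k * half_line_weight \<sigma> z - \<Psi> y z" using yz by (simp add: compensator_def)
      show "((y + z) powr r * (E y z * \<Psi> y z / 2) + a * (y + z) powr r * ((1 - E y z) * \<Psi> y z / 2)
        + y powr r * compensator y z) + (y powr r * (\<Psi> y z / 2) + y powr r * (\<Psi> y z / 2))
        \<le> (y powr r * (\<Psi> y z / 2) + z powr r * (\<Psi> y z / 2))
        + (c / 2 * (y * 1) + c / 2 * (1 * z)) + k * (y powr r * half_line_weight \<sigma> z)"
        unfolding d using pw[OF yz(1,2)] by (simp add: field_simps)
    qed
    also have "\<dots> = (?\<omega> y * ennreal (\<Psi> y z / 2) + ?\<omega> z * ennreal (\<Psi> y z / 2))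
       + (ennreal (c / 2) * (?p 1 y * ?p 0 z) + ennreal (c / 2) * (?p 0 y * ?p 1 z)) + ennreal k * (?\<omega> y * w z)"
      using c yz k_nonneg
      by (simp add: ennreal_mult[symmetric] ennreal_plus[symmetric] pos_powr_def del: times_divide_eq_right times_divide_eq_left ennreal_plus)
    finally show ?thesis .
  qed
  have "(\<integral>\<^sup>+x. ?\<omega> x * bilin compensator f f x \<partial>lborel) + (X + X)
      = (\<integral>\<^sup>+y. \<integral>\<^sup>+z. (weak_kernel compensator ?\<omega> y z + (?\<omega> y * ennreal (\<Psi> y z / 2) + ?\<omega> y * ennreal (\<Psi> y z / 2)))
          * (f y * f z) \<partial>lborel \<partial>lborel)"
  proof -
    have [measurable]: "(\<lambda>(y, z). weak_kernel compensator ?\<omega> y z) \<in> borel_measurable (borel \<Otimes>\<^sub>M borel)"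
      unfolding weak_kernel_def by measurable
    have "(\<integral>\<^sup>+x. ?\<omega> x * bilin compensator f f x \<partial>lborel) = (\<integral>\<^sup>+y. \<integral>\<^sup>+z. weak_kernel compensator ?\<omega> y z * (f y * f z) \<partial>lborel \<partial>lborel)"
      by (rule weak_form) measurable
    then show ?thesis unfolding X_def distrib_right by (simp add: nn_integral_add)
  qed
  also have "\<dots> \<le> (\<integral>\<^sup>+y. \<integral>\<^sup>+z. ((?\<omega> y * ennreal (\<Psi> y z / 2) + ?\<omega> z * ennreal (\<Psi> y z / 2))
       + (ennreal (c / 2) * (?p 1 y * ?p 0 z) + ennreal (c / 2) * (?p 0 y * ?p 1 z)) + ennreal k * (?\<omega> y * w z))
          * (f y * f z) \<partial>lborel \<partial>lborel)"
    by (intro nn_integral_mono mult_right_mono point) auto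
  also have "\<dots> = (X + (\<integral>\<^sup>+y. \<integral>\<^sup>+z. ?\<omega> z * ennreal (\<Psi> y z / 2) * (f y * f z) \<partial>lborel \<partial>lborel))
      + ((\<integral>\<^sup>+y. \<integral>\<^sup>+z. ennreal (c / 2) * (?p 1 y * ?p 0 z) * (f y * f z) \<partial>lborel \<partial>lborel)
        + (\<integral>\<^sup>+y. \<integral>\<^sup>+z. ennreal (c / 2) * (?p 0 y * ?p 1 z) * (f y * f z) \<partial>lborel \<partial>lborel))
      + (\<integral>\<^sup>+y. \<integral>\<^sup>+z. ennreal k * (?\<omega> y * w z) * (f y * f z) \<partial>lborel \<partial>lborel)"
    unfolding X_def distrib_right by (simp add: nn_integral_add)
  also have "\<dots> = (X + X) + (ennreal (c / 2) * (moment 1 f * moment 0 f) + ennreal (c / 2) * (moment 0 f * moment 1 f))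
      + ennreal k * (moment r f * weight f)"
    unfolding X_sym by (subst (1 2 3) split) (auto simp: moment_def)
  also have "ennreal (c / 2) * (moment 1 f * moment 0 f) + ennreal (c / 2) * (moment 0 f * moment 1 f)
      = (ennreal (c / 2) + ennreal (c / 2)) * (moment 1 f * moment 0 f)"
    by (simp add: distrib_right mult.commute[of "moment 0 f"])
  also have "ennreal (c / 2) + ennreal (c / 2) = ennreal c"
    using c by (simp add: ennreal_plus[symmetric] del: ennreal_plus)
  finally have "(X + X) + (\<integral>\<^sup>+x. ?\<omega> x * bilin compensator f f x \<partial>lborel)
      \<le> (X + X) + (ennreal c * (moment 1 f * moment 0 f) + ennreal k * (weight f * moment r f))"
    by (simp add: add_ac mult_ac)
  then show ?thesis using Xfin by (auto simp: ennreal_add_left_cancel_le)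
qed

text \<open>
  On the unit square the outcome of a collision counts as at most two particles, and each of them
  counts no more than the mean of its parents. Off the square \<open>x + y \<ge> 1\<close>, hence \<open>\<Psi> \<le> k\<close> and \<open>(x + y) powr r \<le> 1\<close>.
\<close>

lemma \<Psi>_powr_pointwise:
  assumes r: "r \<le> 0" and xy: "0 < x" "0 < y"
  shows "\<Psi> x y * (E x y + \<eta> * (1 - E x y)) * (x + y) powr r \<le> \<Psi> x y * (x powr r + y powr r) + \<eta> * k * (x + y)"
proof (cases "x < 1 \<and> y < 1")
  case True
  have "(x + y) powr r \<le> x powr r" "(x + y) powr r \<le> y powr r"
    using powr_mono2'[of r x "x + y"] powr_mono2'[of r y "x + y"] r xy by auto
  then have *: "2 * (x + y) powr r \<le> x powr r + y powr r" by linarith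
  have "(E x y + \<eta> * (1 - E x y)) * (x + y) powr r \<le> 2 * (x + y) powr r"
    using E_unit_square[of x y] True xy by (intro mult_right_mono) auto
  also note *
  finally have "\<Psi> x y * ((E x y + \<eta> * (1 - E x y)) * (x + y) powr r) \<le> \<Psi> x y * (x powr r + y powr r)"
    by (intro mult_left_mono) auto
  moreover have "0 \<le> \<eta> * k * (x + y)" using \<eta>_ge k_nonneg xy by auto
  ultimately show ?thesis by (simp add: mult.assoc)
next
  case False
  then have s: "1 \<le> x + y" using xy by linarith
  have "\<Psi> x y \<le> k * (x + y) powr (-\<sigma>)" by (rule \<Psi>_le[OF xy])
  also have "\<dots> \<le> k * 1" using powr_mono2'[of "-\<sigma>" 1 "x + y"] s \<sigma>_pos k_nonneg by (intro mult_left_mono) auto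
  finally have 1: "\<Psi> x y \<le> k" by simp
  have 2: "E x y + \<eta> * (1 - E x y) \<le> \<eta>"
    using mult_right_mono[of 1 \<eta> "E x y"] \<eta>_ge E_nonneg[of x y] by (simp add: algebra_simps)
  have 3: "(x + y) powr r \<le> 1" using powr_mono2'[of r 1 "x + y"] s r by auto
  have "0 \<le> E x y + \<eta> * (1 - E x y)" using \<eta>_ge by (simp add: add_nonneg_nonneg)
  then have "\<Psi> x y * (E x y + \<eta> * (1 - E x y)) * (x + y) powr r \<le> k * \<eta> * 1"
    using 1 2 3 k_nonneg \<eta>_ge by (intro mult_mono) auto
  also have "\<dots> \<le> k * \<eta> * (x + y)" using s k_nonneg \<eta>_ge by (intro mult_left_mono) auto
  finally have "\<Psi> x y * (E x y + \<eta> * (1 - E x y)) * (x + y) powr r \<le> \<eta> * k * (x + y)" by (simp add: mult_ac)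
  then show ?thesis by (simp add: add_increasing)
qed

lemma moment_le_weight:
  assumes "r \<in> {0, 1, -2 * \<sigma>}" shows "moment r f \<le> weight f"
  unfolding moment_def
proof (intro nn_integral_mono mult_right_mono ennreal_leI)
  show "pos_powr r x \<le> half_line_weight \<sigma> x" for x
    using assms by (auto simp: half_line_weight_eq_powers)
qed simp

lemma weight_eq_moments:
  assumes [measurable]: "f \<in> borel_measurable borel"
  shows "weight f = moment 0 f + moment 1 f + moment (-2 * \<sigma>) f"
  unfolding moment_def w_eq_powers distrib_right by (simp add: nn_integral_add)

lemma moment_growth:
  assumes f: "f \<in> borel_measurable borel" and fin: "weight f < \<infinity>"
  shows "(\<integral>\<^sup>+x. ennreal (pos_powr 1 x) * bilin compensator f f x \<partial>lborel) \<le> ennreal k * (weight f * moment 1 f)"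
    and "r \<in> {0, -2 * \<sigma>} \<Longrightarrow> (\<integral>\<^sup>+x. ennreal (pos_powr r x) * bilin compensator f f x \<partial>lborel)
      \<le> ennreal (\<eta> * k) * (moment 1 f * moment 0 f) + ennreal k * (weight f * moment r f)"
proof -
  have fin': "moment r f < \<infinity>" if "r \<in> {0, 1, -2 * \<sigma>}" for r
    using moment_le_weight[OF that] fin by (rule le_less_trans)
  have "(\<integral>\<^sup>+x. ennreal (pos_powr 1 x) * bilin compensator f f x \<partial>lborel)
      \<le> ennreal 0 * (moment 1 f * moment 0 f) + ennreal k * (weight f * moment 1 f)"
    by (rule moment_growth_general[where a=1, OF f fin fin']) (use fragment_moment_powr in auto)
  then show "(\<integral>\<^sup>+x. ennreal (pos_powr 1 x) * bilin compensator f f x \<partial>lborel) \<le> ennreal k * (weight f * moment 1 f)"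
    by simp
  show "(\<integral>\<^sup>+x. ennreal (pos_powr r x) * bilin compensator f f x \<partial>lborel)
      \<le> ennreal (\<eta> * k) * (moment 1 f * moment 0 f) + ennreal k * (weight f * moment r f)" if "r \<in> {0, -2 * \<sigma>}"
  proof (rule moment_growth_general[where a=\<eta>, OF f fin fin'])
    show "fragment_moment (enn (pos_powr r)) x y \<le> ennreal (\<eta> * (x + y) powr r)"
      if "0 < x" "0 < y" for x y
      using fragment_moment_powr(1,3)[OF that] \<open>r \<in> {0, -2 * \<sigma>}\<close> by blast
    show "\<Psi> x y * (E x y + \<eta> * (1 - E x y)) * (x + y) powr r \<le> \<Psi> x y * (x powr r + y powr r) + \<eta> * k * (x + y)"
      if "0 < x" "0 < y" for x y
      using \<Psi>_powr_pointwise[OF _ that, of r] \<open>r \<in> {0, -2 * \<sigma>}\<close> \<sigma>_pos by auto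
  qed (use that \<eta>_ge k_nonneg in auto)
qed

end


section \<open>Unlimited lifespan and the change of time\<close>

locale collision_model_datum = collision_model +
  fixes f0 :: "real \<Rightarrow> real"
  assumes f0_measurable [measurable]: "f0 \<in> borel_measurable borel"
    and f0_nonneg [simp]: "0 \<le> f0 x"
    and f0_weight: "(\<integral>\<^sup>+x. ennreal (half_line_weight \<sigma> x) * ennreal (f0 x) \<partial>lborel) < \<infinity>"
begin

abbreviation u0 :: "real \<Rightarrow> ennreal" where "u0 x \<equiv> ennreal (f0 x)"

definition u :: "real \<Rightarrow> real \<Rightarrow> ennreal" where "u = flow u0"

lemma u0_measurable: "u0 \<in> borel_measurable borel" by measurable

lemma u_measurable [measurable]: "joint_borel u"
  unfolding u_def by (rule flow_measurable) measurable

text \<open>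
  The lifespan of the compensated solution. It is an interval containing \<open>0\<close> and may be bounded.
\<close>

definition J :: "real set" where "J = {\<tau>. 0 \<le> \<tau> \<and> weight (u \<tau>) < \<infinity>}"

lemma J_nonneg: "\<tau> \<in> J \<Longrightarrow> 0 \<le> \<tau>" by (simp add: J_def)

lemma u_mono: "0 \<le> a \<Longrightarrow> a \<le> b \<Longrightarrow> u a x \<le> u b x"
  unfolding u_def by (rule flow_mono[OF u0_measurable])

lemma weight_mono: "0 \<le> a \<Longrightarrow> a \<le> b \<Longrightarrow> weight (u a) \<le> weight (u b)"
  by (intro nn_integral_mono mult_left_mono u_mono) auto

lemma J_downward: "b \<in> J \<Longrightarrow> 0 \<le> a \<Longrightarrow> a \<le> b \<Longrightarrow> a \<in> J"
  unfolding J_def using weight_mono[of a b] by (auto intro: le_less_trans)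

lemma zero_in_J: "0 \<in> J"
  using f0_weight by (simp add: J_def u_def flow_0[OF u0_measurable])

definition m :: "real \<Rightarrow> real \<Rightarrow> real" where "m r \<tau> = enn2real (moment r (u \<tau>))"

text \<open>
  The weighted integral of \<open>u\<close>, written as a sum of moments; the two agree on the lifespan
  (\<open>weight_finite\<close>), and off it \<open>enn2real\<close> puts infinite moments to zero.
\<close>

definition U :: "real \<Rightarrow> real" where "U = (\<lambda>\<tau>. m 0 \<tau> + m 1 \<tau> + m (-2 * \<sigma>) \<tau>)"

lemma m_nonneg [simp]: "0 \<le> m r \<tau>" by (simp add: m_def)

lemma U_nonneg [simp]: "0 \<le> U \<tau>" by (simp add: U_def)

abbreviation "exponents \<equiv> {0, 1, -2 * \<sigma>}"

lemma moment_finite: "\<tau> \<in> J \<Longrightarrow> r \<in> exponents \<Longrightarrow> moment r (u \<tau>) = ennreal (m r \<tau>)"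
  using moment_le_weight[of r "u \<tau>"] unfolding m_def J_def
  by (intro ennreal_enn2real[symmetric]) (auto simp: less_top[symmetric] top_unique)

lemma weight_finite: "\<tau> \<in> J \<Longrightarrow> weight (u \<tau>) = ennreal (U \<tau>)"
  by (subst weight_eq_moments) (auto simp: moment_finite U_def)

lemma moment_step:
  assumes "0 \<le> a" "a \<le> b"
  shows "moment r (u b) = moment r (u a)
    + (\<integral>\<^sup>+s\<in>{a..b}. (\<integral>\<^sup>+x. ennreal (pos_powr r x) * bilin compensator (u s) (u s) x \<partial>lborel) \<partial>lborel)"
  unfolding moment_def u_def by (rule moment_split[OF u0_measurable _ assms]) measurable

text \<open>
  The rate of change of each moment is at most the weighted integral of \<open>Q(u)\<close>, hence bounded up to time
  \<open>b\<close>. So the moments are Lipschitz continuous.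
\<close>

lemma m_increment:
  assumes b: "b \<in> J" and r: "r \<in> exponents" and ac: "0 \<le> a" "a \<le> c" "c \<le> b"
  shows "m r a \<le> m r c" "m r c \<le> m r a + bound * (U b)\<^sup>2 * (c - a)"
proof -
  have J: "a \<in> J" "c \<in> J" using J_downward[OF b] ac by auto
  have "(\<integral>\<^sup>+s\<in>{a..c}. (\<integral>\<^sup>+x. ennreal (pos_powr r x) * bilin compensator (u s) (u s) x \<partial>lborel) \<partial>lborel)
      \<le> (\<integral>\<^sup>+s\<in>{a..c}. ennreal (bound * (U b)\<^sup>2) \<partial>lborel)"
  proof (rule nn_integral_mono)
    fix s
    have "(\<integral>\<^sup>+x. ennreal (pos_powr r x) * bilin compensator (u s) (u s) x \<partial>lborel) \<le> ennreal (bound * (U b)\<^sup>2)"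
      if s: "s \<in> {a..c}"
    proof -
      have "(\<integral>\<^sup>+x. ennreal (pos_powr r x) * bilin compensator (u s) (u s) x \<partial>lborel) \<le> weight (bilin compensator (u s) (u s))"
        using moment_le_weight[OF r] unfolding moment_def .
      also have "\<dots> \<le> ennreal bound * (weight (u s))\<^sup>2" by (rule Q_bound) measurable
      also have "\<dots> \<le> ennreal bound * (weight (u b))\<^sup>2"
        using s ac by (intro mult_left_mono power_mono weight_mono) auto
      also have "\<dots> = ennreal (bound * (U b)\<^sup>2)"
        by (simp add: weight_finite[OF b] ennreal_power ennreal_mult bound_nonneg)
      finally show ?thesis .
    qed
    then show "(\<integral>\<^sup>+x. ennreal (pos_powr r x) * bilin compensator (u s) (u s) x \<partial>lborel) * indicator {a..c} s
      \<le> ennreal (bound * (U b)\<^sup>2) * indicator {a..c} s" by (auto simp: indicator_def)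
  qed
  also have "\<dots> = ennreal (bound * (U b)\<^sup>2 * (c - a))"
    using ac bound_nonneg by (simp add: nn_integral_cmult_indicator ennreal_mult)
  finally have "moment r (u c) \<le> moment r (u a) + ennreal (bound * (U b)\<^sup>2 * (c - a))"
    unfolding moment_step[OF ac(1,2)] by (rule add_left_mono)
  then have "ennreal (m r c) \<le> ennreal (m r a + bound * (U b)\<^sup>2 * (c - a))"
    using ac bound_nonneg by (simp add: moment_finite[OF J(1) r] moment_finite[OF J(2) r] ennreal_plus)
  then show "m r c \<le> m r a + bound * (U b)\<^sup>2 * (c - a)"
    using ac bound_nonneg by (subst (asm) ennreal_le_iff) (auto intro!: add_nonneg_nonneg mult_nonneg_nonneg)
  have "moment r (u a) \<le> moment r (u c)" unfolding moment_step[OF ac(1,2)] by simp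
  then show "m r a \<le> m r c" by (simp add: moment_finite[OF J(1) r] moment_finite[OF J(2) r])
qed

lemma m_continuous:
  assumes b: "b \<in> J" and r: "r \<in> exponents"
  shows "continuous_on {0..b} (m r)"
proof (rule lipschitz_on_continuous_on, rule lipschitz_onI)
  show "0 \<le> bound * (U b)\<^sup>2" using bound_nonneg by simp
  fix a c assume "a \<in> {0..b}" "c \<in> {0..b}"
  then show "dist (m r a) (m r c) \<le> bound * (U b)\<^sup>2 * dist a c"
  proof (induction a c rule: linorder_wlog)
    case (le a c)
    then show ?case using m_increment[OF b r, of a c] by (auto simp: dist_real_def)
  qed (simp add: dist_commute)
qed

lemma U_continuous: "b \<in> J \<Longrightarrow> continuous_on {0..b} U"
  unfolding U_def by (intro continuous_intros m_continuous) auto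

lemma U_mono: "b \<in> J \<Longrightarrow> 0 \<le> a \<Longrightarrow> a \<le> b \<Longrightarrow> U a \<le> U b"
  unfolding U_def by (intro add_mono m_increment) auto

lemma m_integral_inequality:
  assumes b: "b \<in> J" and s: "s \<in> {0..b}" and r: "r \<in> exponents"
    and \<rho>: "continuous_on {0..b} \<rho>" "\<And>t. 0 \<le> \<rho> t"
      "\<And>t. t \<in> J \<Longrightarrow> (\<integral>\<^sup>+x. ennreal (pos_powr r x) * bilin compensator (u t) (u t) x \<partial>lborel) \<le> ennreal (\<rho> t)"
  shows "m r s \<le> m r 0 + integral {0..s} \<rho>"
proof -
  have J: "s \<in> J" using J_downward[OF b] s by auto
  have int: "(\<rho> has_integral integral {0..s} \<rho>) {0..s}"
    using s by (intro integrable_integral integrable_continuous_interval continuous_on_subset[OF \<rho>(1)]) auto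
  have "ennreal (m r s) = moment r (u s)" by (simp add: moment_finite[OF J r])
  also have "\<dots> = moment r (u 0)
    + (\<integral>\<^sup>+t\<in>{0..s}. (\<integral>\<^sup>+x. ennreal (pos_powr r x) * bilin compensator (u t) (u t) x \<partial>lborel) \<partial>lborel)"
    by (rule moment_step) (use s in auto)
  also have "\<dots> \<le> moment r (u 0) + (\<integral>\<^sup>+t\<in>{0..s}. ennreal (\<rho> t) \<partial>lborel)"
    using J_downward[OF b] s by (intro add_left_mono nn_integral_mono) (auto simp: indicator_def intro!: \<rho>(3))
  also have "(\<integral>\<^sup>+t\<in>{0..s}. ennreal (\<rho> t) \<partial>lborel) = ennreal (integral {0..s} \<rho>)"
    by (rule nn_integral_has_integral_lebesgue'[OF _ int]) (rule \<rho>(2))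
  also have "moment r (u 0) + ennreal (integral {0..s} \<rho>) = ennreal (m r 0 + integral {0..s} \<rho>)"
    using \<rho>(2) int by (simp add: moment_finite[OF zero_in_J r] has_integral_nonneg ennreal_plus)
  finally show ?thesis
    using \<rho>(2) int by (subst (asm) ennreal_le_iff) (auto simp: has_integral_nonneg intro!: add_nonneg_nonneg)
qed

text \<open>
  The factor that undoes the compensation, and the time of the original equation as a function of the
  time of the compensated one.
\<close>

definition \<phi> :: "real \<Rightarrow> real" where "\<phi> \<tau> = exp (- k * integral {0..\<tau>} U)"
definition \<theta> :: "real \<Rightarrow> real" where "\<theta> \<tau> = integral {0..\<tau>} (\<lambda>s. 1 / \<phi> s)"

lemma \<phi>_pos [simp]: "0 < \<phi> \<tau>" by (simp add: \<phi>_def)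

lemma \<phi>_nonneg [simp]: "0 \<le> \<phi> \<tau>" by (simp add: \<phi>_def)

lemma \<phi>_neq_0 [simp]: "\<phi> \<tau> \<noteq> 0" by (simp add: \<phi>_def)

lemma \<phi>_continuous: "b \<in> J \<Longrightarrow> continuous_on {0..b} \<phi>"
  unfolding \<phi>_def by (intro continuous_intros continuous_on_integral U_continuous)

lemma inverse_\<phi>_continuous: "b \<in> J \<Longrightarrow> continuous_on {0..b} (\<lambda>s. 1 / \<phi> s)"
  by (intro continuous_intros \<phi>_continuous) (auto simp: \<phi>_def)

lemma \<theta>_continuous: "b \<in> J \<Longrightarrow> continuous_on {0..b} \<theta>"
  unfolding \<theta>_def by (intro continuous_on_integral inverse_\<phi>_continuous)

lemma \<phi>_le_1: assumes "\<tau> \<in> J" shows "\<phi> \<tau> \<le> 1"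
proof -
  have "0 \<le> integral {0..\<tau>} U"
    by (intro integral_nonneg integrable_continuous_interval U_continuous assms) auto
  then show ?thesis using k_nonneg by (simp add: \<phi>_def)
qed

lemma \<theta>_increment:
  assumes b: "b \<in> J" and a: "0 \<le> a" "a \<le> b" shows "b - a \<le> \<theta> b - \<theta> a"
proof -
  have int: "(\<lambda>s. 1 / \<phi> s) integrable_on {0..b}"
    by (intro integrable_continuous_interval inverse_\<phi>_continuous b)
  have "\<theta> a + integral {a..b} (\<lambda>s. 1 / \<phi> s) = \<theta> b"
    unfolding \<theta>_def using a int by (intro Henstock_Kurzweil_Integration.integral_combine) auto
  moreover have "integral {a..b} (\<lambda>s. 1) \<le> integral {a..b} (\<lambda>s. 1 / \<phi> s)"
  proof (rule integral_le)
    show "(\<lambda>s. 1 / \<phi> s) integrable_on {a..b}"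
      using a by (intro integrable_continuous_interval continuous_on_subset[OF inverse_\<phi>_continuous[OF b]]) auto
    show "1 \<le> 1 / \<phi> s" if "s \<in> {a..b}" for s
      using \<phi>_le_1[OF J_downward[OF b]] that a by simp
  qed auto
  ultimately show ?thesis using a by simp
qed

lemma \<theta>_0: "\<theta> 0 = 0" by (simp add: \<theta>_def)

lemma a_priori_bound:
  assumes \<tau>: "\<tau> \<in> J"
  shows "\<phi> \<tau> * U \<tau> \<le> m 1 0 + m (-2 * \<sigma>) 0 + 2 * (m 0 0 * exp (\<eta> * k * m 1 0 * \<theta> \<tau>))"
proof -
  have growth: "(\<integral>\<^sup>+x. ennreal (pos_powr 1 x) * bilin compensator (u t) (u t) x \<partial>lborel) \<le> ennreal (0 + k * U t * m 1 t)"
    "r \<in> {0, -2 * \<sigma>} \<Longrightarrow> (\<integral>\<^sup>+x. ennreal (pos_powr r x) * bilin compensator (u t) (u t) x \<partial>lborel)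
       \<le> ennreal (\<eta> * k * (m 1 t * m 0 t) + k * U t * m r t)" if t: "t \<in> J" for r t
  proof -
    have fin: "u t \<in> borel_measurable borel" "weight (u t) < \<infinity>" using t by (auto simp: J_def)
    show "(\<integral>\<^sup>+x. ennreal (pos_powr 1 x) * bilin compensator (u t) (u t) x \<partial>lborel) \<le> ennreal (0 + k * U t * m 1 t)"
      using moment_growth(1)[OF fin] k_nonneg
      by (simp add: weight_finite[OF t] moment_finite[OF t] ennreal_mult mult.assoc)
    show "(\<integral>\<^sup>+x. ennreal (pos_powr r x) * bilin compensator (u t) (u t) x \<partial>lborel)
       \<le> ennreal (\<eta> * k * (m 1 t * m 0 t) + k * U t * m r t)" if r: "r \<in> {0, -2 * \<sigma>}"
    proof -
      have r': "r \<in> exponents" using r by auto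
      show ?thesis
        using moment_growth(2)[OF fin r] k_nonneg \<eta>_ge
        by (simp add: weight_finite[OF t] moment_finite[OF t] moment_finite[OF t r'] ennreal_mult ennreal_plus mult.assoc)
    qed
  qed
  have c: "continuous_on {0..\<tau>} (m 1)" "continuous_on {0..\<tau>} (m 0)" "continuous_on {0..\<tau>} (m (-2 * \<sigma>))"
    "continuous_on {0..\<tau>} U"
    using m_continuous[OF \<tau>] U_continuous[OF \<tau>] by auto
  show ?thesis unfolding \<phi>_def \<theta>_def
  proof (rule moment_system_bound[OF c(1,2,3)])
    show "U = (\<lambda>s. m 0 s + m 1 s + m (-2 * \<sigma>) s)" by (rule U_def)
    show "m 1 s \<le> m 1 0 + integral {0..s} (\<lambda>r. 0 + k * U r * m 1 r)" if s: "s \<in> {0..\<tau>}" for s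
      by (rule m_integral_inequality[OF \<tau> s _ _ _ growth(1)])
         (use k_nonneg in \<open>auto intro!: continuous_intros c\<close>)
    show "m 0 s \<le> m 0 0 + integral {0..s} (\<lambda>r. \<eta> * k * (m 1 r * m 0 r) + k * U r * m 0 r)" if s: "s \<in> {0..\<tau>}" for s
      by (rule m_integral_inequality[OF \<tau> s _ _ _ growth(2)])
         (use k_nonneg \<eta>_ge in \<open>auto intro!: continuous_intros c\<close>)
    show "m (-2 * \<sigma>) s \<le> m (-2 * \<sigma>) 0 + integral {0..s} (\<lambda>r. \<eta> * k * (m 1 r * m 0 r) + k * U r * m (-2 * \<sigma>) r)"
      if s: "s \<in> {0..\<tau>}" for s
    proof (rule m_integral_inequality[OF \<tau> s _ _ _ growth(2)])
      show "continuous_on {0..\<tau>} (\<lambda>r. \<eta> * k * (m 1 r * m 0 r) + k * U r * m (-2 * \<sigma>) r)"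
        by (intro continuous_intros c)
    qed (use k_nonneg \<eta>_ge in auto)
  qed (use k_nonneg \<eta>_ge \<tau> in \<open>auto simp: J_def\<close>)
qed

text \<open>
  If \<open>\<theta>\<close> stayed below \<open>\<Theta>\<close>, then \<open>\<phi> U\<close> would be bounded by the a priori estimate. As \<open>U\<close> is then at most a
  multiple of \<open>1 / \<phi>\<close>, the derivative of \<open>\<theta>\<close>, the factor \<open>\<phi>\<close> would be bounded below and \<open>U\<close> bounded above.
  The lifespan would be closed under adding a fixed time step, hence unbounded, although \<open>\<tau> \<le> \<theta> \<tau>\<close>.
\<close>

lemma \<theta>_unbounded: "\<exists>\<tau>\<in>J. \<Theta> \<le> \<theta> \<tau>"
proof (rule ccontr)
  assume "\<not> ?thesis"
  then have less: "\<theta> \<tau> < \<Theta>" if "\<tau> \<in> J" for \<tau> using that by force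
  define B where "B = m 1 0 + m (-2 * \<sigma>) 0 + 2 * (m 0 0 * exp (\<eta> * k * m 1 0 * \<Theta>))"
  have B0: "0 \<le> B" by (simp add: B_def)
  have UB: "U \<tau> \<le> B * (1 / \<phi> \<tau>)" if "\<tau> \<in> J" for \<tau>
  proof -
    have "exp (\<eta> * k * m 1 0 * \<theta> \<tau>) \<le> exp (\<eta> * k * m 1 0 * \<Theta>)"
      using less[OF that] \<eta>_ge k_nonneg by (auto intro!: mult_left_mono)
    then have "m 0 0 * exp (\<eta> * k * m 1 0 * \<theta> \<tau>) \<le> m 0 0 * exp (\<eta> * k * m 1 0 * \<Theta>)"
      by (rule mult_left_mono) simp
    then have "\<phi> \<tau> * U \<tau> \<le> B" using a_priori_bound[OF that] by (simp add: B_def)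
    then show ?thesis using \<phi>_pos[of \<tau>] by (simp add: field_simps)
  qed
  define A where "A = B * exp (k * (B * \<Theta>))"
  have A0: "0 \<le> A" using B0 by (simp add: A_def)
  have UA: "U \<tau> \<le> A" if \<tau>: "\<tau> \<in> J" for \<tau>
  proof -
    have "integral {0..\<tau>} U \<le> integral {0..\<tau>} (\<lambda>s. B * (1 / \<phi> s))"
      using UB J_downward[OF \<tau>]
      by (intro integral_le integrable_continuous_interval continuous_intros U_continuous inverse_\<phi>_continuous \<tau>) auto
    also have "\<dots> = B * \<theta> \<tau>" unfolding \<theta>_def by (rule Henstock_Kurzweil_Integration.integral_mult_right)
    also have "\<dots> \<le> B * \<Theta>" using less[OF \<tau>] B0 by (intro mult_left_mono) auto
    finally have "k * integral {0..\<tau>} U \<le> k * (B * \<Theta>)" using k_nonneg by (rule mult_left_mono)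
    then have "1 / \<phi> \<tau> \<le> exp (k * (B * \<Theta>))" by (simp add: \<phi>_def exp_minus field_simps)
    then show ?thesis using UB[OF \<tau>] B0 mult_left_mono[of "1 / \<phi> \<tau>" "exp (k * (B * \<Theta>))" B]
      unfolding A_def by linarith
  qed
  (* The step length granted by weight_flow_bound; the summand 1 keeps the denominator positive. *)
  define e where "e = 1 / (4 * bound * A + 1)"
  have pos: "4 * bound * A + 1 > 0" using A0 bound_nonneg by (intro add_nonneg_pos) auto
  then have e: "e > 0" "4 * bound * A * e \<le> 1" by (auto simp: e_def field_simps)
  have step: "\<tau> + e \<in> J" if \<tau>: "\<tau> \<in> J" for \<tau>
  proof -
    have "weight (u (\<tau> + e)) \<le> weight (flow (u \<tau>) e)"
      unfolding u_def by (intro nn_integral_mono mult_left_mono flow_restart[OF u0_measurable]) (use e J_nonneg[OF \<tau>] in auto)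
    also have "\<dots> \<le> ennreal (2 * A)"
    proof (rule weight_flow_bound)
      show "weight (u \<tau>) \<le> ennreal A" using UA[OF \<tau>] by (simp add: weight_finite[OF \<tau>] ennreal_leI)
    qed (use A0 e in auto)
    also have "\<dots> < \<infinity>" by simp
    finally show ?thesis using e J_nonneg[OF \<tau>] by (simp add: J_def)
  qed
  have "real n * e \<in> J" for n
  proof (induction n)
    case (Suc n)
    then show ?case using step[OF Suc] by (simp add: distrib_right add.commute)
  qed (use zero_in_J in simp)
  then have "real n * e < \<Theta>" for n
    using \<theta>_increment[of "real n * e" 0] less[of "real n * e"] e \<theta>_0 by force
  moreover obtain n where "\<Theta> < real n * e" using reals_Archimedean3[OF e(1)] by blast
  ultimately show False by (meson less_asym)
qed

text \<open>
  The inverse of \<open>\<theta>\<close>.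
\<close>

definition T :: "real \<Rightarrow> real" where "T t = (SOME \<tau>. \<tau> \<in> J \<and> \<theta> \<tau> = t)"

lemma T: assumes "0 \<le> t" shows "T t \<in> J" "\<theta> (T t) = t"
proof -
  obtain b where b: "b \<in> J" "t \<le> \<theta> b" using \<theta>_unbounded by blast
  have "\<exists>\<tau>\<ge>0. \<tau> \<le> b \<and> \<theta> \<tau> = t"
    by (rule IVT') (use b \<theta>_0 assms J_nonneg \<theta>_continuous in auto)
  then have "\<exists>\<tau>. \<tau> \<in> J \<and> \<theta> \<tau> = t" using J_downward[OF b(1)] by blast
  then have "T t \<in> J \<and> \<theta> (T t) = t" unfolding T_def by (rule someI_ex)
  then show "T t \<in> J" "\<theta> (T t) = t" by auto
qed

lemma T_nonneg: "0 \<le> t \<Longrightarrow> 0 \<le> T t" using T J_nonneg by blast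

lemma T_\<theta>: assumes "\<tau> \<in> J" shows "T (\<theta> \<tau>) = \<tau>"
proof -
  have \<theta>0: "0 \<le> \<theta> \<tau>" using \<theta>_increment[OF assms, of 0] \<theta>_0 J_nonneg[OF assms] by simp
  note T' = T[OF \<theta>0] and J0 = J_nonneg[OF assms] and T0 = J_nonneg[OF T(1)[OF \<theta>0]]
  show ?thesis
    using \<theta>_increment[OF assms T0] \<theta>_increment[OF T'(1) J0] T'(2) by linarith
qed

lemma T_0: "T 0 = 0" using T_\<theta>[OF zero_in_J] by (simp add: \<theta>_0)

lemma T_mono_lipschitz:
  assumes "0 \<le> s" "s \<le> t" shows "T s \<le> T t" "T t - T s \<le> t - s"
proof -
  have J: "T s \<in> J" "T t \<in> J" "0 \<le> T s" "0 \<le> T t" using T T_nonneg assms by auto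
  show "T s \<le> T t"
    using \<theta>_increment[OF J(1) J(4)] T assms by force
  then show "T t - T s \<le> t - s" using \<theta>_increment[OF J(2) J(3)] T assms by simp
qed

lemma T_continuous: "continuous_on {0..} T"
proof (rule lipschitz_on_continuous_on, rule lipschitz_onI)
  fix a c :: real assume "a \<in> {0..}" "c \<in> {0..}"
  then show "dist (T a) (T c) \<le> 1 * dist a c"
  proof (induction a c rule: linorder_wlog)
    case (le a c)
    then show ?case using T_mono_lipschitz[of a c] by (auto simp: dist_real_def)
  qed (simp add: dist_commute)
qed simp

lemma T_strict: "0 \<le> s \<Longrightarrow> s < t \<Longrightarrow> T s < T t"
  using T_mono_lipschitz(1)[of s t] T(2)[of s] T(2)[of t] by (metis less_eq_real_def less_irrefl order_trans)

lemma T_isCont: "0 < t \<Longrightarrow> isCont T t"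
  using continuous_on_interior[OF T_continuous, of t] by simp

lemma T_derivative:
  assumes "0 < t" shows "(T has_real_derivative \<phi> (T t)) (at t)"
proof -
  have "0 < T t" using T_strict[of 0 t] T_0 assms by simp
  moreover have "T t < T (t + 1)" using T_strict assms by simp
  ultimately have "(\<theta> has_real_derivative 1 / \<phi> (T t)) (at (T t))"
    unfolding \<theta>_def
    by (intro integral_has_derivative_interior[OF inverse_\<phi>_continuous[OF T(1)[of "t + 1"]]]) (use assms in auto)
  then have "(T has_real_derivative inverse (1 / \<phi> (T t))) (at t)"
    by (rule DERIV_inverse_function[where a=0 and b="t + 1"]) (use assms T T_isCont in auto)
  then show ?thesis by (simp add: inverse_eq_divide)
qed

end


section \<open>The operators on real-valued profiles\<close>

lemma AE_lborel_reflect: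
  fixes R :: "real \<Rightarrow> bool"
  assumes "AE y in lborel. R y" shows "AE y in lborel. R (x - y)"
proof -
  obtain N where N: "N \<in> null_sets lborel" "{y. \<not> R y} \<subseteq> N"
    using assms by (auto simp: eventually_ae_filter)
  have [measurable]: "N \<in> sets borel" using N by (auto simp: null_sets_def)
  have "AE y in lborel. x + (-1) * y \<notin> N"
    by (rule AE_borel_affine) (use N in \<open>auto intro: AE_not_in\<close>)
  then show ?thesis by eventually_elim (use N in auto)
qed

lemma half_ennreal:
  assumes "0 \<le> a" shows "ennreal (a / 2) = 1 / 2 * ennreal a"
proof -
  have "ennreal (a / 2) = ennreal a / ennreal 2"
    using assms by (intro divide_ennreal[symmetric]) auto
  also have "\<dots> = 1 / 2 * ennreal a" by (simp add: divide_ennreal_def mult.commute)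
  finally show ?thesis .
qed

context collision_model begin

lemma coag_cong:
  assumes f: "AE y in lborel. 0 < y \<longrightarrow> f y = f' y" and h: "AE y in lborel. 0 < y \<longrightarrow> h y = h' y"
  shows "coag f h x = coag f' h' x"
  unfolding coag_def
proof (rule nn_integral_cong_AE)
  show "AE y in lborel. ennreal (E (x - y) y * \<Psi> (x - y) y / 2) * (f (x - y) * h y)
      = ennreal (E (x - y) y * \<Psi> (x - y) y / 2) * (f' (x - y) * h' y)"
    using AE_lborel_reflect[OF f, of x] h
  proof eventually_elim
    case (elim y)
    then show ?case by (cases "0 < x - y \<and> 0 < y") (auto simp: \<Psi>_outside)
  qed
qed

lemma breakage_cong:
  assumes f: "AE y in lborel. 0 < y \<longrightarrow> f y = f' y" and h: "AE y in lborel. 0 < y \<longrightarrow> h y = h' y"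
  shows "breakage f h x = breakage f' h' x"
  unfolding breakage_def
proof (rule nn_integral_cong_AE)
  show "AE y in lborel. (\<integral>\<^sup>+z. ennreal (P x y z * (1 - E y z) * \<Psi> y z / 2) * (f y * h z) \<partial>lborel)
     = (\<integral>\<^sup>+z. ennreal (P x y z * (1 - E y z) * \<Psi> y z / 2) * (f' y * h' z) \<partial>lborel)"
    using f
  proof eventually_elim
    case (elim y)
    show ?case
    proof (rule nn_integral_cong_AE)
      show "AE z in lborel. ennreal (P x y z * (1 - E y z) * \<Psi> y z / 2) * (f y * h z)
         = ennreal (P x y z * (1 - E y z) * \<Psi> y z / 2) * (f' y * h' z)"
        using h
      proof eventually_elim
        case (elim z)
        then show ?case using \<open>0 < y \<longrightarrow> f y = f' y\<close> by (cases "0 < y \<and> 0 < z") (auto simp: \<Psi>_outside)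
      qed
    qed
  qed
qed

lemma lin_cong:
  assumes h: "AE y in lborel. 0 < y \<longrightarrow> h y = h' y" and x: "f x = f' x" and K: "admissible K"
  shows "lin K f h x = lin K f' h' x"
proof -
  have "(\<integral>\<^sup>+y. ennreal (K x y) * h y \<partial>lborel) = (\<integral>\<^sup>+y. ennreal (K x y) * h' y \<partial>lborel)"
  proof (rule nn_integral_cong_AE)
    show "AE y in lborel. ennreal (K x y) * h y = ennreal (K x y) * h' y"
      using h
    proof eventually_elim
      case (elim y)
      then show ?case using K by (cases "0 < y") (auto simp: admissible_def)
    qed
  qed
  then show ?thesis by (simp add: lin_def x)
qed

lemma bilin_cong:
  assumes "AE y in lborel. 0 < y \<longrightarrow> f y = f' y" "AE y in lborel. 0 < y \<longrightarrow> h y = h' y"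
    and "f x = f' x" "admissible K"
  shows "bilin K f h x = bilin K f' h' x"
  unfolding bilin_def using coag_cong[OF assms(1,2)] breakage_cong[OF assms(1,2)] lin_cong[of h h' f x f', OF assms(2-4)] by simp

text \<open>
  Dominated convergence at a fixed point \<open>x\<close>. The breakage term needs it twice, the inner integral being
  finite only for almost every value of the outer variable.
\<close>

lemma bilin_tendsto:
  fixes F :: "nat \<Rightarrow> real \<Rightarrow> real" and f d :: "real \<Rightarrow> real"
  assumes [measurable]: "\<And>n. F n \<in> borel_measurable borel" "f \<in> borel_measurable borel" "d \<in> borel_measurable borel"
    and K: "joint_borel K" "\<And>x y. 0 \<le> K x y"
    and lim: "\<And>y. (\<lambda>n. F n y) \<longlonglongrightarrow> f y" and dom: "\<And>n y. 0 \<le> F n y" "\<And>n y. F n y \<le> d y"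
    and fin: "bilin K (enn d) (enn d) x < \<infinity>"
  shows "(\<lambda>n. bilin K (enn (F n)) (enn (F n)) x)
    \<longlonglongrightarrow> bilin K (enn f) (enn f) x"
proof -
  note [measurable] = K(1)
  have f0: "0 \<le> f y" for y using lim dom(1) by (intro LIMSEQ_le_const[OF lim]) auto
  have d0: "0 \<le> d y" for y using dom(1)[of 0 y] dom(2)[of 0 y] by linarith
  have conv: "(\<lambda>n. ennreal c * (ennreal (F n y) * ennreal (F n z))) \<longlonglongrightarrow> ennreal c * (ennreal (f y) * ennreal (f z))"
    if c: "0 \<le> c" for c y z
  proof -
    have "(\<lambda>n. ennreal (c * (F n y * F n z))) \<longlonglongrightarrow> ennreal (c * (f y * f z))"
      by (intro tendsto_ennrealI tendsto_intros lim)
    then show ?thesis using c dom(1) f0 by (simp add: ennreal_mult)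
  qed
  have le: "ennreal c * (ennreal (F n y) * ennreal (F n z)) \<le> ennreal c * (ennreal (d y) * ennreal (d z))" for c n y z
    by (intro mult_left_mono mult_mono ennreal_leI dom) auto
  let ?f = "\<lambda>y. ennreal (f y)" and ?F = "\<lambda>n y. ennreal (F n y)" and ?d = "\<lambda>y. ennreal (d y)"
  have fin': "coag ?d ?d x < \<infinity>" "breakage ?d ?d x < \<infinity>" "lin K ?d ?d x < \<infinity>"
    using fin by (auto simp: bilin_def)
  have "(\<lambda>n. coag (?F n) (?F n) x) \<longlonglongrightarrow> coag ?f ?f x"
    unfolding coag_def
    by (rule nn_integral_dominated_convergence[OF _ _ _ _ fin'(1)[unfolded coag_def]])
       (auto intro!: conv le)
  moreover have "(\<lambda>n. breakage (?F n) (?F n) x) \<longlonglongrightarrow> breakage ?f ?f x"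
    unfolding breakage_def
  proof (rule nn_integral_dominated_convergence[OF _ _ _ _ fin'(2)[unfolded breakage_def]])
    have "AE y in lborel. (\<integral>\<^sup>+z. ennreal (P x y z * (1 - E y z) * \<Psi> y z / 2) * (?d y * ?d z) \<partial>lborel) \<noteq> \<infinity>"
      by (rule nn_integral_PInf_AE) (use fin'(2) in \<open>auto simp: breakage_def\<close>)
    then show "AE y in lborel. (\<lambda>n. \<integral>\<^sup>+z. ennreal (P x y z * (1 - E y z) * \<Psi> y z / 2) * (?F n y * ?F n z) \<partial>lborel)
       \<longlonglongrightarrow> (\<integral>\<^sup>+z. ennreal (P x y z * (1 - E y z) * \<Psi> y z / 2) * (?f y * ?f z) \<partial>lborel)"
    proof eventually_elim
      case (elim y)
      then have y: "(\<integral>\<^sup>+z. ennreal (P x y z * (1 - E y z) * \<Psi> y z / 2) * (?d y * ?d z) \<partial>lborel) < \<infinity>"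
        by (simp add: less_top)
      show ?case
        by (rule nn_integral_dominated_convergence[OF _ _ _ _ y]) (auto intro!: conv le)
    qed
  qed (auto intro!: nn_integral_mono le)
  moreover have "(\<lambda>n. lin K (?F n) (?F n) x) \<longlonglongrightarrow> lin K ?f ?f x"
  proof -
    have eq: "lin K h h x = (\<integral>\<^sup>+y. ennreal (K x y) * (h x * h y) \<partial>lborel)" if [measurable]: "h \<in> borel_measurable borel" for h
    proof -
      have "lin K h h x = (\<integral>\<^sup>+y. h x * (ennreal (K x y) * h y) \<partial>lborel)"
        unfolding lin_def by (rule nn_integral_cmult[symmetric]) measurable
      then show ?thesis by (simp add: mult_ac)
    qed
    have y: "(\<integral>\<^sup>+y. ennreal (K x y) * (?d x * ?d y) \<partial>lborel) < \<infinity>" using fin'(3) by (subst (asm) eq) auto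
    have "(\<lambda>n. \<integral>\<^sup>+y. ennreal (K x y) * (?F n x * ?F n y) \<partial>lborel) \<longlonglongrightarrow> (\<integral>\<^sup>+y. ennreal (K x y) * (?f x * ?f y) \<partial>lborel)"
      by (rule nn_integral_dominated_convergence[OF _ _ _ _ y]) (auto intro!: conv le K(2))
    then show ?thesis by (simp add: eq)
  qed
  ultimately show ?thesis unfolding bilin_def by (intro tendsto_add)
qed

lemma coag_scale:
  assumes "0 \<le> c" and [measurable]: "f \<in> borel_measurable borel"
  shows "coag (\<lambda>y. ennreal (c * f y)) (\<lambda>y. ennreal (c * f y)) x = ennreal (c\<^sup>2) * coag (enn f) (enn f) x"
proof -
  have "coag (\<lambda>y. ennreal (c * f y)) (\<lambda>y. ennreal (c * f y)) x
      = (\<integral>\<^sup>+y. ennreal (c\<^sup>2) * (ennreal (E (x - y) y * \<Psi> (x - y) y / 2) * (ennreal (f (x - y)) * ennreal (f y))) \<partial>lborel)"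
    unfolding coag_def using assms(1) by (simp add: ennreal_mult' power2_eq_square mult_ac)
  also have "\<dots> = ennreal (c\<^sup>2) * coag (enn f) (enn f) x"
    unfolding coag_def by (rule nn_integral_cmult) measurable
  finally show ?thesis .
qed

lemma breakage_scale:
  assumes "0 \<le> c" and [measurable]: "f \<in> borel_measurable borel"
  shows "breakage (\<lambda>y. ennreal (c * f y)) (\<lambda>y. ennreal (c * f y)) x
    = ennreal (c\<^sup>2) * breakage (enn f) (enn f) x"
proof -
  have "breakage (\<lambda>y. ennreal (c * f y)) (\<lambda>y. ennreal (c * f y)) x
      = (\<integral>\<^sup>+y. \<integral>\<^sup>+z. ennreal (c\<^sup>2) * (ennreal (P x y z * (1 - E y z) * \<Psi> y z / 2) * (ennreal (f y) * ennreal (f z))) \<partial>lborel \<partial>lborel)"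
    unfolding breakage_def using assms(1) by (simp add: ennreal_mult' power2_eq_square mult_ac)
  also have "\<dots> = (\<integral>\<^sup>+y. ennreal (c\<^sup>2) * (\<integral>\<^sup>+z. ennreal (P x y z * (1 - E y z) * \<Psi> y z / 2) * (ennreal (f y) * ennreal (f z)) \<partial>lborel) \<partial>lborel)"
    by (intro nn_integral_cong nn_integral_cmult) measurable
  also have "\<dots> = ennreal (c\<^sup>2) * breakage (enn f) (enn f) x"
    unfolding breakage_def by (rule nn_integral_cmult) measurable
  finally show ?thesis .
qed

lemma lin_scale:
  assumes "0 \<le> c" and [measurable]: "f \<in> borel_measurable borel" "joint_borel K"
  shows "lin K (\<lambda>y. ennreal (c * f y)) (\<lambda>y. ennreal (c * f y)) x
    = ennreal (c\<^sup>2) * lin K (enn f) (enn f) x"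
proof -
  have "(\<integral>\<^sup>+y. ennreal (K x y) * ennreal (c * f y) \<partial>lborel) = (\<integral>\<^sup>+y. ennreal c * (ennreal (K x y) * ennreal (f y)) \<partial>lborel)"
    using assms(1) by (simp add: ennreal_mult' mult_ac)
  also have "\<dots> = ennreal c * (\<integral>\<^sup>+y. ennreal (K x y) * ennreal (f y) \<partial>lborel)"
    by (rule nn_integral_cmult) measurable
  finally show ?thesis using assms(1) by (simp add: lin_def ennreal_mult' power2_eq_square mult_ac)
qed

lemma op_Bc_eq_coag:
  assumes [measurable]: "f \<in> borel_measurable borel" and f: "\<And>y. 0 \<le> f y"
  shows "op_Bc \<Psi> E f x = coag (enn f) (enn f) x"
proof -
  have "op_Bc \<Psi> E f x = 1 / 2 * (\<integral>\<^sup>+y. ennreal (E (x - y) y * \<Psi> (x - y) y * f (x - y) * f y) \<partial>lborel)"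
    unfolding op_Bc_def nn_integral_completion
    by (intro arg_cong[where f="\<lambda>z. 1 / 2 * z"] nn_integral_cong) (auto simp: indicator_def \<Psi>_outside)
  also have "\<dots> = (\<integral>\<^sup>+y. 1 / 2 * ennreal (E (x - y) y * \<Psi> (x - y) y * f (x - y) * f y) \<partial>lborel)"
    by (rule nn_integral_cmult[symmetric]) measurable
  also have "\<dots> = coag (enn f) (enn f) x"
    unfolding coag_def
    by (intro nn_integral_cong) (simp add: half_ennreal ennreal_mult f mult_ac)
  finally show ?thesis .
qed

lemma op_Dcb_eq_lin:
  assumes [measurable]: "f \<in> borel_measurable borel" and f: "\<And>y. 0 \<le> f y"
  shows "op_Dcb \<Psi> f x = lin \<Psi> (enn f) (enn f) x"
proof -
  have "op_Dcb \<Psi> f x = (\<integral>\<^sup>+y. ennreal (f x) * (ennreal (\<Psi> x y) * ennreal (f y)) \<partial>lborel)"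
    unfolding op_Dcb_def nn_integral_completion
    by (intro nn_integral_cong) (auto simp: indicator_def \<Psi>_outside ennreal_mult f mult_ac)
  also have "\<dots> = lin \<Psi> (enn f) (enn f) x"
    unfolding lin_def by (rule nn_integral_cmult) measurable
  finally show ?thesis .
qed

lemma op_Bb_eq_breakage:
  assumes [measurable]: "f \<in> borel_measurable borel" and f: "\<And>y. 0 \<le> f y"
  shows "op_Bb \<Psi> (\<lambda>x y. 1 - E x y) P f x = breakage (enn f) (enn f) x"
proof -
  let ?F = "\<lambda>y z. ennreal (P x y z * (1 - E y z) * \<Psi> y z * f y * f z)"
  have "op_Bb \<Psi> (\<lambda>x y. 1 - E x y) P f x = 1 / 2 * (\<integral>\<^sup>+y. \<integral>\<^sup>+z. ?F (y - z) z \<partial>lborel \<partial>lborel)"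
  proof -
    have "(\<integral>\<^sup>+z. ?F (y - z) z * indicator {0<..<y} z \<partial>lborel) * indicator {x<..} y
        = (\<integral>\<^sup>+z. ?F (y - z) z \<partial>lborel)" for y
    proof (cases "x < y")
      case True
      then show ?thesis by (auto simp: \<Psi>_outside indicator_def intro!: nn_integral_cong)
    next
      case False
      then show ?thesis by (simp add: P_outside)
    qed
    then show ?thesis unfolding op_Bb_def nn_integral_completion by simp
  qed
  also have "(\<integral>\<^sup>+y. \<integral>\<^sup>+z. ?F (y - z) z \<partial>lborel \<partial>lborel) = (\<integral>\<^sup>+z. \<integral>\<^sup>+y. ?F (y - z) z \<partial>lborel \<partial>lborel)"
    by (rule lborel_pair.Fubini'[symmetric]) measurable
  also have "\<dots> = (\<integral>\<^sup>+z. \<integral>\<^sup>+y. ?F (z + y - z) z \<partial>lborel \<partial>lborel)"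
    by (intro nn_integral_cong nn_integral_shift_lborel[symmetric]) measurable
  also have "\<dots> = (\<integral>\<^sup>+z. \<integral>\<^sup>+y. ?F y z \<partial>lborel \<partial>lborel)" by simp
  also have "\<dots> = (\<integral>\<^sup>+y. \<integral>\<^sup>+z. ?F y z \<partial>lborel \<partial>lborel)"
    by (rule lborel_pair.Fubini') measurable
  also have "1 / 2 * \<dots> = (\<integral>\<^sup>+y. 1 / 2 * (\<integral>\<^sup>+z. ?F y z \<partial>lborel) \<partial>lborel)"
    by (rule nn_integral_cmult[symmetric]) measurable
  also have "\<dots> = (\<integral>\<^sup>+y. \<integral>\<^sup>+z. 1 / 2 * ?F y z \<partial>lborel \<partial>lborel)"
    by (intro nn_integral_cong nn_integral_cmult[symmetric]) measurable
  also have "\<dots> = breakage (enn f) (enn f) x"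
    unfolding breakage_def
    by (intro nn_integral_cong) (simp add: half_ennreal ennreal_mult f mult_ac)
  finally show ?thesis .
qed

end

lemma S_norm_eq_nn_integral:
  assumes [measurable]: "f \<in> borel_measurable borel"
  shows "S_norm \<sigma> f = enn2real (\<integral>\<^sup>+x. ennreal (half_line_weight \<sigma> x) * ennreal \<bar>f x\<bar> \<partial>lborel)"
proof -
  have "S_norm \<sigma> f = (LINT x|lebesgue. half_line_weight \<sigma> x * \<bar>f x\<bar>)"
    unfolding S_norm_def set_lebesgue_integral_def
    by (intro Bochner_Integration.integral_cong) (auto simp: half_line_weight_def indicator_def)
  also have "\<dots> = enn2real (\<integral>\<^sup>+x. ennreal (half_line_weight \<sigma> x * \<bar>f x\<bar>) \<partial>lebesgue)"
    by (rule integral_eq_nn_integral) (auto intro!: measurable_completion)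
  also have "\<dots> = enn2real (\<integral>\<^sup>+x. ennreal (half_line_weight \<sigma> x) * ennreal \<bar>f x\<bar> \<partial>lborel)"
    by (simp add: nn_integral_completion ennreal_mult)
  finally show ?thesis .
qed

lemma S_space_iff_nn_integral:
  assumes [measurable]: "f \<in> borel_measurable borel"
  shows "f \<in> S_space \<sigma> \<longleftrightarrow> (\<integral>\<^sup>+x. ennreal (half_line_weight \<sigma> x) * ennreal \<bar>f x\<bar> \<partial>lborel) < \<infinity>"
proof -
  have "f \<in> S_space \<sigma> \<longleftrightarrow> integrable lebesgue (\<lambda>x. half_line_weight \<sigma> x * f x)"
    unfolding S_space_def set_integrable_def mem_Collect_eq
    by (intro Bochner_Integration.integrable_cong) (auto simp: half_line_weight_def indicator_def)
  also have "\<dots> \<longleftrightarrow> (\<integral>\<^sup>+x. ennreal (norm (half_line_weight \<sigma> x * f x)) \<partial>lebesgue) < \<infinity>"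
    unfolding integrable_iff_bounded by (auto intro!: measurable_completion)
  also have "\<dots> \<longleftrightarrow> (\<integral>\<^sup>+x. ennreal (half_line_weight \<sigma> x) * ennreal \<bar>f x\<bar> \<partial>lborel) < \<infinity>"
    by (simp add: nn_integral_completion ennreal_mult abs_mult)
  finally show ?thesis .
qed

text \<open>
  The condition that a weak solution satisfies at almost every \<open>x\<close>, isolated because both existence and
  uniqueness argue at a fixed \<open>x\<close> and all times.
\<close>

definition integral_equation_at ::
    "(real \<Rightarrow> real \<Rightarrow> real) \<Rightarrow> (real \<Rightarrow> real \<Rightarrow> real) \<Rightarrow> (real \<Rightarrow> real \<Rightarrow> real) \<Rightarrow>
      (real \<Rightarrow> real \<Rightarrow> real \<Rightarrow> real) \<Rightarrow> (real \<Rightarrow> real) \<Rightarrow> (real \<Rightarrow> real \<Rightarrow> real) \<Rightarrow> real \<Rightarrow> real \<Rightarrow> bool" where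
  "integral_equation_at \<Psi> E E' P g_in h x t \<longleftrightarrow>
     (\<integral>\<^sup>+s\<in>{0..t}. (\<integral>\<^sup>+\<nu>\<in>{0<..}. ennreal (\<Psi> x \<nu> * h s \<nu>) \<partial>lebesgue) \<partial>lebesgue) < \<infinity> \<and>
     (\<integral>\<^sup>+s\<in>{0..t}. op_Bb \<Psi> E' P (h s) x \<partial>lebesgue) < \<infinity> \<and>
     (AE s in lebesgue. s \<in> {0..t} \<longrightarrow>
        op_Bc \<Psi> E (h s) x < \<infinity> \<and> op_Dcb \<Psi> (h s) x < \<infinity> \<and> op_Bb \<Psi> E' P (h s) x < \<infinity>) \<and>
     set_integrable lebesgue {0..t}
       (\<lambda>s. enn2real (op_Bc \<Psi> E (h s) x) - enn2real (op_Dcb \<Psi> (h s) x) + enn2real (op_Bb \<Psi> E' P (h s) x)) \<and>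
     h t x = g_in x + (LINT s:{0..t}|lebesgue.
       enn2real (op_Bc \<Psi> E (h s) x) - enn2real (op_Dcb \<Psi> (h s) x) + enn2real (op_Bb \<Psi> E' P (h s) x))"

lemma weak_solution_on_iff:
  "weak_solution_on \<sigma> \<Psi> E E' P g_in T h \<longleftrightarrow>
     (\<forall>t\<in>{0..T}. h t \<in> S_cone \<sigma>) \<and> S_continuous_on \<sigma> {0..T} h \<and>
     (AE x in lborel. 0 < x \<longrightarrow> (\<forall>t\<in>{0..T}. integral_equation_at \<Psi> E E' P g_in h x t))"
  unfolding weak_solution_on_def integral_equation_at_def AE_completion_iff ..


section \<open>Construction of the weak solution\<close>

context collision_model_datum begin

definition q_enn :: "real \<Rightarrow> real \<Rightarrow> ennreal" where "q_enn \<tau> x = bilin compensator (u \<tau>) (u \<tau>) x"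

lemma q_enn_measurable [measurable]: "joint_borel q_enn"
  unfolding q_enn_def by (rule bilin_measurable) measurable

lemma q_enn_mono: "0 \<le> a \<Longrightarrow> a \<le> b \<Longrightarrow> q_enn a x \<le> q_enn b x"
  unfolding q_enn_def by (intro bilin_mono u_mono)

text \<open>
  The points at which \<open>Q(u)\<close> stays finite during the whole lifespan. As \<open>Q(u)\<close> increases in time, the
  countably many times \<open>T n\<close>, which exhaust the lifespan, decide this.
\<close>

definition regular :: "real set" where
  "regular = {x. 0 < x \<and> (\<forall>n::nat. q_enn (T (real n)) x < \<infinity>)}"

lemma regular_measurable [measurable]: "regular \<in> sets borel"
  unfolding regular_def by measurable

lemma J_le_T: assumes "\<tau> \<in> J" obtains n :: nat where "\<tau> \<le> T (real n)"
proof -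
  obtain n where n: "\<theta> \<tau> \<le> real n" using real_arch_simple by blast
  have "0 \<le> \<theta> \<tau>" using \<theta>_increment[OF assms, of 0] \<theta>_0 J_nonneg[OF assms] by simp
  then have "T (\<theta> \<tau>) \<le> T (real n)" using T_mono_lipschitz(1) n by blast
  then show ?thesis using that T_\<theta>[OF assms] by simp
qed

lemma q_enn_finite: assumes "x \<in> regular" "\<tau> \<in> J" shows "q_enn \<tau> x < \<infinity>"
proof -
  obtain n :: nat where "\<tau> \<le> T (real n)" using J_le_T[OF assms(2)] .
  then have "q_enn \<tau> x \<le> q_enn (T (real n)) x" using J_nonneg[OF assms(2)] by (intro q_enn_mono)
  also have "\<dots> < \<infinity>" using assms(1) by (simp add: regular_def)
  finally show ?thesis .
qed

lemma AE_regular: "AE x in lborel. 0 < x \<longrightarrow> x \<in> regular"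
proof -
  have "AE x in lborel. 0 < x \<longrightarrow> q_enn (T (real n)) x < \<infinity>" for n :: nat
  proof -
    have "weight (q_enn (T (real n))) \<le> ennreal bound * (weight (u (T (real n))))\<^sup>2"
      unfolding q_enn_def by (rule Q_bound) measurable
    also have "\<dots> = ennreal (bound * (U (T (real n)))\<^sup>2)"
      by (simp add: weight_finite[OF T(1)] ennreal_power ennreal_mult bound_nonneg)
    finally have "weight (q_enn (T (real n))) \<noteq> \<infinity>" by (auto simp: top_unique)
    then have "AE x in lborel. w x * q_enn (T (real n)) x \<noteq> \<infinity>"
      by (intro nn_integral_PInf_AE) auto
    then show ?thesis
    proof eventually_elim
      case (elim x)
      show ?case
      proof
        assume "0 < x"
        then have "half_line_weight \<sigma> x > 0"
          using S_weight_ge_one[of x \<sigma>] by (simp add: half_line_weight_def)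
        then show "q_enn (T (real n)) x < \<infinity>" using elim by (auto simp: ennreal_mult_eq_top_iff less_top)
      qed
    qed
  qed
  then have "AE x in lborel. \<forall>n::nat. 0 < x \<longrightarrow> q_enn (T (real n)) x < \<infinity>"
    by (subst AE_all_countable) auto
  then show ?thesis by eventually_elim (auto simp: regular_def)
qed

lemma u_eq: "u \<tau> x = u0 x + (\<integral>\<^sup>+s\<in>{0..\<tau>}. q_enn s x \<partial>lborel)"
  unfolding u_def q_enn_def by (rule flow_equation[OF u0_measurable])

lemma u_split: "0 \<le> a \<Longrightarrow> a \<le> b \<Longrightarrow> u b x = u a x + (\<integral>\<^sup>+s\<in>{a..b}. q_enn s x \<partial>lborel)"
  unfolding u_def q_enn_def by (rule flow_split[OF u0_measurable])

lemma q_enn_integral_le: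
  assumes "0 \<le> a" "a \<le> c" "c \<le> b"
  shows "(\<integral>\<^sup>+s\<in>{a..c}. q_enn s x \<partial>lborel) \<le> q_enn b x * ennreal (c - a)"
proof -
  have "(\<integral>\<^sup>+s\<in>{a..c}. q_enn s x \<partial>lborel) \<le> (\<integral>\<^sup>+s\<in>{a..c}. q_enn b x \<partial>lborel)"
    using assms by (intro nn_integral_mono) (auto simp: indicator_def intro!: q_enn_mono)
  also have "\<dots> = q_enn b x * ennreal (c - a)"
    using assms by (simp add: nn_integral_cmult_indicator)
  finally show ?thesis .
qed

lemma u_finite: assumes "x \<in> regular" "\<tau> \<in> J" shows "u \<tau> x < \<infinity>"
proof -
  have "u \<tau> x \<le> u0 x + q_enn \<tau> x * ennreal (\<tau> - 0)"
    unfolding u_eq[of \<tau>] using J_nonneg[OF assms(2)] by (intro add_left_mono q_enn_integral_le) auto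
  also have "\<dots> < \<infinity>" using q_enn_finite[OF assms] by (auto simp: ennreal_mult_less_top)
  finally show ?thesis .
qed

text \<open>
  The finite representative of \<open>u\<close>. At every point it is continuous in time, so convergence arguments need
  not exclude a null set.
\<close>

definition v :: "real \<Rightarrow> real \<Rightarrow> real" where
  "v \<tau> x = (if x \<in> regular then enn2real (u \<tau> x) else 0)"

abbreviation v_enn :: "real \<Rightarrow> real \<Rightarrow> ennreal" where "v_enn \<tau> x \<equiv> ennreal (v \<tau> x)"

lemma v_measurable [measurable]: "joint_borel v"
  unfolding v_def by measurable

lemma v_nonneg [simp]: "0 \<le> v \<tau> x" by (simp add: v_def)

lemma v_eq_u: "x \<in> regular \<Longrightarrow> \<tau> \<in> J \<Longrightarrow> v_enn \<tau> x = u \<tau> x"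
  unfolding v_def using u_finite by (simp add: less_top)

lemma AE_v_eq_u: "\<tau> \<in> J \<Longrightarrow> AE x in lborel. 0 < x \<longrightarrow> v_enn \<tau> x = u \<tau> x"
  using AE_regular by eventually_elim (auto simp: v_eq_u)

lemma bilin_v: "x \<in> regular \<Longrightarrow> \<tau> \<in> J \<Longrightarrow> bilin compensator (v_enn \<tau>) (v_enn \<tau>) x = q_enn \<tau> x"
  unfolding q_enn_def by (intro bilin_cong AE_v_eq_u v_eq_u admissible_compensator) auto

lemma weight_v: "\<tau> \<in> J \<Longrightarrow> weight (v_enn \<tau>) = ennreal (U \<tau>)"
proof -
  assume \<tau>: "\<tau> \<in> J"
  have "weight (v_enn \<tau>) = weight (u \<tau>)"
  proof (rule nn_integral_cong_AE)
    show "AE x in lborel. w x * v_enn \<tau> x = w x * u \<tau> x"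
      using AE_v_eq_u[OF \<tau>] by eventually_elim (auto simp: half_line_weight_def)
  qed
  then show ?thesis by (simp add: weight_finite[OF \<tau>])
qed

definition q :: "real \<Rightarrow> real \<Rightarrow> real" where "q \<tau> x = enn2real (q_enn \<tau> x)"

lemma q_enn_eq_q: "x \<in> regular \<Longrightarrow> \<tau> \<in> J \<Longrightarrow> q_enn \<tau> x = ennreal (q \<tau> x)"
  using q_enn_finite by (simp add: q_def less_top)

lemma q_nonneg [simp]: "0 \<le> q \<tau> x" by (simp add: q_def)

lemma v_increment:
  assumes b: "b \<in> J" and ac: "0 \<le> a" "a \<le> c" "c \<le> b"
  shows "v a x \<le> v c x" "v c x \<le> v a x + q b x * (c - a)"
proof -
  have J: "a \<in> J" "c \<in> J" using J_downward[OF b] ac by auto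
  have "v a x \<le> v c x \<and> v c x \<le> v a x + q b x * (c - a)"
  proof (cases "x \<in> regular")
    case True
    have "v_enn c x \<le> v_enn a x + q_enn b x * ennreal (c - a)"
      unfolding v_eq_u[OF True J(1)] v_eq_u[OF True J(2)] u_split[OF ac(1,2)]
      by (intro add_left_mono q_enn_integral_le ac)
    also have "\<dots> = ennreal (v a x + q b x * (c - a))"
      using ac by (simp add: q_enn_eq_q[OF True b] ennreal_mult ennreal_plus)
    finally have 1: "v c x \<le> v a x + q b x * (c - a)"
      using ac by (subst (asm) ennreal_le_iff) (auto intro!: add_nonneg_nonneg mult_nonneg_nonneg)
    have "v_enn a x \<le> v_enn c x"
      unfolding v_eq_u[OF True J(1)] v_eq_u[OF True J(2)] by (rule u_mono[OF ac(1,2)])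
    then show ?thesis using 1 by simp
  next
    case False
    then show ?thesis using ac by (simp add: v_def)
  qed
  then show "v a x \<le> v c x" "v c x \<le> v a x + q b x * (c - a)" by auto
qed

lemma v_continuous:
  assumes b: "b \<in> J" shows "continuous_on {0..b} (\<lambda>\<tau>. v \<tau> x)"
proof (rule lipschitz_on_continuous_on, rule lipschitz_onI)
  fix a c assume "a \<in> {0..b}" "c \<in> {0..b}"
  then show "dist (v a x) (v c x) \<le> q b x * dist a c"
  proof (induction a c rule: linorder_wlog)
    case (le a c)
    then show ?case using v_increment[OF b, of a c x] by (auto simp: dist_real_def)
  qed (simp add: dist_commute)
qed simp

text \<open>
  The right-hand side at a regular point is continuous in time, by dominated convergence with the
  value at the final time as majorant. This turns the integral equation for \<open>v\<close> into a classical
  differential equation.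
\<close>

lemma q_continuous:
  assumes b: "b \<in> J" and x: "x \<in> regular"
  shows "continuous_on {0..b} (\<lambda>\<tau>. q \<tau> x)"
  unfolding continuous_on_sequentially
proof (intro allI ballI impI, elim conjE)
  fix s and a :: real assume a: "a \<in> {0..b}" and s: "\<forall>n. s n \<in> {0..b}" "s \<longlonglongrightarrow> a"
  have J: "s n \<in> J" "a \<in> J" for n using J_downward[OF b] s a by auto
  have "(\<lambda>n. bilin compensator (v_enn (s n)) (v_enn (s n)) x) \<longlonglongrightarrow> bilin compensator (v_enn a) (v_enn a) x"
  proof (rule bilin_tendsto)
    show "(\<lambda>n. v (s n) y) \<longlonglongrightarrow> v a y" for y
      using v_continuous[OF b, of y, unfolded continuous_on_sequentially] a s by (auto simp: o_def)
    show "v (s n) y \<le> v b y" for n y using v_increment(1)[OF b, of "s n" b] s by auto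
    show "bilin compensator (v_enn b) (v_enn b) x < \<infinity>" using bilin_v[OF x b] q_enn_finite[OF x b] by simp
  qed (use admissible_compensator in \<open>auto simp: admissible_def\<close>)
  then have "(\<lambda>n. q_enn (s n) x) \<longlonglongrightarrow> ennreal (q a x)" using bilin_v[OF x] J q_enn_eq_q[OF x J(2)] by simp
  then have "(\<lambda>n. enn2real (q_enn (s n) x)) \<longlonglongrightarrow> q a x" by (rule tendsto_enn2real) simp
  then show "((\<lambda>\<tau>. q \<tau> x) \<circ> s) \<longlonglongrightarrow> q a x" by (simp add: q_def o_def)
qed

lemma v_equation:
  assumes b: "b \<in> J" and x: "x \<in> regular" and \<tau>: "\<tau> \<in> {0..b}"
  shows "v \<tau> x = f0 x + integral {0..\<tau>} (\<lambda>s. q s x)"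
proof -
  have J: "s \<in> J" if "s \<in> {0..\<tau>}" for s using J_downward[OF b, of s] that \<tau> by auto
  have int: "((\<lambda>s. q s x) has_integral integral {0..\<tau>} (\<lambda>s. q s x)) {0..\<tau>}"
    using \<tau> by (intro integrable_integral integrable_continuous_interval continuous_on_subset[OF q_continuous[OF b x]]) auto
  have \<tau>J: "\<tau> \<in> J" using J[of \<tau>] \<tau> by auto
  have "v_enn \<tau> x = u0 x + (\<integral>\<^sup>+s\<in>{0..\<tau>}. q_enn s x \<partial>lborel)" by (simp only: v_eq_u[OF x \<tau>J] u_eq)
  also have "(\<integral>\<^sup>+s\<in>{0..\<tau>}. q_enn s x \<partial>lborel) = (\<integral>\<^sup>+s\<in>{0..\<tau>}. ennreal (q s x) \<partial>lborel)"
    by (intro nn_integral_cong) (auto simp: indicator_def q_enn_eq_q[OF x J])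
  also have "\<dots> = ennreal (integral {0..\<tau>} (\<lambda>s. q s x))"
    by (rule nn_integral_has_integral_lebesgue'[OF _ int]) simp
  also have "u0 x + \<dots> = ennreal (f0 x + integral {0..\<tau>} (\<lambda>s. q s x))"
    using has_integral_nonneg[OF int] by (simp add: ennreal_plus)
  finally show ?thesis
    using has_integral_nonneg[OF int] by (subst (asm) ennreal_inj) (auto intro!: add_nonneg_nonneg)
qed

definition sol :: "real \<Rightarrow> real \<Rightarrow> real" where "sol t x = \<phi> (T t) * v (T t) x"

abbreviation sol_enn :: "real \<Rightarrow> real \<Rightarrow> ennreal" where "sol_enn t x \<equiv> ennreal (sol t x)"

lemma sol_nonneg [simp]: "0 \<le> sol t x" unfolding sol_def by (intro mult_nonneg_nonneg less_imp_le[OF \<phi>_pos] v_nonneg)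

lemma sol_measurable [measurable]: "sol t \<in> borel_measurable borel"
  unfolding sol_def by measurable

text \<open>
  The derivative of \<open>sol\<close>, by the chain rule with \<open>\<phi>' = -k U \<phi>\<close> and \<open>T' = \<phi>\<close>.
\<close>

definition rate :: "real \<Rightarrow> real \<Rightarrow> real" where
  "rate t x = (\<phi> (T t))\<^sup>2 * (q (T t) x - k * U (T t) * v (T t) x)"

lemma compose_T_continuous:
  fixes f :: "real \<Rightarrow> real"
  assumes "\<And>b. b \<in> J \<Longrightarrow> continuous_on {0..b} f"
  shows "continuous_on {0..t} (\<lambda>s. f (T s))"
proof (cases "0 \<le> t")
  case True
  show ?thesis
    by (rule continuous_on_compose2[OF assms[OF T(1)[OF True]]])
       (use T_mono_lipschitz(1) T_nonneg in \<open>auto intro!: continuous_on_subset[OF T_continuous]\<close>)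
qed simp

lemma rate_continuous: "x \<in> regular \<Longrightarrow> continuous_on {0..t} (\<lambda>s. rate s x)"
  unfolding rate_def
  by (intro continuous_intros compose_T_continuous \<phi>_continuous U_continuous v_continuous
      compose_T_continuous[of "\<lambda>\<tau>. v \<tau> x"] compose_T_continuous[of "\<lambda>\<tau>. q \<tau> x"] q_continuous)

lemma sol_continuous: "continuous_on {0..t} (\<lambda>s. sol s x)"
  unfolding sol_def
  by (intro continuous_intros compose_T_continuous[of "\<lambda>\<tau>. v \<tau> x"] compose_T_continuous \<phi>_continuous v_continuous)

lemma sol_derivative:
  assumes x: "x \<in> regular" and t: "0 < t"
  shows "((\<lambda>s. sol s x) has_real_derivative rate t x) (at t)"
proof -
  let ?b = "T (t + 1)"
  have b: "?b \<in> J" using T t by simp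
  have in_b: "0 < T t" "T t < ?b" using T_strict[of 0 t] T_strict[of t "t + 1"] T_0 t by auto
  have dv: "((\<lambda>\<tau>. v \<tau> x) has_real_derivative q (T t) x) (at (T t))"
  proof (rule has_field_derivative_transform_within_open)
    show "((\<lambda>\<tau>. f0 x + integral {0..\<tau>} (\<lambda>s. q s x)) has_real_derivative q (T t) x) (at (T t))"
      by (rule DERIV_cong[OF DERIV_add[OF DERIV_const integral_has_derivative_interior[OF q_continuous[OF b x] in_b]]]) simp
    show "f0 x + integral {0..\<tau>} (\<lambda>s. q s x) = v \<tau> x" if "\<tau> \<in> {0<..<?b}" for \<tau>
      using v_equation[OF b x, of \<tau>] that by simp
  qed (use in_b in auto)
  have d\<phi>: "(\<phi> has_real_derivative - k * U (T t) * \<phi> (T t)) (at (T t))"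
    unfolding \<phi>_def[abs_def]
    by (rule derivative_eq_intros integral_has_derivative_interior[OF U_continuous[OF b] in_b] refl)+ simp
  have 1: "((\<lambda>s. v (T s) x) has_real_derivative q (T t) x * \<phi> (T t)) (at t)"
    by (rule DERIV_chain2[OF dv T_derivative[OF t]])
  have 2: "((\<lambda>s. \<phi> (T s)) has_real_derivative (- k * U (T t) * \<phi> (T t)) * \<phi> (T t)) (at t)"
    by (rule DERIV_chain2[OF d\<phi> T_derivative[OF t]])
  show ?thesis
    unfolding sol_def rate_def
    by (rule DERIV_cong[OF DERIV_mult[OF 2 1]]) (simp add: power2_eq_square algebra_simps)
qed

lemma sol_0: "x \<in> regular \<Longrightarrow> sol 0 x = f0 x"
  using v_equation[OF zero_in_J, of x 0] by (simp add: sol_def T_0 \<phi>_def)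

lemma sol_equation:
  assumes x: "x \<in> regular" and t: "0 \<le> t"
  shows "sol t x = f0 x + integral {0..t} (\<lambda>s. rate s x)"
proof -
  have "((\<lambda>s. rate s x) has_integral (sol t x - sol 0 x)) {0..t}"
    by (rule fundamental_theorem_of_calculus_interior[OF t sol_continuous])
       (use sol_derivative[OF x] in \<open>auto simp: has_real_derivative_iff_has_vector_derivative\<close>)
  then show ?thesis using sol_0[OF x] by (simp add: integral_unique)
qed

lemma weight_sol: "0 \<le> t \<Longrightarrow> weight (sol_enn t) = ennreal (\<phi> (T t) * U (T t))"
proof -
  assume t: "0 \<le> t"
  have "weight (sol_enn t) = (\<integral>\<^sup>+x. ennreal (\<phi> (T t)) * (w x * v_enn (T t) x) \<partial>lborel)"
    using \<phi>_pos[of "T t"] by (simp add: sol_def ennreal_mult mult_ac)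
  also have "\<dots> = ennreal (\<phi> (T t)) * weight (v_enn (T t))" by (rule nn_integral_cmult) measurable
  finally show ?thesis using \<phi>_pos[of "T t"] by (simp add: weight_v[OF T(1)[OF t]] ennreal_mult)
qed

text \<open>
  Here the compensation cancels. The operators are quadratic, which gives the factor \<open>\<phi>\<^sup>2\<close>, and the
  compensating term and the death term of \<open>v\<close> add up to \<open>k U v\<close>.
\<close>

lemma rate_eq_operators:
  assumes x: "x \<in> regular" and t: "0 \<le> t"
  shows "coag (sol_enn t) (sol_enn t) x < \<infinity>" "breakage (sol_enn t) (sol_enn t) x \<le> ennreal (q (T t) x)"
    "lin \<Psi> (sol_enn t) (sol_enn t) x < \<infinity>"
    "rate t x = enn2real (coag (sol_enn t) (sol_enn t) x) - enn2real (lin \<Psi> (sol_enn t) (sol_enn t) x)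
      + enn2real (breakage (sol_enn t) (sol_enn t) x)"
proof -
  let ?\<tau> = "T t" let ?c = "\<phi> ?\<tau>"
  let ?v = "v_enn ?\<tau>"
  have J: "?\<tau> \<in> J" by (rule T(1)[OF t])
  have x0: "0 < x" using x by (simp add: regular_def)
  have c0: "0 \<le> ?c" using \<phi>_pos[of ?\<tau>] by simp
  have eq: "ennreal (q ?\<tau> x) = coag ?v ?v x + breakage ?v ?v x + lin compensator ?v ?v x"
    using bilin_v[OF x J] q_enn_eq_q[OF x J] by (simp add: bilin_def)
  have "coag ?v ?v x + breakage ?v ?v x + lin compensator ?v ?v x < \<infinity>"
    unfolding eq[symmetric] by simp
  then have fin: "coag ?v ?v x < \<infinity>" "breakage ?v ?v x < \<infinity>" "lin compensator ?v ?v x < \<infinity>"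
    by auto
  have sum: "lin compensator ?v ?v x + lin \<Psi> ?v ?v x = ennreal (k * U ?\<tau> * v ?\<tau> x)"
  proof -
    have "(\<integral>\<^sup>+y. ennreal (compensator x y) * ?v y \<partial>lborel) + (\<integral>\<^sup>+y. ennreal (\<Psi> x y) * ?v y \<partial>lborel)
        = (\<integral>\<^sup>+y. ennreal (compensator x y) * ?v y + ennreal (\<Psi> x y) * ?v y \<partial>lborel)"
      by (rule nn_integral_add[symmetric]) measurable
    also have "\<dots> = (\<integral>\<^sup>+y. ennreal k * (w y * ?v y) \<partial>lborel)"
    proof (rule nn_integral_cong)
      fix y
      have "ennreal (compensator x y) + ennreal (\<Psi> x y) = ennreal (compensator x y + \<Psi> x y)"
        using admissible_compensator by (intro ennreal_plus[symmetric]) (auto simp: admissible_def)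
      also have "\<dots> = ennreal k * w y"
        using x0 k_nonneg by (auto simp: compensator_def \<Psi>_outside half_line_weight_def ennreal_mult')
      finally show "ennreal (compensator x y) * ?v y + ennreal (\<Psi> x y) * ?v y = ennreal k * (w y * ?v y)"
        by (simp add: distrib_right[symmetric] mult.assoc)
    qed
    also have "\<dots> = ennreal k * ennreal (U ?\<tau>)"
      by (subst nn_integral_cmult) (auto simp: weight_v[OF J])
    finally show ?thesis
      unfolding lin_def distrib_left[symmetric] using k_nonneg by (simp add: ennreal_mult mult_ac)
  qed
  have lin\<Psi>: "lin \<Psi> ?v ?v x < \<infinity>"
  proof -
    have "lin \<Psi> ?v ?v x \<le> ennreal (k * U ?\<tau> * v ?\<tau> x)" unfolding sum[symmetric] by simp
    also have "\<dots> < \<infinity>" by simp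
    finally show ?thesis .
  qed
  have scale: "coag (sol_enn t) (sol_enn t) x = ennreal (?c\<^sup>2) * coag ?v ?v x"
    "breakage (sol_enn t) (sol_enn t) x = ennreal (?c\<^sup>2) * breakage ?v ?v x"
    "lin \<Psi> (sol_enn t) (sol_enn t) x = ennreal (?c\<^sup>2) * lin \<Psi> ?v ?v x"
    unfolding sol_def by (intro coag_scale breakage_scale lin_scale c0; measurable)+
  show "coag (sol_enn t) (sol_enn t) x < \<infinity>" "lin \<Psi> (sol_enn t) (sol_enn t) x < \<infinity>"
    using fin lin\<Psi> by (auto simp: scale ennreal_mult_less_top)
  have "?c\<^sup>2 \<le> 1" using \<phi>_le_1[OF J] c0 by (simp add: power_le_one)
  then have "ennreal (?c\<^sup>2) * breakage ?v ?v x \<le> 1 * breakage ?v ?v x"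
    by (intro mult_right_mono) (auto simp: ennreal_le_1)
  also have "\<dots> \<le> ennreal (q ?\<tau> x)" unfolding eq by (simp add: add_increasing add_increasing2)
  finally show "breakage (sol_enn t) (sol_enn t) x \<le> ennreal (q ?\<tau> x)" by (simp add: scale)
  have "q ?\<tau> x = enn2real (coag ?v ?v x + breakage ?v ?v x + lin compensator ?v ?v x)"
    unfolding eq[symmetric] by simp
  also have "\<dots> = enn2real (coag ?v ?v x) + enn2real (breakage ?v ?v x) + enn2real (lin compensator ?v ?v x)"
    using fin by (simp add: enn2real_plus)
  finally have q: "q ?\<tau> x = enn2real (coag ?v ?v x) + enn2real (breakage ?v ?v x) + enn2real (lin compensator ?v ?v x)" .
  have "k * U ?\<tau> * v ?\<tau> x = enn2real (lin compensator ?v ?v x + lin \<Psi> ?v ?v x)"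
    unfolding sum using k_nonneg by simp
  also have "\<dots> = enn2real (lin compensator ?v ?v x) + enn2real (lin \<Psi> ?v ?v x)"
    using fin lin\<Psi> by (simp add: enn2real_plus)
  finally have s: "k * U ?\<tau> * v ?\<tau> x = enn2real (lin compensator ?v ?v x) + enn2real (lin \<Psi> ?v ?v x)" .
  show "rate t x = enn2real (coag (sol_enn t) (sol_enn t) x) - enn2real (lin \<Psi> (sol_enn t) (sol_enn t) x)
      + enn2real (breakage (sol_enn t) (sol_enn t) x)"
    unfolding rate_def q s scale by (simp add: enn2real_mult algebra_simps)
qed

lemma sol_in_S_cone: "0 \<le> t \<Longrightarrow> sol t \<in> S_cone \<sigma>"
  unfolding S_cone_def by (simp add: S_space_iff_nn_integral weight_sol)

text \<open>
  As \<open>v\<close> increases in time, the weighted norm of an increment of \<open>v\<close> is the increment of \<open>U\<close>, and \<open>U\<close> is continuous.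
\<close>

lemma sol_S_continuous: "S_continuous_on \<sigma> {0..b} sol"
  unfolding S_continuous_on_def
proof
  fix t assume t: "t \<in> {0..b}"
  have bound: "S_norm \<sigma> (\<lambda>x. sol s x - sol t x)
      \<le> \<bar>\<phi> (T s) - \<phi> (T t)\<bar> * U (T s) + \<phi> (T t) * \<bar>U (T s) - U (T t)\<bar>" if s: "s \<in> {0..b}" for s
  proof -
    have J: "T s \<in> J" "T t \<in> J" using T s t by auto
    have diff: "weight (\<lambda>x. ennreal \<bar>v a x - v c x\<bar>) = ennreal \<bar>U a - U c\<bar>" if J: "a \<in> J" "c \<in> J" for a c
      using that
    proof (induction a c rule: linorder_wlog)
      case (le a c)
      note v = v_increment(1)[OF le(3) J_nonneg[OF le(2)] le(1) order_refl]
      have "ennreal (U c) = weight (\<lambda>x. v_enn a x + ennreal \<bar>v a x - v c x\<bar>)"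
        unfolding weight_v[OF le(3), symmetric]
        using v by (intro nn_integral_cong) (simp add: ennreal_plus[symmetric] del: ennreal_plus)
      also have "\<dots> = ennreal (U a) + weight (\<lambda>x. ennreal \<bar>v a x - v c x\<bar>)"
        unfolding distrib_left by (subst nn_integral_add) (auto simp: weight_v[OF le(2)])
      finally have "ennreal (U c) - ennreal (U a) = weight (\<lambda>x. ennreal \<bar>v a x - v c x\<bar>)" by simp
      then show ?case
        using U_mono[OF le(3) J_nonneg[OF le(2)] le(1)] by (simp add: ennreal_minus abs_minus_commute)
    qed (simp add: abs_minus_commute)
    have "weight (\<lambda>x. ennreal \<bar>sol s x - sol t x\<bar>)
        \<le> weight (\<lambda>x. ennreal \<bar>\<phi> (T s) - \<phi> (T t)\<bar> * v_enn (T s) x + ennreal (\<phi> (T t)) * ennreal \<bar>v (T s) x - v (T t) x\<bar>)"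
    proof (intro nn_integral_mono mult_left_mono)
      fix x
      have "sol s x - sol t x = (\<phi> (T s) - \<phi> (T t)) * v (T s) x + \<phi> (T t) * (v (T s) x - v (T t) x)"
        by (simp add: sol_def algebra_simps)
      then have "\<bar>sol s x - sol t x\<bar> \<le> \<bar>\<phi> (T s) - \<phi> (T t)\<bar> * v (T s) x + \<phi> (T t) * \<bar>v (T s) x - v (T t) x\<bar>"
        using abs_triangle_ineq[of "(\<phi> (T s) - \<phi> (T t)) * v (T s) x" "\<phi> (T t) * (v (T s) x - v (T t) x)"]
        by (simp add: abs_mult less_imp_le[OF \<phi>_pos])
      then show "ennreal \<bar>sol s x - sol t x\<bar>
          \<le> ennreal \<bar>\<phi> (T s) - \<phi> (T t)\<bar> * v_enn (T s) x + ennreal (\<phi> (T t)) * ennreal \<bar>v (T s) x - v (T t) x\<bar>"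
        using \<phi>_pos[of "T t"]
        by (simp add: ennreal_mult[symmetric] ennreal_plus[symmetric] del: ennreal_plus)
    qed auto
    also have "\<dots> = (\<integral>\<^sup>+x. ennreal \<bar>\<phi> (T s) - \<phi> (T t)\<bar> * (w x * v_enn (T s) x)
        + ennreal (\<phi> (T t)) * (w x * ennreal \<bar>v (T s) x - v (T t) x\<bar>) \<partial>lborel)"
      by (simp add: distrib_left mult_ac)
    also have "\<dots> = ennreal \<bar>\<phi> (T s) - \<phi> (T t)\<bar> * ennreal (U (T s)) + ennreal (\<phi> (T t)) * ennreal \<bar>U (T s) - U (T t)\<bar>"
      by (simp add: nn_integral_add nn_integral_cmult weight_v[OF J(1)] diff[OF J])
    also have "\<dots> = ennreal (\<bar>\<phi> (T s) - \<phi> (T t)\<bar> * U (T s) + \<phi> (T t) * \<bar>U (T s) - U (T t)\<bar>)"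
      using \<phi>_pos[of "T t"] by (simp add: ennreal_mult ennreal_plus)
    finally show ?thesis
      using \<phi>_pos[of "T t"] by (subst S_norm_eq_nn_integral) (auto intro!: enn2real_leI add_nonneg_nonneg mult_nonneg_nonneg)
  qed
  have cont: "continuous_on {0..b} (\<lambda>s. \<bar>\<phi> (T s) - \<phi> (T t)\<bar> * U (T s) + \<phi> (T t) * \<bar>U (T s) - U (T t)\<bar>)"
    by (intro continuous_intros compose_T_continuous \<phi>_continuous U_continuous)
  then have lim: "((\<lambda>s. \<bar>\<phi> (T s) - \<phi> (T t)\<bar> * U (T s) + \<phi> (T t) * \<bar>U (T s) - U (T t)\<bar>) \<longlongrightarrow> 0) (at t within {0..b})"
    using t unfolding continuous_on_def by force
  show "((\<lambda>s. S_norm \<sigma> (\<lambda>x. sol s x - sol t x)) \<longlongrightarrow> 0) (at t within {0..b})"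
  proof (rule tendsto_sandwich[OF _ _ tendsto_const lim])
    show "\<forall>\<^sub>F s in at t within {0..b}. 0 \<le> S_norm \<sigma> (\<lambda>x. sol s x - sol t x)"
      by (simp add: S_norm_eq_nn_integral)
    show "\<forall>\<^sub>F s in at t within {0..b}. S_norm \<sigma> (\<lambda>x. sol s x - sol t x)
        \<le> \<bar>\<phi> (T s) - \<phi> (T t)\<bar> * U (T s) + \<phi> (T t) * \<bar>U (T s) - U (T t)\<bar>"
      using bound by (auto simp: eventually_at_filter intro!: always_eventually)
  qed
qed

theorem sol_global_weak_solution:
  "global_weak_solution \<sigma> \<Psi> E (\<lambda>x y. 1 - E x y) P f0 sol"
  unfolding global_weak_solution_def weak_solution_on_iff
proof (intro allI impI conjI)
  fix b :: real assume b: "0 < b"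
  show "\<forall>t\<in>{0..b}. sol t \<in> S_cone \<sigma>" using sol_in_S_cone by auto
  show "S_continuous_on \<sigma> {0..b} sol" by (rule sol_S_continuous)
  note ops = op_Bc_eq_coag[OF sol_measurable sol_nonneg] op_Dcb_eq_lin[OF sol_measurable sol_nonneg]
    op_Bb_eq_breakage[OF sol_measurable sol_nonneg]
  let ?D = "\<lambda>s x. enn2real (op_Bc \<Psi> E (sol s) x) - enn2real (op_Dcb \<Psi> (sol s) x)
                + enn2real (op_Bb \<Psi> (\<lambda>x y. 1 - E x y) P (sol s) x)"
  have D: "?D s x = rate s x" if "x \<in> regular" "0 \<le> s" for s x
    using rate_eq_operators(4)[OF that] by (simp add: ops)
  have main: "integral_equation_at \<Psi> E (\<lambda>x y. 1 - E x y) P f0 sol x t"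
    if x: "x \<in> regular" and t: "t \<in> {0..b}" for x t
    unfolding integral_equation_at_def
  proof (intro conjI)
    have x0: "0 < x" using x by (simp add: regular_def)
    have t0: "0 \<le> t" using t by simp
    have le: "q (T s) x \<le> q (T t) x" "U (T s) \<le> U (T t)" if s: "s \<in> {0..t}" for s
    proof -
      have T: "0 \<le> T s" "T s \<le> T t" "T s \<in> J" "T t \<in> J" using T_mono_lipschitz(1)[of s t] T_nonneg T s by auto
      show "U (T s) \<le> U (T t)" by (rule U_mono[OF T(4,1,2)])
      have "ennreal (q (T s) x) \<le> ennreal (q (T t) x)"
        using q_enn_mono[OF T(1,2), of x] by (simp add: q_enn_eq_q[OF x] T)
      then show "q (T s) x \<le> q (T t) x" by simp
    qed
    have "(\<integral>\<^sup>+s\<in>{0..t}. (\<integral>\<^sup>+\<nu>\<in>{0<..}. ennreal (\<Psi> x \<nu> * sol s \<nu>) \<partial>lebesgue) \<partial>lebesgue)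
        \<le> (\<integral>\<^sup>+s\<in>{0..t}. ennreal (k * U (T t)) \<partial>lborel)"
      unfolding nn_integral_completion
    proof (rule nn_integral_mono)
      fix s
      have "(\<integral>\<^sup>+\<nu>\<in>{0<..}. ennreal (\<Psi> x \<nu> * sol s \<nu>) \<partial>lborel) \<le> ennreal (k * U (T t))" if s: "s \<in> {0..t}"
      proof -
        have "(\<integral>\<^sup>+\<nu>\<in>{0<..}. ennreal (\<Psi> x \<nu> * sol s \<nu>) \<partial>lborel) \<le> (\<integral>\<^sup>+\<nu>. ennreal k * (w \<nu> * sol_enn s \<nu>) \<partial>lborel)"
        proof (rule nn_integral_mono)
          fix \<nu>
          have "ennreal (\<Psi> x \<nu> * sol s \<nu>) \<le> ennreal (k * half_line_weight \<sigma> \<nu> * sol s \<nu>)"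
            by (intro ennreal_leI mult_right_mono \<Psi>_le_weight) simp
          also have "\<dots> = ennreal k * (w \<nu> * sol_enn s \<nu>)" using k_nonneg by (simp add: ennreal_mult mult.assoc)
          finally show "ennreal (\<Psi> x \<nu> * sol s \<nu>) * indicator {0<..} \<nu> \<le> ennreal k * (w \<nu> * sol_enn s \<nu>)"
            by (auto simp: indicator_def)
        qed
        also have "\<dots> = ennreal k * weight (sol_enn s)" by (rule nn_integral_cmult) measurable
        also have "\<dots> = ennreal (k * (\<phi> (T s) * U (T s)))"
          using s k_nonneg \<phi>_pos[of "T s"] by (simp add: weight_sol ennreal_mult)
        also have "\<dots> \<le> ennreal (k * (1 * U (T t)))"
          using s k_nonneg \<phi>_le_1[OF T(1)] \<phi>_pos[of "T s"] le[OF s]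
          by (intro ennreal_leI mult_left_mono mult_mono) (auto simp: less_imp_le)
        finally show ?thesis by simp
      qed
      then show "(\<integral>\<^sup>+\<nu>\<in>{0<..}. ennreal (\<Psi> x \<nu> * sol s \<nu>) \<partial>lborel) * indicator {0..t} s
          \<le> ennreal (k * U (T t)) * indicator {0..t} s" by (auto simp: indicator_def)
    qed
    also have "\<dots> < \<infinity>" using t0 by (simp add: nn_integral_cmult_indicator ennreal_mult_less_top)
    finally show "(\<integral>\<^sup>+s\<in>{0..t}. (\<integral>\<^sup>+\<nu>\<in>{0<..}. ennreal (\<Psi> x \<nu> * sol s \<nu>) \<partial>lebesgue) \<partial>lebesgue) < \<infinity>" .
    have "(\<integral>\<^sup>+s\<in>{0..t}. op_Bb \<Psi> (\<lambda>x y. 1 - E x y) P (sol s) x \<partial>lebesgue)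
        \<le> (\<integral>\<^sup>+s\<in>{0..t}. ennreal (q (T t) x) \<partial>lborel)"
      unfolding nn_integral_completion
    proof (rule nn_integral_mono)
      fix s
      have "op_Bb \<Psi> (\<lambda>x y. 1 - E x y) P (sol s) x \<le> ennreal (q (T t) x)" if s: "s \<in> {0..t}"
      proof -
        have "op_Bb \<Psi> (\<lambda>x y. 1 - E x y) P (sol s) x \<le> ennreal (q (T s) x)"
          unfolding ops using s by (intro rate_eq_operators(2)[OF x]) auto
        also have "\<dots> \<le> ennreal (q (T t) x)" by (intro ennreal_leI le[OF s])
        finally show ?thesis .
      qed
      then show "op_Bb \<Psi> (\<lambda>x y. 1 - E x y) P (sol s) x * indicator {0..t} s
          \<le> ennreal (q (T t) x) * indicator {0..t} s" by (auto simp: indicator_def)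
    qed
    also have "\<dots> < \<infinity>" using t0 by (simp add: nn_integral_cmult_indicator ennreal_mult_less_top)
    finally show "(\<integral>\<^sup>+s\<in>{0..t}. op_Bb \<Psi> (\<lambda>x y. 1 - E x y) P (sol s) x \<partial>lebesgue) < \<infinity>" .
    show "AE s in lebesgue. s \<in> {0..t} \<longrightarrow>
       op_Bc \<Psi> E (sol s) x < \<infinity> \<and> op_Dcb \<Psi> (sol s) x < \<infinity> \<and> op_Bb \<Psi> (\<lambda>x y. 1 - E x y) P (sol s) x < \<infinity>"
    proof (intro AE_I2 impI)
      fix s assume "s \<in> {0..t}"
      then have s: "0 \<le> s" by simp
      show "op_Bc \<Psi> E (sol s) x < \<infinity> \<and> op_Dcb \<Psi> (sol s) x < \<infinity> \<and> op_Bb \<Psi> (\<lambda>x y. 1 - E x y) P (sol s) x < \<infinity>"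
        unfolding ops using rate_eq_operators(1-3)[OF x s] by (auto intro: le_less_trans)
    qed
    have int: "set_integrable lebesgue {0..t} (\<lambda>s. rate s x)"
      by (rule absolutely_integrable_continuous_real[OF rate_continuous[OF x]])
    show "set_integrable lebesgue {0..t} (\<lambda>s. ?D s x)"
      using int by (subst set_integrable_cong[OF refl refl D[OF x]]) auto
    have "(LINT s:{0..t}|lebesgue. ?D s x) = (LINT s:{0..t}|lebesgue. rate s x)"
      by (intro set_lebesgue_integral_cong) (auto simp: D[OF x])
    also have "\<dots> = integral {0..t} (\<lambda>s. rate s x)" by (rule set_lebesgue_integral_eq_integral(2)[OF int])
    finally show "sol t x = f0 x + (LINT s:{0..t}|lebesgue. ?D s x)" using sol_equation[OF x t0] by simp
  qed
  show "AE x in lborel. 0 < x \<longrightarrow> (\<forall>t\<in>{0..b}. integral_equation_at \<Psi> E (\<lambda>x y. 1 - E x y) P f0 sol x t)"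
    using AE_regular by eventually_elim (use main in blast)
qed

end


section \<open>Jointly measurable versions of weak solutions\<close>

text \<open>
  In the supremum norm with weight \<open>exp (- 2 K s)\<close> the integral operator on the right is a contraction with
  constant \<open>1/2\<close>, so the norm of \<open>\<Delta>\<close>, which is finite, is at most half of itself.
\<close>

lemma gronwall_nn_integral:
  fixes \<Delta> :: "real \<Rightarrow> ennreal"
  assumes K: "0 < K" and M: "0 \<le> M" "\<And>t. t \<in> {0..b} \<Longrightarrow> \<Delta> t \<le> ennreal M"
    and le: "\<And>t. t \<in> {0..b} \<Longrightarrow> \<Delta> t \<le> (\<integral>\<^sup>+s\<in>{0..t}. ennreal K * \<Delta> s \<partial>lborel)"
    and t: "t \<in> {0..b}"
  shows "\<Delta> t = 0"
proof -
  define D where "D s = enn2real (\<Delta> s) * exp (- 2 * K * s)" for s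
  define S where "S = (SUP s\<in>{0..b}. D s)"
  have fin: "\<Delta> s = ennreal (enn2real (\<Delta> s))" if "s \<in> {0..b}" for s
    using M(2)[OF that] by (intro ennreal_enn2real[symmetric]) (auto simp: less_top[symmetric] top_unique)
  have D0: "0 \<le> D s" for s by (simp add: D_def)
  have DM: "D s \<le> M" if s: "s \<in> {0..b}" for s
  proof -
    have "enn2real (\<Delta> s) \<le> M" using M(2)[OF s] M(1) by (rule enn2real_leI[rotated])
    then have "D s \<le> M * 1" unfolding D_def using M s K by (intro mult_mono) auto
    then show ?thesis by simp
  qed
  then have bdd: "bdd_above (D ` {0..b})" by (intro bdd_aboveI2[of _ _ M])
  have DS: "D s \<le> S" if "s \<in> {0..b}" for s
    unfolding S_def by (rule cSUP_upper[OF that bdd])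
  have S0: "0 \<le> S" using DS[OF t] D0[of t] by linarith
  have half: "D s \<le> S / 2" if s: "s \<in> {0..b}" for s
  proof -
    have int: "((\<lambda>r. K * (S * exp (2 * K * r))) has_integral (S / 2 * exp (2 * K * s) - S / 2 * exp (2 * K * 0))) {0..s}"
      by (rule fundamental_theorem_of_calculus)
         (use s in \<open>auto intro!: derivative_eq_intros simp: has_real_derivative_iff_has_vector_derivative[symmetric]\<close>)
    have "\<Delta> s \<le> (\<integral>\<^sup>+r\<in>{0..s}. ennreal K * \<Delta> r \<partial>lborel)" by (rule le[OF s])
    also have "\<dots> \<le> (\<integral>\<^sup>+r\<in>{0..s}. ennreal (K * (S * exp (2 * K * r))) \<partial>lborel)"
    proof (rule nn_integral_mono)
      fix r
      have "ennreal K * \<Delta> r \<le> ennreal (K * (S * exp (2 * K * r)))" if r: "r \<in> {0..s}"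
      proof -
        have rb: "r \<in> {0..b}" using r s by auto
        have "enn2real (\<Delta> r) \<le> S * exp (2 * K * r)"
          using DS[OF rb] by (simp add: D_def exp_minus field_simps)
        then have "\<Delta> r \<le> ennreal (S * exp (2 * K * r))" by (subst fin[OF rb]) (rule ennreal_leI)
        then show ?thesis using K S0 by (simp add: ennreal_mult mult_left_mono)
      qed
      then show "ennreal K * \<Delta> r * indicator {0..s} r \<le> ennreal (K * (S * exp (2 * K * r))) * indicator {0..s} r"
        by (auto simp: indicator_def)
    qed
    also have "\<dots> = ennreal (S / 2 * exp (2 * K * s) - S / 2 * exp (2 * K * 0))"
      by (rule nn_integral_has_integral_lebesgue'[OF _ int]) (use K S0 in auto)
    also have "\<dots> \<le> ennreal (S / 2 * exp (2 * K * s))" using S0 by (intro ennreal_leI) auto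
    finally have "enn2real (\<Delta> s) \<le> S / 2 * exp (2 * K * s)" using S0 by (intro enn2real_leI) auto
    then show ?thesis by (simp add: D_def exp_minus field_simps)
  qed
  have "(SUP s\<in>{0..b}. D s) \<le> S / 2" by (rule cSUP_least) (use t half in auto)
  then have "S \<le> S / 2" unfolding S_def[symmetric] .
  then have "S = 0" using S0 by linarith
  then have "D t = 0" using DS[OF t] D0[of t] by linarith
  then have "enn2real (\<Delta> t) = 0" by (simp add: D_def)
  then show ?thesis using fin[OF t] by simp
qed

lemma AE_Borel_witness:
  fixes R :: "real \<Rightarrow> bool"
  assumes "AE x in lborel. 0 < x \<longrightarrow> R x"
  obtains G where "G \<in> sets borel" "\<And>x. x \<in> G \<Longrightarrow> 0 < x \<and> R x" "AE x in lborel. 0 < x \<longrightarrow> x \<in> G"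
proof -
  obtain N where N: "N \<in> null_sets lborel" "{x. \<not> (0 < x \<longrightarrow> R x)} \<subseteq> N"
    using assms by (auto simp: eventually_ae_filter)
  have "AE x in lborel. x \<notin> N" by (rule AE_not_in[OF N(1)])
  then have "AE x in lborel. 0 < x \<longrightarrow> x \<in> {0<..} - N" by eventually_elim auto
  moreover have "{0<..} - N \<in> sets borel" using N(1) by (auto simp: null_sets_def)
  ultimately show ?thesis using N(2) by (intro that[of "{0<..} - N"]) auto
qed

lemma S_weight_pos: "0 < x \<Longrightarrow> 0 < S_weight \<sigma> x"
  using S_weight_ge_one[of x \<sigma>] by simp

lemma S_space_Borel_version:
  assumes "f \<in> S_space \<sigma>"
  obtains f' where "f' \<in> borel_measurable borel" "AE x in lborel. 0 < x \<longrightarrow> f' x = f x"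
proof -
  have "(\<lambda>x. indicator {0<..} x *\<^sub>R (S_weight \<sigma> x * f x)) \<in> borel_measurable lebesgue"
    using assms by (auto simp: S_space_def set_integrable_def)
  then obtain F where F: "F \<in> borel_measurable lborel"
    "AE x in lborel. indicator {0<..} x *\<^sub>R (S_weight \<sigma> x * f x) = F x"
    by (blast dest: completion_ex_borel_measurable_real)
  have [measurable]: "F \<in> borel_measurable borel" using F(1) by simp
  show ?thesis
  proof
    show "(\<lambda>x. F x / S_weight \<sigma> x) \<in> borel_measurable borel" unfolding S_weight_def by measurable
    show "AE x in lborel. 0 < x \<longrightarrow> F x / S_weight \<sigma> x = f x"
      using F(2)
    proof eventually_elim
      case (elim x)
      show ?case
      proof
        assume "0 < x"
        then show "F x / S_weight \<sigma> x = f x" using elim S_weight_pos[of x \<sigma>] by (auto simp: field_simps)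
      qed
    qed
  qed
qed

lemma global_weak_solution_equation:
  assumes "global_weak_solution \<sigma> \<Psi> E E' P g_in h"
  shows "AE x in lborel. 0 < x \<longrightarrow> (\<forall>t\<ge>0. integral_equation_at \<Psi> E E' P g_in h x t)"
proof -
  have "AE x in lborel. \<forall>n::nat. 0 < x \<longrightarrow> (\<forall>t\<in>{0..real n + 1}. integral_equation_at \<Psi> E E' P g_in h x t)"
    unfolding AE_all_countable
  proof
    fix n :: nat
    have "weak_solution_on \<sigma> \<Psi> E E' P g_in (real n + 1) h"
      using assms by (auto simp: global_weak_solution_def)
    then show "AE x in lborel. 0 < x \<longrightarrow> (\<forall>t\<in>{0..real n + 1}. integral_equation_at \<Psi> E E' P g_in h x t)"
      unfolding weak_solution_on_iff by blast
  qed
  then show ?thesis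
  proof eventually_elim
    case (elim x)
    show ?case
    proof (intro impI allI)
      fix t :: real assume "0 < x" "0 \<le> t"
      moreover obtain n :: nat where "t \<le> real n" using real_arch_simple by blast
      ultimately show "integral_equation_at \<Psi> E E' P g_in h x t" using elim by (auto dest!: spec[of _ n])
    qed
  qed
qed

lemma integral_equation_continuous:
  assumes "\<And>t. 0 \<le> t \<Longrightarrow> integral_equation_at \<Psi> E E' P g_in h x t"
  shows "continuous_on {0..} (\<lambda>t. h t x)"
proof -
  let ?D = "\<lambda>s. enn2real (op_Bc \<Psi> E (h s) x) - enn2real (op_Dcb \<Psi> (h s) x) + enn2real (op_Bb \<Psi> E' P (h s) x)"
  have cont: "continuous_on {0..b} (\<lambda>t. h t x)" if b: "0 \<le> b" for b
  proof -
    have "set_integrable lebesgue {0..b} ?D" using assms[OF b] by (simp add: integral_equation_at_def)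
    then have "?D integrable_on {0..b}" by (rule set_lebesgue_integral_eq_integral(1))
    then have "continuous_on {0..b} (\<lambda>t. g_in x + integral {0..t} ?D)"
      by (rule continuous_on_add[OF continuous_on_const indefinite_integral_continuous_1])
    moreover have "h t x = g_in x + integral {0..t} ?D" if "t \<in> {0..b}" for t
    proof -
      have t: "integral_equation_at \<Psi> E E' P g_in h x t" using assms that by auto
      then have "set_integrable lebesgue {0..t} ?D" by (simp add: integral_equation_at_def)
      then have "(LINT s:{0..t}|lebesgue. ?D s) = integral {0..t} ?D" by (rule set_lebesgue_integral_eq_integral(2))
      then show ?thesis using t unfolding integral_equation_at_def by auto
    qed
    ultimately show ?thesis by (subst continuous_on_cong[OF refl]) auto
  qed
  show ?thesis
    unfolding continuous_on_eq_continuous_within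
  proof
    fix t :: real assume t: "t \<in> {0..}"
    have "continuous (at t within {0..t + 1}) (\<lambda>t. h t x)"
      using cont[of "t + 1"] t by (auto simp: continuous_on_eq_continuous_within)
    moreover have "at t within {0..} = at t within {0..t + 1}"
      by (rule at_within_nhd[of t "{..<t + 1}"]) auto
    ultimately show "continuous (at t within {0..}) (\<lambda>t. h t x)" by simp
  qed
qed

text \<open>
  At almost every \<open>x\<close> the integral equation makes \<open>h t x\<close> continuous in \<open>t\<close>. So it is the limit of its values
  at rational times just below \<open>t\<close>, and these involve only countably many Borel functions of \<open>x\<close>.
\<close>

lemma weak_solution_joint_version:
  assumes sol: "global_weak_solution \<sigma> \<Psi> E E' P g_in h"
  obtains G H where "G \<in> sets borel" "AE x in lborel. 0 < x \<longrightarrow> x \<in> G" "G \<subseteq> {0<..}"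
    "joint_borel H"
    "\<And>t x. 0 \<le> t \<Longrightarrow> x \<in> G \<Longrightarrow> H t x = h t x" "\<And>t x. (0::real) \<le> H t x"
    "\<And>t x. x \<in> G \<Longrightarrow> 0 \<le> t \<Longrightarrow> integral_equation_at \<Psi> E E' P g_in h x t"
proof -
  have cone: "h t \<in> S_cone \<sigma>" if "0 \<le> t" for t
    using sol[unfolded global_weak_solution_def weak_solution_on_def, rule_format, of "t + 1"] that by auto
  have "\<exists>f. f \<in> borel_measurable borel \<and> (0 \<le> t \<longrightarrow> (AE x in lborel. 0 < x \<longrightarrow> f x = h t x))" for t
  proof (cases "0 \<le> t")
    case True
    then have "h t \<in> S_space \<sigma>" using cone by (simp add: S_cone_def)
    then show ?thesis by (rule S_space_Borel_version) auto
  qed (auto intro!: exI[of _ "\<lambda>_. 0"])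
  then obtain hb where hb: "\<And>t. hb t \<in> borel_measurable borel"
    "\<And>t. 0 \<le> t \<Longrightarrow> AE x in lborel. 0 < x \<longrightarrow> hb t x = h t x" by metis
  let ?I = "\<rat> \<inter> {0..} :: real set"
  have "AE x in lborel. \<forall>t\<in>?I. 0 < x \<longrightarrow> hb t x = h t x \<and> 0 \<le> h t x"
  proof (subst AE_ball_countable)
    show "\<forall>t\<in>?I. AE x in lborel. 0 < x \<longrightarrow> hb t x = h t x \<and> 0 \<le> h t x"
    proof
      fix t assume "t \<in> ?I"
      then have t: "0 \<le> t" by simp
      have "AE x in lborel. 0 < x \<longrightarrow> 0 \<le> h t x"
        using cone[OF t] by (simp add: S_cone_def AE_completion_iff)
      with hb(2)[OF t] show "AE x in lborel. 0 < x \<longrightarrow> hb t x = h t x \<and> 0 \<le> h t x"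
        by eventually_elim auto
    qed
  qed (auto intro: countable_Int1 countable_rat)
  with global_weak_solution_equation[OF sol]
  have "AE x in lborel. 0 < x \<longrightarrow> (\<forall>t\<ge>0. integral_equation_at \<Psi> E E' P g_in h x t) \<and> (\<forall>t\<in>?I. hb t x = h t x \<and> 0 \<le> h t x)"
    by eventually_elim auto
  then obtain G where G: "G \<in> sets borel" "\<And>x. x \<in> G \<Longrightarrow> 0 < x \<and>
      ((\<forall>t\<ge>0. integral_equation_at \<Psi> E E' P g_in h x t) \<and> (\<forall>t\<in>?I. hb t x = h t x \<and> 0 \<le> h t x))"
    "AE x in lborel. 0 < x \<longrightarrow> x \<in> G"
    by (rule AE_Borel_witness) (rule that)
  note [measurable] = G(1) hb(1)
  define H where "H t x = (if x \<in> G \<and> 0 \<le> t then h t x else 0)" for t x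
  (* A rational time at most t, at distance less than 1 / (n + 1), nonnegative if t is. *)
  define r where "r n t = of_int \<lfloor>real (Suc n) * t\<rfloor> / real (Suc n)" for n :: nat and t :: real
  have rQ: "r n t \<in> ?I" if "0 \<le> t" for n t using that by (auto simp: r_def)
  have rlim: "(\<lambda>n. r n t) \<longlonglongrightarrow> t" for t
  proof -
    have le: "\<bar>r n t - t\<bar> \<le> inverse (real (Suc n))" for n
    proof -
      have "\<bar>of_int \<lfloor>real (Suc n) * t\<rfloor> - real (Suc n) * t\<bar> \<le> 1" by linarith
      moreover have "(r n t - t) * real (Suc n) = of_int \<lfloor>real (Suc n) * t\<rfloor> - real (Suc n) * t"
        by (simp add: r_def left_diff_distrib del: of_nat_Suc)
      ultimately have "\<bar>r n t - t\<bar> * real (Suc n) \<le> 1" by (metis abs_mult abs_of_nat)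
      then show ?thesis by (simp add: field_simps del: of_nat_Suc)
    qed
    have "(\<lambda>n. r n t - t) \<longlonglongrightarrow> 0"
      by (rule Lim_null_comparison[OF _ LIMSEQ_inverse_real_of_nat]) (use le in auto)
    then show ?thesis by (simp add: LIM_zero_iff)
  qed
  have lim: "(\<lambda>n. h (r n t) x) \<longlonglongrightarrow> h t x" if "x \<in> G" "0 \<le> t" for x t
  proof -
    have "continuous_on {0..} (\<lambda>t. h t x)"
      by (rule integral_equation_continuous) (use G(2)[OF that(1)] in auto)
    then have "\<forall>s. \<forall>a\<in>{0..}. (\<forall>n. s n \<in> {0..}) \<and> s \<longlonglongrightarrow> a \<longrightarrow> ((\<lambda>t. h t x) \<circ> s) \<longlonglongrightarrow> h a x"
      unfolding continuous_on_sequentially .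
    from this[THEN spec, of "\<lambda>n. r n t", THEN bspec, of t]
    have "((\<lambda>t. h t x) \<circ> (\<lambda>n. r n t)) \<longlonglongrightarrow> h t x" using rQ[OF that(2)] rlim[of t] that(2) by simp
    then show ?thesis by (simp add: o_def)
  qed
  have "joint_borel H"
  proof (rule borel_measurable_LIMSEQ_real)
    let ?u = "\<lambda>n (t, x). if x \<in> G \<and> 0 \<le> t then hb (r n t) x else 0"
    show "(\<lambda>n. ?u n z) \<longlonglongrightarrow> (case z of (t, x) \<Rightarrow> H t x)" for z
    proof (cases z)
      case (Pair t x)
      show ?thesis
      proof (cases "x \<in> G \<and> 0 \<le> t")
        case True
        then have "hb (r n t) x = h (r n t) x" for n using G(2)[of x] rQ[of t n] by simp
        then show ?thesis using lim[of x t] True by (simp add: Pair H_def)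
      next
        case False
        then show ?thesis unfolding Pair H_def prod.case if_not_P[OF False] by simp
      qed
    qed
    show "?u n \<in> borel_measurable (borel \<Otimes>\<^sub>M borel)" for n
    proof -
      have "(\<lambda>z. (\<lambda>(i::int) z. hb (of_int i / real (Suc n)) (snd z)) \<lfloor>real (Suc n) * fst z\<rfloor> z) \<in> borel_measurable (borel \<Otimes>\<^sub>M borel)"
        by (rule measurable_compose_countable) measurable
      then have [measurable]: "(\<lambda>z. hb (r n (fst z)) (snd z)) \<in> borel_measurable (borel \<Otimes>\<^sub>M borel)"
        by (simp add: r_def)
      show ?thesis unfolding case_prod_beta by measurable
    qed
  qed
  moreover have "0 \<le> H t x" for t x
  proof (cases "x \<in> G \<and> 0 \<le> t")
    case True
    then have "0 \<le> h (r n t) x" for n using G(2)[of x] rQ[of t n] by simp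
    then have "0 \<le> h t x" using lim[of x t] True by (intro LIMSEQ_le_const[of _ "h t x"]) auto
    then show ?thesis by (simp add: H_def)
  qed (auto simp: H_def)
  ultimately show ?thesis
    using G by (intro that[of G H]) (auto simp: H_def)
qed

lemma nn_integral_set_cong_AE:
  fixes f g :: "real \<Rightarrow> ennreal"
  assumes "AE x in lborel. x \<in> A \<longrightarrow> f x = g x"
  shows "(\<integral>\<^sup>+x\<in>A. f x \<partial>lborel) = (\<integral>\<^sup>+x\<in>A. g x \<partial>lborel)"
  by (rule nn_integral_cong_AE) (use assms in \<open>eventually_elim, auto simp: indicator_def\<close>)

text \<open>
  The operators depend only on the classes of the profile and of the kernels. The three congruence
  rules allow both to change, as they serve uniqueness and the passage to Borel kernels.
\<close>

lemma op_Bc_cong: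
  assumes f: "AE y in lborel. 0 < y \<longrightarrow> f y = f' y"
    and K: "AE y in lborel. 0 < y \<and> y < x \<longrightarrow> E (x - y) y * \<Psi> (x - y) y = E' (x - y) y * \<Psi>' (x - y) y"
  shows "op_Bc \<Psi> E f x = op_Bc \<Psi>' E' f' x"
  unfolding op_Bc_def nn_integral_completion
proof (intro arg_cong[where f="\<lambda>z. 1 / 2 * z"] nn_integral_set_cong_AE)
  show "AE y in lborel. y \<in> {0<..<x} \<longrightarrow> ennreal (E (x - y) y * \<Psi> (x - y) y * f (x - y) * f y)
     = ennreal (E' (x - y) y * \<Psi>' (x - y) y * f' (x - y) * f' y)"
    using f AE_lborel_reflect[OF f, of x] K by eventually_elim auto
qed

lemma op_Dcb_cong:
  assumes f: "AE y in lborel. 0 < y \<longrightarrow> f y = f' y" and x: "f x = f' x"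
    and K: "AE y in lborel. 0 < y \<longrightarrow> \<Psi> x y = \<Psi>' x y"
  shows "op_Dcb \<Psi> f x = op_Dcb \<Psi>' f' x"
  unfolding op_Dcb_def nn_integral_completion
proof (rule nn_integral_set_cong_AE)
  show "AE y in lborel. y \<in> {0<..} \<longrightarrow> ennreal (\<Psi> x y * f x * f y) = ennreal (\<Psi>' x y * f' x * f' y)"
    using f K by eventually_elim (auto simp: x)
qed

lemma op_Bb_cong:
  assumes f: "AE y in lborel. 0 < y \<longrightarrow> f y = f' y"
    and K: "AE y in lborel. AE z in lborel. x < y \<and> 0 < z \<and> z < y \<longrightarrow>
      P x (y - z) z * E (y - z) z * \<Psi> (y - z) z = P' x (y - z) z * E' (y - z) z * \<Psi>' (y - z) z"
  shows "op_Bb \<Psi> E P f x = op_Bb \<Psi>' E' P' f' x"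
  unfolding op_Bb_def nn_integral_completion
proof (intro arg_cong[where f="\<lambda>z. 1 / 2 * z"] nn_integral_set_cong_AE)
  show "AE y in lborel. y \<in> {x<..} \<longrightarrow>
     (\<integral>\<^sup>+z\<in>{0<..<y}. ennreal (P x (y - z) z * E (y - z) z * \<Psi> (y - z) z * f (y - z) * f z) \<partial>lborel)
     = (\<integral>\<^sup>+z\<in>{0<..<y}. ennreal (P' x (y - z) z * E' (y - z) z * \<Psi>' (y - z) z * f' (y - z) * f' z) \<partial>lborel)"
    using K
  proof (eventually_elim, intro impI nn_integral_set_cong_AE)
    fix y assume K: "AE z in lborel. x < y \<and> 0 < z \<and> z < y \<longrightarrow>
      P x (y - z) z * E (y - z) z * \<Psi> (y - z) z = P' x (y - z) z * E' (y - z) z * \<Psi>' (y - z) z"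
      and y: "y \<in> {x<..}"
    show "AE z in lborel. z \<in> {0<..<y} \<longrightarrow> ennreal (P x (y - z) z * E (y - z) z * \<Psi> (y - z) z * f (y - z) * f z)
       = ennreal (P' x (y - z) z * E' (y - z) z * \<Psi>' (y - z) z * f' (y - z) * f' z)"
      using K f AE_lborel_reflect[OF f, of y] by eventually_elim (use y in auto)
  qed
qed

lemma S_norm_cong:
  assumes f: "AE x in lborel. 0 < x \<longrightarrow> f x = f' x"
    and "f \<in> S_space \<sigma>" and "f' \<in> borel_measurable borel"
  shows "S_norm \<sigma> f = S_norm \<sigma> f'" "f' \<in> S_space \<sigma>"
proof -
  have eq: "AE x in lebesgue. indicator {0<..} x *\<^sub>R (S_weight \<sigma> x * f x) = indicator {0<..} x *\<^sub>R (S_weight \<sigma> x * f' x)"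
    unfolding AE_completion_iff using f by eventually_elim (auto simp: indicator_def)
  have S: "S_weight \<sigma> \<in> borel_measurable borel" unfolding S_weight_def by measurable
  have m': "(\<lambda>x. indicator {0<..} x *\<^sub>R (S_weight \<sigma> x * f' x)) \<in> borel_measurable lebesgue"
    using assms(3) S by (intro measurable_completion) simp
  have int: "integrable lebesgue (\<lambda>x. indicator {0<..} x *\<^sub>R (S_weight \<sigma> x * f x))"
    using assms(2) by (simp add: S_space_def set_integrable_def)
  show "f' \<in> S_space \<sigma>" unfolding S_space_def set_integrable_def mem_Collect_eq
    by (rule integrable_cong_AE_imp[OF int m']) (use eq in \<open>eventually_elim, simp\<close>)
  have abs: "indicator {0<..} x *\<^sub>R (S_weight \<sigma> x * \<bar>g x\<bar>) = \<bar>indicator {0<..} x *\<^sub>R (S_weight \<sigma> x * g x)\<bar>" for x and g :: "real \<Rightarrow> real"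
    using S_weight_pos[of x \<sigma>] by (auto simp: indicator_def abs_mult)
  show "S_norm \<sigma> f = S_norm \<sigma> f'"
    unfolding S_norm_def set_lebesgue_integral_def abs
    by (rule integral_cong_AE) (use int m' eq in \<open>auto intro!: borel_measurable_abs elim!: eventually_mono\<close>)
qed


section \<open>Uniqueness\<close>

lemma ennreal_abs_diff_le:
  assumes "a < \<infinity>" "b < \<infinity>" "a \<le> b + c" "b \<le> a + c"
  shows "ennreal \<bar>enn2real a - enn2real b\<bar> \<le> c"
proof (cases "c = \<infinity>")
  case False
  obtain a' b' c' where "a = ennreal a'" "b = ennreal b'" "c = ennreal c'" "0 \<le> a'" "0 \<le> b'" "0 \<le> c'"
    using assms(1,2) False by (cases a; cases b; cases c) auto
  then show ?thesis using assms(3,4) by (simp add: ennreal_plus[symmetric] del: ennreal_plus)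
qed simp

lemma weak_solution_weight_bounded:
  assumes S: "\<And>s. s \<in> {0..b} \<Longrightarrow> h s \<in> S_space \<sigma>" and cont: "S_continuous_on \<sigma> {0..b} h"
    and H: "\<And>s. H s \<in> borel_measurable borel" "\<And>s. s \<in> {0..b} \<Longrightarrow> AE x in lborel. 0 < x \<longrightarrow> h s x = H s x"
  shows "\<exists>B\<ge>0. \<forall>s\<in>{0..b}. (\<integral>\<^sup>+x. ennreal (half_line_weight \<sigma> x) * ennreal \<bar>H s x\<bar> \<partial>lborel) \<le> ennreal B"
proof -
  note [measurable] = H(1)
  let ?N = "\<lambda>f. (\<integral>\<^sup>+x. ennreal (half_line_weight \<sigma> x) * ennreal \<bar>f x\<bar> \<partial>lborel)"
  define n where "n s = enn2real (?N (H s))" for s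
  have fin: "?N (H s) < \<infinity>" if s: "s \<in> {0..b}" for s
    using S_norm_cong(2)[OF H(2)[OF s] S[OF s] H(1)] by (simp add: S_space_iff_nn_integral)
  have step: "\<bar>n s - n t\<bar> \<le> S_norm \<sigma> (\<lambda>x. h s x - h t x)" if s: "s \<in> {0..b}" and t: "t \<in> {0..b}" for s t
  proof -
    have diff: "(\<lambda>x. h s x - h t x) \<in> S_space \<sigma>"
      using set_integral_diff(1)[of lebesgue "{0<..}" "\<lambda>x. S_weight \<sigma> x * h s x" "\<lambda>x. S_weight \<sigma> x * h t x"] S[OF s] S[OF t]
      by (simp add: S_space_def right_diff_distrib)
    have ae: "AE x in lborel. 0 < x \<longrightarrow> h s x - h t x = H s x - H t x"
      using H(2)[OF s] H(2)[OF t] by eventually_elim auto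
    have eq: "S_norm \<sigma> (\<lambda>x. h s x - h t x) = enn2real (?N (\<lambda>x. H s x - H t x))"
      by (subst S_norm_cong(1)[OF ae diff]) (auto simp: S_norm_eq_nn_integral)
    have fin': "?N (\<lambda>x. H s x - H t x) < \<infinity>"
      using S_norm_cong(2)[OF ae diff] by (simp add: S_space_iff_nn_integral)
    have tri: "?N f \<le> ?N g + ?N (\<lambda>x. H s x - H t x)"
      if [measurable]: "f \<in> borel_measurable borel" "g \<in> borel_measurable borel"
        and le: "\<And>x. \<bar>f x\<bar> \<le> \<bar>g x\<bar> + \<bar>H s x - H t x\<bar>" for f g
    proof -
      have "?N f \<le> (\<integral>\<^sup>+x. ennreal (half_line_weight \<sigma> x) * ennreal \<bar>g x\<bar>
          + ennreal (half_line_weight \<sigma> x) * ennreal \<bar>H s x - H t x\<bar> \<partial>lborel)"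
        unfolding distrib_left[symmetric]
        by (intro nn_integral_mono mult_left_mono) (auto simp: ennreal_plus[symmetric] le simp del: ennreal_plus intro!: ennreal_leI)
      also have "\<dots> = ?N g + ?N (\<lambda>x. H s x - H t x)" by (rule nn_integral_add) measurable
      finally show ?thesis .
    qed
    have "ennreal \<bar>n s - n t\<bar> \<le> ?N (\<lambda>x. H s x - H t x)"
      unfolding n_def
    proof (rule ennreal_abs_diff_le[OF fin[OF s] fin[OF t]])
      show "?N (H s) \<le> ?N (H t) + ?N (\<lambda>x. H s x - H t x)" by (rule tri[OF H(1) H(1)]) linarith
      show "?N (H t) \<le> ?N (H s) + ?N (\<lambda>x. H s x - H t x)" by (rule tri[OF H(1) H(1)]) linarith
    qed
    also have "\<dots> = ennreal (S_norm \<sigma> (\<lambda>x. h s x - h t x))" using fin' by (simp add: eq less_top)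
    finally show ?thesis by (subst (asm) ennreal_le_iff) (auto simp: eq)
  qed
  have "continuous_on {0..b} n"
    unfolding continuous_on_def
  proof
    fix t assume t: "t \<in> {0..b}"
    have lim: "((\<lambda>s. S_norm \<sigma> (\<lambda>x. h s x - h t x)) \<longlongrightarrow> 0) (at t within {0..b})"
      using cont t by (auto simp: S_continuous_on_def)
    have "((\<lambda>s. n s - n t) \<longlongrightarrow> 0) (at t within {0..b})"
      by (rule Lim_null_comparison[OF _ lim]) (use step t in \<open>auto simp: eventually_at_filter intro!: always_eventually\<close>)
    then show "(n \<longlongrightarrow> n t) (at t within {0..b})" by (simp add: LIM_zero_iff)
  qed
  then have "compact (n ` {0..b})" by (rule compact_continuous_image) simp
  then obtain B where B: "\<forall>y\<in>n ` {0..b}. norm y \<le> B" using compact_imp_bounded bounded_iff by blast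
  have "?N (H s) \<le> ennreal (max 0 B)" if s: "s \<in> {0..b}" for s
  proof -
    have "?N (H s) = ennreal (n s)" using fin[OF s] by (simp add: n_def less_top)
    also have "\<dots> \<le> ennreal (max 0 B)" using B s by (intro ennreal_leI) force
    finally show ?thesis .
  qed
  then show ?thesis by (intro exI[of _ "max 0 B"]) auto
qed

context collision_model begin

lemma product_difference:
  fixes f g :: "real \<Rightarrow> real"
  assumes "\<And>x. 0 \<le> f x" "\<And>x. 0 \<le> g x"
  shows "ennreal (f a) * ennreal (f b) \<le> ennreal (g a) * ennreal (g b)
    + (ennreal \<bar>f a - g a\<bar> * ennreal (f b + g b) + ennreal (f a + g a) * ennreal \<bar>f b - g b\<bar>)"
proof -
  have "f a * f b - g a * g b = (f a - g a) * f b + g a * (f b - g b)" by (simp add: algebra_simps)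
  also have "\<dots> \<le> \<bar>f a - g a\<bar> * (f b + g b) + (f a + g a) * \<bar>f b - g b\<bar>"
  proof (rule add_mono)
    show "(f a - g a) * f b \<le> \<bar>f a - g a\<bar> * (f b + g b)" using assms by (intro mult_mono) auto
    have "g a * (f b - g b) \<le> g a * \<bar>f b - g b\<bar>" using assms by (intro mult_left_mono) auto
    also have "\<dots> \<le> (f a + g a) * \<bar>f b - g b\<bar>" using assms by (intro mult_right_mono) auto
    finally show "g a * (f b - g b) \<le> (f a + g a) * \<bar>f b - g b\<bar>" .
  qed
  finally have "f a * f b \<le> g a * g b + (\<bar>f a - g a\<bar> * (f b + g b) + (f a + g a) * \<bar>f b - g b\<bar>)" by simp
  then show ?thesis using assms by (simp add: ennreal_mult[symmetric] ennreal_plus[symmetric] del: ennreal_plus)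
qed

text \<open>
  Written with sums, since differences are truncated in \<open>[0,\<infinity>]\<close>. The right-hand side uses \<open>f + g\<close> in place
  of \<open>f\<close> or \<open>g\<close>, so that it is symmetric in the two profiles and bounds the difference in both directions.
\<close>

lemma operators_difference:
  fixes f g :: "real \<Rightarrow> real"
  assumes [measurable]: "f \<in> borel_measurable borel" "g \<in> borel_measurable borel"
    and nn: "\<And>x. 0 \<le> f x" "\<And>x. 0 \<le> g x"
  defines "d \<equiv> \<lambda>x. ennreal \<bar>f x - g x\<bar>" and "s \<equiv> \<lambda>x. ennreal (f x + g x)"
  shows "coag (enn f) (enn f) x
      \<le> coag (enn g) (enn g) x + (coag d s x + coag s d x)"
    and "breakage (enn f) (enn f) x
      \<le> breakage (enn g) (enn g) x + (breakage d s x + breakage s d x)"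
    and "lin \<Psi> (enn f) (enn f) x
      \<le> lin \<Psi> (enn g) (enn g) x + (lin \<Psi> d s x + lin \<Psi> s d x)"
proof -
  have [measurable]: "d \<in> borel_measurable borel" "s \<in> borel_measurable borel" unfolding d_def s_def by measurable
  let ?f = "\<lambda>x. ennreal (f x)" and ?g = "\<lambda>x. ennreal (g x)"
  have pd: "c * (?f a * ?f b) \<le> c * (?g a * ?g b) + (c * (d a * s b) + c * (s a * d b))" for c a b
    unfolding distrib_left[symmetric] d_def s_def by (intro mult_left_mono product_difference nn) auto
  have "coag ?f ?f x \<le> (\<integral>\<^sup>+y. ennreal (E (x - y) y * \<Psi> (x - y) y / 2) * (?g (x - y) * ?g y)
      + (ennreal (E (x - y) y * \<Psi> (x - y) y / 2) * (d (x - y) * s y)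
      + ennreal (E (x - y) y * \<Psi> (x - y) y / 2) * (s (x - y) * d y)) \<partial>lborel)"
    unfolding coag_def by (intro nn_integral_mono pd)
  also have "\<dots> = coag ?g ?g x + (coag d s x + coag s d x)"
    unfolding coag_def by (simp add: nn_integral_add)
  finally show "coag ?f ?f x \<le> coag ?g ?g x + (coag d s x + coag s d x)" .
  have "breakage ?f ?f x \<le> (\<integral>\<^sup>+y. \<integral>\<^sup>+z. ennreal (P x y z * (1 - E y z) * \<Psi> y z / 2) * (?g y * ?g z)
      + (ennreal (P x y z * (1 - E y z) * \<Psi> y z / 2) * (d y * s z)
      + ennreal (P x y z * (1 - E y z) * \<Psi> y z / 2) * (s y * d z)) \<partial>lborel \<partial>lborel)"
    unfolding breakage_def by (intro nn_integral_mono pd)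
  also have "\<dots> = breakage ?g ?g x + (breakage d s x + breakage s d x)"
    unfolding breakage_def by (simp add: nn_integral_add)
  finally show "breakage ?f ?f x \<le> breakage ?g ?g x + (breakage d s x + breakage s d x)" .
  have lin_eq: "lin \<Psi> p r x = (\<integral>\<^sup>+y. ennreal (\<Psi> x y) * (p x * r y) \<partial>lborel)"
    if [measurable]: "r \<in> borel_measurable borel" for p r
  proof -
    have "lin \<Psi> p r x = (\<integral>\<^sup>+y. p x * (ennreal (\<Psi> x y) * r y) \<partial>lborel)"
      unfolding lin_def by (rule nn_integral_cmult[symmetric]) measurable
    then show ?thesis by (simp add: mult_ac)
  qed
  have "lin \<Psi> ?f ?f x \<le> (\<integral>\<^sup>+y. ennreal (\<Psi> x y) * (?g x * ?g y)
      + (ennreal (\<Psi> x y) * (d x * s y) + ennreal (\<Psi> x y) * (s x * d y)) \<partial>lborel)"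
    by (subst lin_eq) (auto intro!: nn_integral_mono pd)
  also have "\<dots> = lin \<Psi> ?g ?g x + (lin \<Psi> d s x + lin \<Psi> s d x)"
    by (simp add: nn_integral_add lin_eq)
  finally show "lin \<Psi> ?f ?f x \<le> lin \<Psi> ?g ?g x + (lin \<Psi> d s x + lin \<Psi> s d x)" .
qed

definition net_rate :: "(real \<Rightarrow> real) \<Rightarrow> real \<Rightarrow> real" where
  "net_rate f x = enn2real (coag (enn f) (enn f) x)
     - enn2real (lin \<Psi> (enn f) (enn f) x)
     + enn2real (breakage (enn f) (enn f) x)"

lemma net_rate_difference:
  fixes f g :: "real \<Rightarrow> real"
  assumes meas: "f \<in> borel_measurable borel" "g \<in> borel_measurable borel"
    and nn: "\<And>x. 0 \<le> f x" "\<And>x. 0 \<le> g x"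
    and fin: "\<And>p. p \<in> {f, g} \<Longrightarrow> coag (enn p) (enn p) x < \<infinity>"
      "\<And>p. p \<in> {f, g} \<Longrightarrow> lin \<Psi> (enn p) (enn p) x < \<infinity>"
      "\<And>p. p \<in> {f, g} \<Longrightarrow> breakage (enn p) (enn p) x < \<infinity>"
  defines "d \<equiv> \<lambda>x. ennreal \<bar>f x - g x\<bar>" and "s \<equiv> \<lambda>x. ennreal (f x + g x)"
  shows "ennreal \<bar>net_rate f x - net_rate g x\<bar> \<le> bilin \<Psi> d s x + bilin \<Psi> s d x"
proof -
  let ?f = "\<lambda>x. ennreal (f x)" and ?g = "\<lambda>x. ennreal (g x)"
  have d': "d = (\<lambda>x. ennreal \<bar>g x - f x\<bar>)" and s': "s = (\<lambda>x. ennreal (g x + f x))"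
    by (auto simp: d_def s_def abs_minus_commute add.commute)
  note fg = operators_difference[OF meas nn, of x, folded d_def s_def]
  note gf = operators_difference[OF meas(2,1) nn(2,1), of x, folded d' s']
  have c: "ennreal \<bar>enn2real (coag ?f ?f x) - enn2real (coag ?g ?g x)\<bar> \<le> coag d s x + coag s d x"
    using fin(1) by (intro ennreal_abs_diff_le fg gf) auto
  have b: "ennreal \<bar>enn2real (breakage ?f ?f x) - enn2real (breakage ?g ?g x)\<bar> \<le> breakage d s x + breakage s d x"
    using fin(3) by (intro ennreal_abs_diff_le fg gf) auto
  have l: "ennreal \<bar>enn2real (lin \<Psi> ?f ?f x) - enn2real (lin \<Psi> ?g ?g x)\<bar> \<le> lin \<Psi> d s x + lin \<Psi> s d x"
    using fin(2) by (intro ennreal_abs_diff_le fg gf) auto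
  have "\<bar>net_rate f x - net_rate g x\<bar> \<le> \<bar>enn2real (coag ?f ?f x) - enn2real (coag ?g ?g x)\<bar>
      + \<bar>enn2real (breakage ?f ?f x) - enn2real (breakage ?g ?g x)\<bar> + \<bar>enn2real (lin \<Psi> ?f ?f x) - enn2real (lin \<Psi> ?g ?g x)\<bar>"
    unfolding net_rate_def by linarith
  then have "ennreal \<bar>net_rate f x - net_rate g x\<bar> \<le> ennreal \<bar>enn2real (coag ?f ?f x) - enn2real (coag ?g ?g x)\<bar>
      + ennreal \<bar>enn2real (breakage ?f ?f x) - enn2real (breakage ?g ?g x)\<bar>
      + ennreal \<bar>enn2real (lin \<Psi> ?f ?f x) - enn2real (lin \<Psi> ?g ?g x)\<bar>"
    by (simp add: ennreal_plus[symmetric] del: ennreal_plus)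
  also have "\<dots> \<le> (coag d s x + coag s d x) + (breakage d s x + breakage s d x) + (lin \<Psi> d s x + lin \<Psi> s d x)"
    by (intro add_mono c b l)
  also have "\<dots> = bilin \<Psi> d s x + bilin \<Psi> s d x" by (simp add: bilin_def add_ac)
  finally show ?thesis .
qed

text \<open>
  The weighted norm \<open>\<Delta>\<close> of the difference satisfies a Gronwall inequality, because \<open>bilin \<Psi>\<close> is bounded and
  the norms of both solutions are bounded on compact time intervals.
\<close>

theorem weak_solution_unique:
  assumes sol1: "global_weak_solution \<sigma> \<Psi> E (\<lambda>x y. 1 - E x y) P g_in h1"
    and sol2: "global_weak_solution \<sigma> \<Psi> E (\<lambda>x y. 1 - E x y) P g_in h2"
    and t: "0 \<le> t"
  shows "S_eq (h1 t) (h2 t)"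
proof -
  let ?E' = "\<lambda>x y. 1 - E x y"
  obtain G1 H1 where G1 [measurable]: "G1 \<in> sets borel" and ae1: "AE x in lborel. 0 < x \<longrightarrow> x \<in> G1" and "G1 \<subseteq> {0<..}"
    and H1 [measurable]: "joint_borel H1"
    and eq1: "\<And>t x. 0 \<le> t \<Longrightarrow> x \<in> G1 \<Longrightarrow> H1 t x = h1 t x" and nn1: "\<And>t x. (0::real) \<le> H1 t x"
    and int1: "\<And>t x. x \<in> G1 \<Longrightarrow> 0 \<le> t \<Longrightarrow> integral_equation_at \<Psi> E ?E' P g_in h1 x t"
    by (rule weak_solution_joint_version[OF sol1]) (rule that)
  obtain G2 H2 where G2 [measurable]: "G2 \<in> sets borel" and ae2: "AE x in lborel. 0 < x \<longrightarrow> x \<in> G2" and "G2 \<subseteq> {0<..}"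
    and H2 [measurable]: "joint_borel H2"
    and eq2: "\<And>t x. 0 \<le> t \<Longrightarrow> x \<in> G2 \<Longrightarrow> H2 t x = h2 t x" and nn2: "\<And>t x. (0::real) \<le> H2 t x"
    and int2: "\<And>t x. x \<in> G2 \<Longrightarrow> 0 \<le> t \<Longrightarrow> integral_equation_at \<Psi> E ?E' P g_in h2 x t"
    by (rule weak_solution_joint_version[OF sol2]) (rule that)
  have sec: "H1 s \<in> borel_measurable borel" "H2 s \<in> borel_measurable borel" for s by measurable
  have ops: "op_Bc \<Psi> E (h s) x = coag (enn (H s)) (enn (H s)) x"
    "op_Dcb \<Psi> (h s) x = lin \<Psi> (enn (H s)) (enn (H s)) x"
    "op_Bb \<Psi> ?E' P (h s) x = breakage (enn (H s)) (enn (H s)) x"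
    if ae: "AE y in lborel. 0 < y \<longrightarrow> h s y = H s y" and x: "h s x = H s x"
      and m: "H s \<in> borel_measurable borel" and nn: "\<And>y. 0 \<le> H s y" for h H :: "real \<Rightarrow> real \<Rightarrow> real" and s x
  proof -
    show "op_Bc \<Psi> E (h s) x = coag (enn (H s)) (enn (H s)) x"
      unfolding op_Bc_eq_coag[OF m nn, symmetric] by (rule op_Bc_cong[OF ae]) simp
    show "op_Dcb \<Psi> (h s) x = lin \<Psi> (enn (H s)) (enn (H s)) x"
      unfolding op_Dcb_eq_lin[OF m nn, symmetric] by (rule op_Dcb_cong[OF ae x]) simp
    show "op_Bb \<Psi> ?E' P (h s) x = breakage (enn (H s)) (enn (H s)) x"
      unfolding op_Bb_eq_breakage[OF m nn, symmetric] by (rule op_Bb_cong[OF ae]) simp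
  qed
  have aeH1: "AE y in lborel. 0 < y \<longrightarrow> h1 s y = H1 s y" if "0 \<le> s" for s
    using ae1 by eventually_elim (use eq1 that in auto)
  have aeH2: "AE y in lborel. 0 < y \<longrightarrow> h2 s y = H2 s y" if "0 \<le> s" for s
    using ae2 by eventually_elim (use eq2 that in auto)
  define d where "d s x = ennreal \<bar>H1 s x - H2 s x\<bar>" for s x
  define \<Sigma> where "\<Sigma> s x = ennreal (H1 s x + H2 s x)" for s x
  have [measurable]: "joint_borel d" "joint_borel \<Sigma>"
    unfolding d_def \<Sigma>_def by measurable
  define R where "R s x = bilin \<Psi> (d s) (\<Sigma> s) x + bilin \<Psi> (\<Sigma> s) (d s) x" for s x
  have [measurable]: "joint_borel R"
  proof -
    have [measurable]: "(\<lambda>(s, x). bilin \<Psi> (d s) (\<Sigma> s) x) \<in> borel_measurable (borel \<Otimes>\<^sub>M borel)"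
      "(\<lambda>(s, x). bilin \<Psi> (\<Sigma> s) (d s) x) \<in> borel_measurable (borel \<Otimes>\<^sub>M borel)"
      by (rule bilin_measurable; measurable)+
    show ?thesis unfolding R_def by measurable
  qed
  have pointwise: "d t x \<le> (\<integral>\<^sup>+s\<in>{0..t}. R s x \<partial>lborel)" if x: "x \<in> G1" "x \<in> G2" and t: "0 \<le> t" for x t
  proof -
    have ops1: "op_Bc \<Psi> E (h1 s) x = coag (enn (H1 s)) (enn (H1 s)) x"
      "op_Dcb \<Psi> (h1 s) x = lin \<Psi> (enn (H1 s)) (enn (H1 s)) x"
      "op_Bb \<Psi> ?E' P (h1 s) x = breakage (enn (H1 s)) (enn (H1 s)) x"
      if "0 \<le> s" for s
      by (rule ops[of h1 s H1, OF aeH1[OF that] eq1[OF that x(1), symmetric] sec(1) nn1])+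
    have ops2: "op_Bc \<Psi> E (h2 s) x = coag (enn (H2 s)) (enn (H2 s)) x"
      "op_Dcb \<Psi> (h2 s) x = lin \<Psi> (enn (H2 s)) (enn (H2 s)) x"
      "op_Bb \<Psi> ?E' P (h2 s) x = breakage (enn (H2 s)) (enn (H2 s)) x"
      if "0 \<le> s" for s
      by (rule ops[of h2 s H2, OF aeH2[OF that] eq2[OF that x(2), symmetric] sec(2) nn2])+
    let ?D = "\<lambda>h s. enn2real (op_Bc \<Psi> E (h s) x) - enn2real (op_Dcb \<Psi> (h s) x) + enn2real (op_Bb \<Psi> ?E' P (h s) x)"
    note i1 = int1[OF x(1) t, unfolded integral_equation_at_def]
    note i2 = int2[OF x(2) t, unfolded integral_equation_at_def]
    have int: "set_integrable lebesgue {0..t} (?D h1)" "set_integrable lebesgue {0..t} (?D h2)"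
      using i1 i2 by blast+
    have "H1 t x - H2 t x = (LINT s:{0..t}|lebesgue. ?D h1 s) - (LINT s:{0..t}|lebesgue. ?D h2 s)"
      using i1 i2 eq1[OF t x(1)] eq2[OF t x(2)] by simp
    also have "\<dots> = (LINT s:{0..t}|lebesgue. ?D h1 s - ?D h2 s)"
      by (rule set_integral_diff(2)[OF int, symmetric])
    finally have "d t x = ennreal (norm (LINT s:{0..t}|lebesgue. ?D h1 s - ?D h2 s))"
      by (simp add: d_def)
    also have "\<dots> \<le> (\<integral>\<^sup>+s. ennreal (norm (indicator {0..t} s *\<^sub>R (?D h1 s - ?D h2 s))) \<partial>lebesgue)"
      unfolding set_lebesgue_integral_def
      using set_integral_diff(1)[OF int] by (intro integral_norm_bound_ennreal) (simp add: set_integrable_def)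
    also have "\<dots> = (\<integral>\<^sup>+s. ennreal (norm (indicator {0..t} s *\<^sub>R (?D h1 s - ?D h2 s))) \<partial>lborel)"
      by (rule nn_integral_completion)
    also have "\<dots> \<le> (\<integral>\<^sup>+s\<in>{0..t}. R s x \<partial>lborel)"
    proof (rule nn_integral_mono_AE)
      from i1 have "AE s in lborel. s \<in> {0..t} \<longrightarrow>
        op_Bc \<Psi> E (h1 s) x < \<infinity> \<and> op_Dcb \<Psi> (h1 s) x < \<infinity> \<and> op_Bb \<Psi> ?E' P (h1 s) x < \<infinity>"
        unfolding AE_completion_iff by blast
      moreover from i2 have "AE s in lborel. s \<in> {0..t} \<longrightarrow>
        op_Bc \<Psi> E (h2 s) x < \<infinity> \<and> op_Dcb \<Psi> (h2 s) x < \<infinity> \<and> op_Bb \<Psi> ?E' P (h2 s) x < \<infinity>"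
        unfolding AE_completion_iff by blast
      ultimately show "AE s in lborel. ennreal (norm (indicator {0..t} s *\<^sub>R (?D h1 s - ?D h2 s))) \<le> R s x * indicator {0..t} s"
      proof eventually_elim
        case (elim s)
        show ?case
        proof (cases "s \<in> {0..t}")
          case True
          then have s: "0 \<le> s" by simp
          have "ennreal \<bar>net_rate (H1 s) x - net_rate (H2 s) x\<bar> \<le> R s x"
            unfolding R_def d_def \<Sigma>_def
            by (rule net_rate_difference[OF sec nn1 nn2]) (use elim True in \<open>auto simp: ops1[OF s] ops2[OF s]\<close>)
          then show ?thesis using True by (simp add: net_rate_def ops1[OF s] ops2[OF s])
        qed simp
      qed
    qed
    finally show ?thesis .
  qed
  define \<Delta> where "\<Delta> s = (\<integral>\<^sup>+x. w x * d s x \<partial>lborel)" for s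
  have sp: "h1 s \<in> S_space \<sigma>" "h2 s \<in> S_space \<sigma>" if "s \<in> {0..t + 1}" for s
    using sol1 sol2 that t unfolding global_weak_solution_def weak_solution_on_def S_cone_def
    by (auto dest!: spec[of _ "t + 1"])
  have co: "S_continuous_on \<sigma> {0..t + 1} h1" "S_continuous_on \<sigma> {0..t + 1} h2"
    using sol1 sol2 t unfolding global_weak_solution_def weak_solution_on_def
    by (auto dest!: spec[of _ "t + 1"])
  have "\<exists>B\<ge>0. \<forall>s\<in>{0..t + 1}. (\<integral>\<^sup>+x. w x * ennreal \<bar>H1 s x\<bar> \<partial>lborel) \<le> ennreal B"
    by (rule weak_solution_weight_bounded[OF sp(1) co(1) sec(1)]) (assumption, rule aeH1, simp)
  then obtain B1 where B1: "0 \<le> B1" "\<And>s. s \<in> {0..t + 1} \<Longrightarrow> (\<integral>\<^sup>+x. w x * ennreal (H1 s x) \<partial>lborel) \<le> ennreal B1"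
    unfolding abs_of_nonneg[OF nn1] by blast
  have "\<exists>B\<ge>0. \<forall>s\<in>{0..t + 1}. (\<integral>\<^sup>+x. w x * ennreal \<bar>H2 s x\<bar> \<partial>lborel) \<le> ennreal B"
    by (rule weak_solution_weight_bounded[OF sp(2) co(2) sec(2)]) (assumption, rule aeH2, simp)
  then obtain B2 where B2: "0 \<le> B2" "\<And>s. s \<in> {0..t + 1} \<Longrightarrow> (\<integral>\<^sup>+x. w x * ennreal (H2 s x) \<partial>lborel) \<le> ennreal B2"
    unfolding abs_of_nonneg[OF nn2] by blast
  have \<Sigma>_weight: "(\<integral>\<^sup>+x. w x * \<Sigma> s x \<partial>lborel) \<le> ennreal (B1 + B2)" if s: "s \<in> {0..t + 1}" for s
  proof -
    have "(\<integral>\<^sup>+x. w x * \<Sigma> s x \<partial>lborel) = (\<integral>\<^sup>+x. w x * ennreal (H1 s x) + w x * ennreal (H2 s x) \<partial>lborel)"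
      by (simp add: \<Sigma>_def nn1 nn2 distrib_left)
    also have "\<dots> = (\<integral>\<^sup>+x. w x * ennreal (H1 s x) \<partial>lborel) + (\<integral>\<^sup>+x. w x * ennreal (H2 s x) \<partial>lborel)"
      by (rule nn_integral_add) measurable
    also have "\<dots> \<le> ennreal B1 + ennreal B2" by (intro add_mono B1 B2 s)
    finally show ?thesis using B1 B2 by simp
  qed
  have \<Delta>_le: "\<Delta> s \<le> ennreal (B1 + B2)" if s: "s \<in> {0..t + 1}" for s
  proof -
    have "\<Delta> s \<le> (\<integral>\<^sup>+x. w x * \<Sigma> s x \<partial>lborel)"
      unfolding \<Delta>_def
    proof (intro nn_integral_mono mult_left_mono)
      fix x
      show "d s x \<le> \<Sigma> s x" unfolding d_def \<Sigma>_def
        by (intro ennreal_leI) (use nn1[of s x] nn2[of s x] in linarith)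
    qed simp
    also note \<Sigma>_weight[OF s]
    finally show ?thesis .
  qed
  define K where "K = 2 * bound * (B1 + B2) + 1"
  have K: "0 < K" using B1(1) B2(1) bound_nonneg by (simp add: K_def add_nonneg_pos)
  have "\<Delta> t = 0"
  proof (rule gronwall_nn_integral[OF K])
    show "0 \<le> B1 + B2" using B1 B2 by simp
    show "t \<in> {0..t + 1}" using t by simp
    fix r assume r: "r \<in> {0..t + 1}"
    show "\<Delta> r \<le> ennreal (B1 + B2)" by (rule \<Delta>_le[OF r])
    have "\<Delta> r \<le> (\<integral>\<^sup>+x. w x * (\<integral>\<^sup>+s\<in>{0..r}. R s x \<partial>lborel) \<partial>lborel)"
      unfolding \<Delta>_def
    proof (rule nn_integral_mono_AE)
      show "AE x in lborel. w x * d r x \<le> w x * (\<integral>\<^sup>+s\<in>{0..r}. R s x \<partial>lborel)"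
        using ae1 ae2
      proof eventually_elim
        case (elim x)
        then show ?case
          by (cases "0 < x") (use r in \<open>auto simp: half_line_weight_def intro!: mult_left_mono pointwise\<close>)
      qed
    qed
    also have "\<dots> = (\<integral>\<^sup>+x. \<integral>\<^sup>+s. w x * (R s x * indicator {0..r} s) \<partial>lborel \<partial>lborel)"
      by (intro nn_integral_cong nn_integral_cmult[symmetric]) measurable
    also have "\<dots> = (\<integral>\<^sup>+s. \<integral>\<^sup>+x. w x * (R s x * indicator {0..r} s) \<partial>lborel \<partial>lborel)"
      by (rule lborel_pair.Fubini') measurable
    also have "\<dots> \<le> (\<integral>\<^sup>+s\<in>{0..r}. ennreal K * \<Delta> s \<partial>lborel)"
    proof (rule nn_integral_mono)
      fix s
      have "(\<integral>\<^sup>+x. w x * R s x \<partial>lborel) \<le> ennreal K * \<Delta> s" if s: "s \<in> {0..r}"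
      proof -
        have s': "s \<in> {0..t + 1}" using s r by auto
        have [measurable]: "bilin \<Psi> (d s) (\<Sigma> s) \<in> borel_measurable borel" "bilin \<Psi> (\<Sigma> s) (d s) \<in> borel_measurable borel"
          unfolding bilin_def coag_def breakage_def lin_def by measurable
        have "(\<integral>\<^sup>+x. w x * R s x \<partial>lborel)
            = (\<integral>\<^sup>+x. w x * bilin \<Psi> (d s) (\<Sigma> s) x \<partial>lborel) + (\<integral>\<^sup>+x. w x * bilin \<Psi> (\<Sigma> s) (d s) x \<partial>lborel)"
          unfolding R_def distrib_left by (rule nn_integral_add) measurable
        also have "\<dots> \<le> ennreal bound * (\<Delta> s * (\<integral>\<^sup>+x. w x * \<Sigma> s x \<partial>lborel))
            + ennreal bound * ((\<integral>\<^sup>+x. w x * \<Sigma> s x \<partial>lborel) * \<Delta> s)"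
          unfolding \<Delta>_def by (intro add_mono bilin_weight_bound admissible_\<Psi>) measurable
        also have "\<dots> \<le> ennreal bound * (\<Delta> s * ennreal (B1 + B2)) + ennreal bound * (ennreal (B1 + B2) * \<Delta> s)"
          by (intro add_mono mult_left_mono mult_right_mono \<Sigma>_weight s') auto
        also have "\<dots> = (ennreal bound * ennreal (B1 + B2) + ennreal bound * ennreal (B1 + B2)) * \<Delta> s"
          by (simp only: distrib_right mult.assoc mult.commute[of "\<Delta> s"])
        also have "\<dots> = ennreal (bound * (B1 + B2) + bound * (B1 + B2)) * \<Delta> s"
          using B1(1) B2(1) bound_nonneg by (simp only: ennreal_mult[symmetric] ennreal_plus[symmetric] add_nonneg_nonneg mult_nonneg_nonneg)
        also have "\<dots> \<le> ennreal K * \<Delta> s"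
          by (intro mult_right_mono ennreal_leI) (auto simp: K_def)
        finally show ?thesis .
      qed
      then show "(\<integral>\<^sup>+x. w x * (R s x * indicator {0..r} s) \<partial>lborel) \<le> ennreal K * \<Delta> s * indicator {0..r} s"
        by (auto simp: indicator_def)
    qed
    finally show "\<Delta> r \<le> (\<integral>\<^sup>+s\<in>{0..r}. ennreal K * \<Delta> s \<partial>lborel)" .
  qed
  then have "AE x in lborel. w x * d t x = 0"
    unfolding \<Delta>_def by (subst (asm) nn_integral_0_iff_AE) auto
  then show ?thesis
    unfolding S_eq_def AE_completion_iff using aeH1[OF t] aeH2[OF t]
  proof eventually_elim
    case (elim x)
    show ?case
    proof
      assume x: "0 < x"
      then have "half_line_weight \<sigma> x > 0" using S_weight_pos by (simp add: half_line_weight_def)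
      then show "h1 t x = h2 t x" using elim x by (auto simp: d_def)
    qed
  qed
qed

end


section \<open>Borel versions of the data\<close>

lemma AE_section:
  fixes R :: "'a::euclidean_space \<times> 'b::euclidean_space \<Rightarrow> bool"
  assumes "AE z in lborel. R z"
  shows "AE x in lborel. AE y in lborel. R (x, y)"
  by (rule lborel_pair.AE_pair) (subst lborel_prod, rule assms)

lemma AE_swap:
  fixes R :: "'a::euclidean_space \<times> 'b::euclidean_space \<Rightarrow> bool"
  assumes "AE z in lborel. R z"
  shows "AE z in lborel. R (snd z, fst z)"
proof -
  obtain N where N: "N \<in> null_sets lborel" "{z. \<not> R z} \<subseteq> N"
    using assms by (auto simp: eventually_ae_filter)
  then have [measurable]: "N \<in> sets (borel \<Otimes>\<^sub>M borel)" by (subst borel_prod) (auto simp: null_sets_def)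
  have "AE z in lborel. z \<notin> N" by (rule AE_not_in[OF N(1)])
  then have "AE x in lborel. AE y in lborel. (x, y) \<notin> N" by (rule AE_section)
  then have "AE y in lborel. AE x in lborel. (x, y) \<notin> N"
    by (subst lborel_pair.AE_commute) measurable
  moreover have "{z \<in> space (lborel \<Otimes>\<^sub>M lborel). (snd z, fst z) \<notin> N} \<in> sets (lborel \<Otimes>\<^sub>M lborel)"
  proof -
    have "(\<lambda>z. (snd z, fst z)) \<in> lborel \<Otimes>\<^sub>M lborel \<rightarrow>\<^sub>M borel \<Otimes>\<^sub>M borel" by measurable
    from sets.compl_sets[OF measurable_sets[OF this \<open>N \<in> sets (borel \<Otimes>\<^sub>M borel)\<close>]]
    show ?thesis by (rule back_subst[where P="\<lambda>S. S \<in> _"]) auto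
  qed
  ultimately have "AE z in lborel \<Otimes>\<^sub>M lborel. (snd z, fst z) \<notin> N"
    by (intro lborel_pair.AE_pair_measure) simp_all
  then have "AE z in lborel. (snd z, fst z) \<notin> N" by (subst (asm) lborel_prod)
  then show ?thesis by eventually_elim (use N in auto)
qed

text \<open>
  The shear \<open>(y,z) \<mapsto> (y - z, z)\<close>, which occurs in both gain operators, preserves Lebesgue measure.
\<close>

lemma AE_shear:
  fixes R :: "real \<times> real \<Rightarrow> bool"
  assumes "AE z in lborel. R z"
  shows "AE y in lborel. AE z in lborel. R (y - z, z)"
proof -
  obtain N where N: "N \<in> null_sets lborel" "{z. \<not> R z} \<subseteq> N"
    using assms by (auto simp: eventually_ae_filter)
  then have [measurable]: "N \<in> sets (borel \<Otimes>\<^sub>M borel)" by (subst borel_prod) (auto simp: null_sets_def)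
  have "(\<integral>\<^sup>+y. \<integral>\<^sup>+z. indicator N (y - z, z) \<partial>lborel \<partial>lborel) = (\<integral>\<^sup>+z. \<integral>\<^sup>+y. indicator N (y - z, z) \<partial>lborel \<partial>lborel)"
    by (rule lborel_pair.Fubini'[symmetric]) measurable
  also have "\<dots> = (\<integral>\<^sup>+z. \<integral>\<^sup>+y. indicator N (z + y - z, z) \<partial>lborel \<partial>lborel)"
    by (intro nn_integral_cong nn_integral_shift_lborel[symmetric]) measurable
  also have "\<dots> = (\<integral>\<^sup>+z. \<integral>\<^sup>+y. indicator N (y, z) \<partial>lborel \<partial>lborel)" by simp
  also have "\<dots> = (\<integral>\<^sup>+y. \<integral>\<^sup>+z. indicator N (y, z) \<partial>lborel \<partial>lborel)"
    by (rule lborel_pair.Fubini') measurable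
  also have "\<dots> = (\<integral>\<^sup>+z. indicator N z \<partial>(lborel \<Otimes>\<^sub>M lborel))"
    by (rule lborel.nn_integral_fst) measurable
  also have "\<dots> = 0" using N(1) by (subst lborel_prod) (simp add: null_sets_def)
  finally have "AE y in lborel. (\<integral>\<^sup>+z. indicator N (y - z, z) \<partial>lborel) = 0"
    by (subst (asm) nn_integral_0_iff_AE) auto
  then show ?thesis
  proof eventually_elim
    case (elim y)
    then have "AE z in lborel. (indicator N (y - z, z) :: ennreal) = 0"
      by (subst (asm) nn_integral_0_iff_AE) auto
    then show ?case by eventually_elim (use N in \<open>auto simp: indicator_def split: if_splits\<close>)
  qed
qed

lemma lebesgue_on_Borel_version:
  fixes f :: "'a::euclidean_space \<Rightarrow> real"
  assumes f: "f \<in> borel_measurable (lebesgue_on S)" and S: "S \<in> sets borel"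
  obtains f' where "f' \<in> borel_measurable borel" "AE z in lborel. z \<in> S \<longrightarrow> f' z = f z"
proof -
  have "(\<lambda>z. if z \<in> S then f z else 0) \<in> borel_measurable lebesgue"
    using f S by (subst borel_measurable_if) auto
  then obtain f' where "f' \<in> borel_measurable lborel" "AE z in lborel. (if z \<in> S then f z else 0) = f' z"
    by (blast dest: completion_ex_borel_measurable_real)
  then show ?thesis by (intro that[of f']) (auto elim!: eventually_mono)
qed

text \<open>
  A nonzero value of the Bochner integral certifies integrability.
\<close>

lemma set_integral_nonzero_nn_integral:
  fixes f :: "real \<Rightarrow> real"
  assumes "(LINT x:A|lebesgue. f x) = c" "0 < c" "\<And>x. x \<in> A \<Longrightarrow> 0 \<le> f x"
  shows "(\<integral>\<^sup>+x\<in>A. ennreal (f x) \<partial>lborel) = ennreal c"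
proof -
  have int: "integrable lebesgue (\<lambda>x. indicator A x *\<^sub>R f x)"
    using assms(1,2) not_integrable_integral_eq unfolding set_lebesgue_integral_def by force
  have "(\<integral>\<^sup>+x. ennreal (indicator A x *\<^sub>R f x) \<partial>lebesgue) = ennreal c"
    using nn_integral_eq_integral[OF int] assms unfolding set_lebesgue_integral_def by (simp add: indicator_def)
  moreover have "ennreal (indicator A x *\<^sub>R f x) = ennreal (f x) * indicator A x" for x
    by (simp add: indicator_def)
  ultimately show ?thesis by (simp add: nn_integral_completion)
qed

text \<open>
  Agreement for all profiles at once: the exceptional null set of points \<open>x\<close> must not depend on the
  profile, which runs through all times of a solution.
\<close>

definition operators_agree_at where
  "operators_agree_at \<Psi> E E' P \<Psi>1 E1 E1' P1 x \<longleftrightarrow>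
     (\<forall>f. op_Bc \<Psi> E f x = op_Bc \<Psi>1 E1 f x \<and> op_Dcb \<Psi> f x = op_Dcb \<Psi>1 f x \<and> op_Bb \<Psi> E' P f x = op_Bb \<Psi>1 E1' P1 f x) \<and>
     (AE y in lborel. 0 < y \<longrightarrow> \<Psi> x y = \<Psi>1 x y)"

lemma integral_equation_at_transfer:
  assumes agree: "operators_agree_at \<Psi> E E' P \<Psi>1 E1 E1' P1 x" and g: "g_in x = g1 x"
    and eq: "integral_equation_at \<Psi> E E' P g_in h x t"
  shows "integral_equation_at \<Psi>1 E1 E1' P1 g1 h x t"
proof -
  from agree have ops: "op_Bc \<Psi> E f x = op_Bc \<Psi>1 E1 f x" "op_Dcb \<Psi> f x = op_Dcb \<Psi>1 f x"
      "op_Bb \<Psi> E' P f x = op_Bb \<Psi>1 E1' P1 f x" for f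
    by (auto simp: operators_agree_at_def)
  from agree have "AE y in lborel. 0 < y \<longrightarrow> \<Psi> x y = \<Psi>1 x y" by (simp add: operators_agree_at_def)
  then have \<Psi>: "(\<integral>\<^sup>+\<nu>\<in>{0<..}. ennreal (\<Psi> x \<nu> * f \<nu>) \<partial>lebesgue) = (\<integral>\<^sup>+\<nu>\<in>{0<..}. ennreal (\<Psi>1 x \<nu> * f \<nu>) \<partial>lebesgue)" for f
    unfolding nn_integral_completion by (intro nn_integral_set_cong_AE) (auto elim!: eventually_mono)
  show ?thesis using eq g unfolding integral_equation_at_def ops \<Psi> by simp
qed

lemma global_weak_solution_transfer:
  assumes agree: "AE x in lborel. 0 < x \<longrightarrow> operators_agree_at \<Psi> E E' P \<Psi>1 E1 E1' P1 x"
    and g: "AE x in lborel. 0 < x \<longrightarrow> g_in x = g1 x"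
    and sol: "global_weak_solution \<sigma> \<Psi> E E' P g_in h"
  shows "global_weak_solution \<sigma> \<Psi>1 E1 E1' P1 g1 h"
  unfolding global_weak_solution_def
proof (intro allI impI)
  fix T :: real assume "0 < T"
  then have T: "weak_solution_on \<sigma> \<Psi> E E' P g_in T h" using sol by (simp add: global_weak_solution_def)
  then have "AE x in lborel. 0 < x \<longrightarrow> (\<forall>t\<in>{0..T}. integral_equation_at \<Psi> E E' P g_in h x t)"
    by (simp add: weak_solution_on_iff)
  then have "AE x in lborel. 0 < x \<longrightarrow> (\<forall>t\<in>{0..T}. integral_equation_at \<Psi>1 E1 E1' P1 g1 h x t)"
    using agree g by eventually_elim (blast intro: integral_equation_at_transfer)
  then show "weak_solution_on \<sigma> \<Psi>1 E1 E1' P1 g1 T h" using T by (simp add: weak_solution_on_iff)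
qed

lemma operators_agree_at_sym:
  "operators_agree_at \<Psi> E E' P \<Psi>1 E1 E1' P1 x \<Longrightarrow> operators_agree_at \<Psi>1 E1 E1' P1 \<Psi> E E' P x"
  unfolding operators_agree_at_def by (auto elim!: eventually_mono)

text \<open>
  A Borel version is made symmetric by taking the smaller of its values at \<open>(x,y)\<close> and \<open>(y,x)\<close>, and then cut off
  at the given bound. Almost everywhere neither step changes it.
\<close>

lemma collision_kernel_Borel_version:
  assumes \<Psi>: "collision_kernel \<Psi>" and le: "\<And>x y. 0 < x \<Longrightarrow> 0 < y \<Longrightarrow> \<Psi> x y \<le> k / (x + y) powr \<sigma>"
    and k: "0 \<le> k"
  obtains \<Psi>1 where "joint_borel \<Psi>1"
    "\<And>x y. 0 \<le> \<Psi>1 x y" "\<And>x y. \<Psi>1 x y = \<Psi>1 y x" "\<And>x y. \<not> (0 < x \<and> 0 < y) \<Longrightarrow> \<Psi>1 x y = 0"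
    "\<And>x y. 0 < x \<Longrightarrow> 0 < y \<Longrightarrow> \<Psi>1 x y \<le> k * (x + y) powr (-\<sigma>)"
    "AE z in lborel. 0 < fst z \<and> 0 < snd z \<longrightarrow> \<Psi>1 (fst z) (snd z) = \<Psi> (fst z) (snd z)"
proof -
  have "{0<..} \<times> {0<..} \<in> sets (borel :: (real \<times> real) measure)"
    by (intro borel_open open_Times) auto
  then obtain f where f: "f \<in> borel_measurable borel"
    "AE z in lborel. z \<in> {0<..} \<times> {0<..} \<longrightarrow> f z = (case z of (x, y) \<Rightarrow> \<Psi> x y)"
    using \<Psi> unfolding collision_kernel_def by (blast elim: lebesgue_on_Borel_version)
  have [measurable]: "f \<in> borel_measurable (borel \<Otimes>\<^sub>M borel)" using f(1) unfolding borel_prod .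
  define \<Psi>1 where "\<Psi>1 x y = (if 0 < x \<and> 0 < y then max 0 (min (min (f (x, y)) (f (y, x))) (k * (x + y) powr (-\<sigma>))) else 0)" for x y
  show ?thesis
  proof
    show "joint_borel \<Psi>1" unfolding \<Psi>1_def by measurable
    show "\<Psi>1 x y = \<Psi>1 y x" for x y by (simp add: \<Psi>1_def min.commute add.commute conj_commute)
    show "AE z in lborel. 0 < fst z \<and> 0 < snd z \<longrightarrow> \<Psi>1 (fst z) (snd z) = \<Psi> (fst z) (snd z)"
      using f(2) AE_swap[OF f(2)]
    proof eventually_elim
      case (elim z)
      show ?case
      proof
        assume z: "0 < fst z \<and> 0 < snd z"
        have "f (fst z, snd z) = \<Psi> (fst z) (snd z)" "f (snd z, fst z) = \<Psi> (fst z) (snd z)"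
          using elim z \<Psi> by (auto simp: collision_kernel_def case_prod_beta mem_Times_iff)
        moreover have "0 \<le> \<Psi> (fst z) (snd z)" "\<Psi> (fst z) (snd z) \<le> k * (fst z + snd z) powr (-\<sigma>)"
          using z \<Psi> le[of "fst z" "snd z"] by (auto simp: collision_kernel_def powr_minus_divide)
        ultimately show "\<Psi>1 (fst z) (snd z) = \<Psi> (fst z) (snd z)" using z by (simp add: \<Psi>1_def)
      qed
    qed
  qed (use k in \<open>auto simp: \<Psi>1_def\<close>)
qed

lemma probabilities_Borel_version:
  assumes E: "coagulation_breakage_probabilities E E'" and c: "c \<in> {0..1}"
    and low: "\<And>x y. x \<in> {0<..<1} \<Longrightarrow> y \<in> {0<..<1} \<Longrightarrow> c \<le> E x y"
  obtains E1 where "joint_borel E1"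
    "\<And>x y. 0 \<le> E1 x y" "\<And>x y. E1 x y \<le> 1" "\<And>x y. x \<in> {0<..<1} \<Longrightarrow> y \<in> {0<..<1} \<Longrightarrow> c \<le> E1 x y"
    "AE z in lborel. 0 < fst z \<and> 0 < snd z \<longrightarrow> E1 (fst z) (snd z) = E (fst z) (snd z)"
proof -
  have "{0<..} \<times> {0<..} \<in> sets (borel :: (real \<times> real) measure)"
    by (intro borel_open open_Times) auto
  then obtain f where f: "f \<in> borel_measurable borel"
    "AE z in lborel. z \<in> {0<..} \<times> {0<..} \<longrightarrow> f z = (case z of (x, y) \<Rightarrow> E x y)"
    using E unfolding coagulation_breakage_probabilities_def by (blast elim: lebesgue_on_Borel_version)
  have [measurable]: "f \<in> borel_measurable (borel \<Otimes>\<^sub>M borel)" using f(1) unfolding borel_prod .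
  define E1 where "E1 x y = max (if 0 < x \<and> x < 1 \<and> 0 < y \<and> y < 1 then c else 0) (min 1 (f (x, y)))" for x y
  show ?thesis
  proof
    show "joint_borel E1" unfolding E1_def by measurable
    show "AE z in lborel. 0 < fst z \<and> 0 < snd z \<longrightarrow> E1 (fst z) (snd z) = E (fst z) (snd z)"
      using f(2)
    proof eventually_elim
      case (elim z)
      show ?case
      proof
        assume z: "0 < fst z \<and> 0 < snd z"
        have "f (fst z, snd z) = E (fst z) (snd z)" using elim z by (auto simp: case_prod_beta mem_Times_iff)
        moreover have "E (fst z) (snd z) \<in> {0..1}" using z E by (auto simp: coagulation_breakage_probabilities_def)
        ultimately show "E1 (fst z) (snd z) = E (fst z) (snd z)"
          using z low[of "fst z" "snd z"] by (auto simp: E1_def)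
      qed
    qed
  qed (use c in \<open>auto simp: E1_def\<close>)
qed

text \<open>
  The moments of a Borel version \<open>P0\<close> are Borel functions of \<open>(x,y)\<close>, so the pairs at which the bounds fail form
  a Borel null set. On that set the version is put to zero.
\<close>

lemma distribution_function_Borel_version:
  assumes P: "distribution_function P N" and H3: "hyp_H3 P \<eta>" and \<sigma>: "0 < \<sigma>" "\<sigma> < 1/2"
    and \<eta>': "\<eta> 0 \<le> \<eta>'" "\<eta> (2 * \<sigma>) \<le> \<eta>'"
  obtains P1 where "(\<lambda>(m, x, y). P1 m x y) \<in> borel_measurable (borel \<Otimes>\<^sub>M borel \<Otimes>\<^sub>M borel)"
    "\<And>m x y. (0::real) \<le> P1 m x y" "\<And>m x y. \<not> (0 < m \<and> m < x + y) \<Longrightarrow> P1 m x y = 0"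
    "\<And>x y. 0 < x \<Longrightarrow> 0 < y \<Longrightarrow> (\<integral>\<^sup>+m. ennreal (P1 m x y) \<partial>lborel) \<le> ennreal \<eta>'"
    "\<And>x y. 0 < x \<Longrightarrow> 0 < y \<Longrightarrow> (\<integral>\<^sup>+m. ennreal (m * P1 m x y) \<partial>lborel) \<le> ennreal (x + y)"
    "\<And>x y. 0 < x \<Longrightarrow> 0 < y \<Longrightarrow>
      (\<integral>\<^sup>+m. ennreal (m powr (-2 * \<sigma>) * P1 m x y) \<partial>lborel) \<le> ennreal (\<eta>' * (x + y) powr (-2 * \<sigma>))"
    "AE m in lborel. AE z in lborel. 0 < m \<and> m < fst z + snd z \<and> 0 < fst z \<and> 0 < snd z \<longrightarrow>
      P1 m (fst z) (snd z) = P m (fst z) (snd z)"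
proof -
  have "{0<..} \<times> {0<..} \<times> {0<..} \<in> sets (borel :: (real \<times> real \<times> real) measure)"
    by (intro borel_open open_Times) auto
  then obtain f where f: "f \<in> borel_measurable borel"
    "AE z in lborel. z \<in> {0<..} \<times> {0<..} \<times> {0<..} \<longrightarrow> f z = (case z of (m, x, y) \<Rightarrow> P m x y)"
    using P unfolding distribution_function_def by (blast elim: lebesgue_on_Borel_version)
  have [measurable]: "f \<in> borel_measurable (borel \<Otimes>\<^sub>M borel \<Otimes>\<^sub>M borel)" using f(1) unfolding borel_prod .
  define P0 where "P0 m x y = (if 0 < m \<and> m < x + y then max 0 (f (m, x, y)) else 0)" for m x y
  have P0_measurable: "(\<lambda>(m, x, y). P0 m x y) \<in> borel_measurable (borel \<Otimes>\<^sub>M borel \<Otimes>\<^sub>M borel)"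
    unfolding P0_def by measurable
  have [measurable]: "(\<lambda>z. P0 (a z) (b z) (c z)) \<in> borel_measurable M"
    if [measurable]: "a \<in> borel_measurable M" "b \<in> borel_measurable M" "c \<in> borel_measurable M" for a b c and M :: "'z measure"
    unfolding P0_def by measurable
  define good where "good x y \<longleftrightarrow> (\<integral>\<^sup>+m. ennreal (P0 m x y) \<partial>lborel) \<le> ennreal \<eta>' \<and>
     (\<integral>\<^sup>+m. ennreal (m * P0 m x y) \<partial>lborel) \<le> ennreal (x + y) \<and>
     (\<integral>\<^sup>+m. ennreal (m powr (-2 * \<sigma>) * P0 m x y) \<partial>lborel) \<le> ennreal (\<eta>' * (x + y) powr (-2 * \<sigma>))" for x y
  define P1 where "P1 m x y = (if good x y then P0 m x y else 0)" for m x y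
  have AE_good: "AE z in lborel. 0 < fst z \<and> 0 < snd z \<longrightarrow> good (fst z) (snd z)"
    using AE_section[OF AE_swap[OF f(2)]]
  proof eventually_elim
    case (elim z)
    obtain x y where z: "z = (x, y)" by (cases z)
    show ?case
    proof
      assume "0 < fst z \<and> 0 < snd z"
      then have xy: "0 < x" "0 < y" by (auto simp: z)
      have eq: "(\<integral>\<^sup>+m. ennreal (c m * P0 m x y) \<partial>lborel) = (\<integral>\<^sup>+m\<in>{0<..<x + y}. ennreal (c m * P m x y) \<partial>lborel)" for c :: "real \<Rightarrow> real"
      proof (rule nn_integral_cong_AE)
        show "AE m in lborel. ennreal (c m * P0 m x y) = ennreal (c m * P m x y) * indicator {0<..<x + y} m"
          using elim
        proof eventually_elim
          case (elim m)
          have "0 < m \<Longrightarrow> 0 \<le> P m x y" using P xy by (simp add: distribution_function_def)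
          then show ?case using elim xy by (auto simp: P0_def z indicator_def)
        qed
      qed
      have H3': "(\<integral>\<^sup>+m\<in>{0<..<x + y}. ennreal (m powr (-r) * P m x y) \<partial>lborel) \<le> ennreal (\<eta> r * (x + y) powr (-r))"
        if "r \<in> {0..<1}" for r
        using H3[unfolded hyp_H3_def, rule_format, OF that, of y "x + y"] xy by (simp add: nn_integral_completion)
      show "good (fst z) (snd z)"
        unfolding good_def z fst_conv snd_conv
      proof (intro conjI)
        have "(\<integral>\<^sup>+m. ennreal (P0 m x y) \<partial>lborel) = (\<integral>\<^sup>+m\<in>{0<..<x + y}. ennreal (m powr (-0) * P m x y) \<partial>lborel)"
          using eq[of "\<lambda>_. 1"] by (auto simp: indicator_def intro!: nn_integral_cong)
        also have "\<dots> \<le> ennreal (\<eta> 0 * (x + y) powr (-0))" by (rule H3') simp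
        also have "\<dots> \<le> ennreal \<eta>'" using xy \<eta>' by (simp add: ennreal_leI)
        finally show "(\<integral>\<^sup>+m. ennreal (P0 m x y) \<partial>lborel) \<le> ennreal \<eta>'" .
        have "(LINT m:{0<..<x + y}|lebesgue. m * P m x y) = x + y" "0 < x + y"
          using P xy by (auto simp: distribution_function_def)
        then have "(\<integral>\<^sup>+m\<in>{0<..<x + y}. ennreal (m * P m x y) \<partial>lborel) = ennreal (x + y)"
          by (rule set_integral_nonzero_nn_integral) (use P xy in \<open>auto simp: distribution_function_def\<close>)
        then show "(\<integral>\<^sup>+m. ennreal (m * P0 m x y) \<partial>lborel) \<le> ennreal (x + y)" by (simp add: eq)
        have "(\<integral>\<^sup>+m\<in>{0<..<x + y}. ennreal (m powr (-(2 * \<sigma>)) * P m x y) \<partial>lborel) \<le> ennreal (\<eta> (2 * \<sigma>) * (x + y) powr (-(2 * \<sigma>)))"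
          by (rule H3') (use \<sigma> in auto)
        also have "\<dots> \<le> ennreal (\<eta>' * (x + y) powr (-(2 * \<sigma>)))"
          using \<eta>' by (intro ennreal_leI mult_right_mono) auto
        finally show "(\<integral>\<^sup>+m. ennreal (m powr (-2 * \<sigma>) * P0 m x y) \<partial>lborel) \<le> ennreal (\<eta>' * (x + y) powr (-2 * \<sigma>))"
          by (simp add: eq)
      qed
    qed
  qed
  show ?thesis
  proof
    have [measurable]: "Measurable.pred (borel \<Otimes>\<^sub>M borel) (\<lambda>z. good (fst z) (snd z))"
      unfolding good_def by measurable
    have [measurable]: "Measurable.pred (borel \<Otimes>\<^sub>M borel \<Otimes>\<^sub>M borel) (\<lambda>z. good (fst (snd z)) (snd (snd z)))"
      using measurable_compose[of snd "borel \<Otimes>\<^sub>M borel \<Otimes>\<^sub>M borel" "borel \<Otimes>\<^sub>M borel" "\<lambda>z. good (fst z) (snd z)"] by measurable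
    show "(\<lambda>(m, x, y). P1 m x y) \<in> borel_measurable (borel \<Otimes>\<^sub>M borel \<Otimes>\<^sub>M borel)"
      unfolding P1_def case_prod_beta by measurable
    have P0_nn: "0 \<le> P0 m x y" for m x y by (simp add: P0_def)
    show "0 \<le> P1 m x y" for m x y by (simp add: P1_def P0_nn)
    show "P1 m x y = 0" if "\<not> (0 < m \<and> m < x + y)" for m x y using that by (auto simp: P1_def P0_def)
    show "(\<integral>\<^sup>+m. ennreal (P1 m x y) \<partial>lborel) \<le> ennreal \<eta>'"
      "(\<integral>\<^sup>+m. ennreal (m * P1 m x y) \<partial>lborel) \<le> ennreal (x + y)"
      "(\<integral>\<^sup>+m. ennreal (m powr (-2 * \<sigma>) * P1 m x y) \<partial>lborel) \<le> ennreal (\<eta>' * (x + y) powr (-2 * \<sigma>))" for x y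
      by (cases "good x y"; simp add: P1_def; simp add: good_def)+
    show "AE m in lborel. AE z in lborel. 0 < m \<and> m < fst z + snd z \<and> 0 < fst z \<and> 0 < snd z \<longrightarrow>
      P1 m (fst z) (snd z) = P m (fst z) (snd z)"
      using AE_section[OF f(2)]
    proof eventually_elim
      case (elim m)
      show ?case
        using elim AE_good
      proof eventually_elim
        case (elim z)
        show ?case
        proof
          assume z: "0 < m \<and> m < fst z + snd z \<and> 0 < fst z \<and> 0 < snd z"
          then have "f (m, fst z, snd z) = P m (fst z) (snd z)"
            using elim by (auto simp: case_prod_beta mem_Times_iff)
          moreover have "0 \<le> P m (fst z) (snd z)" using P z by (simp add: distribution_function_def)
          ultimately show "P1 m (fst z) (snd z) = P m (fst z) (snd z)" using elim z by (simp add: P1_def P0_def)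
        qed
      qed
    qed
  qed
qed

text \<open>
  Fubini for the coefficients: at almost every \<open>x\<close> they agree with their Borel versions along the line
  \<open>{(x - y, y)}\<close> for coagulation, along \<open>{(x, y)}\<close> for death, and in the plane of pairs for breakage.
\<close>

lemma AE_operators_agree:
  assumes E: "coagulation_breakage_probabilities E E'"
    and \<Psi>1: "AE z in lborel. 0 < fst z \<and> 0 < snd z \<longrightarrow> \<Psi>1 (fst z) (snd z) = \<Psi> (fst z) (snd z)"
    and E1: "AE z in lborel. 0 < fst z \<and> 0 < snd z \<longrightarrow> E1 (fst z) (snd z) = E (fst z) (snd z)"
    and P1: "AE m in lborel. AE z in lborel. 0 < m \<and> m < fst z + snd z \<and> 0 < fst z \<and> 0 < snd z \<longrightarrow>
      P1 m (fst z) (snd z) = P m (fst z) (snd z)"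
  shows "AE x in lborel. 0 < x \<longrightarrow> operators_agree_at \<Psi> E E' P \<Psi>1 E1 (\<lambda>x y. 1 - E1 x y) P1 x"
proof -
  have both: "AE z in lborel. 0 < fst z \<and> 0 < snd z \<longrightarrow>
      \<Psi>1 (fst z) (snd z) = \<Psi> (fst z) (snd z) \<and> E1 (fst z) (snd z) = E (fst z) (snd z) \<and> 1 - E1 (fst z) (snd z) = E' (fst z) (snd z)"
    using \<Psi>1 E1
  proof eventually_elim
    case (elim z)
    have "0 < fst z \<and> 0 < snd z \<Longrightarrow> E (fst z) (snd z) + E' (fst z) (snd z) = 1"
      using E by (simp add: coagulation_breakage_probabilities_def)
    then show ?case using elim by auto
  qed
  from P1 AE_section[OF both] AE_shear[OF both] show ?thesis
  proof eventually_elim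
    case (elim x)
    show ?case
      unfolding operators_agree_at_def
    proof (intro impI conjI allI)
      assume x: "0 < x"
      show \<Psi>: "AE y in lborel. 0 < y \<longrightarrow> \<Psi> x y = \<Psi>1 x y"
        using elim(2) by eventually_elim (use x in auto)
      fix f :: "real \<Rightarrow> real"
      show "op_Bc \<Psi> E f x = op_Bc \<Psi>1 E1 f x"
        by (rule op_Bc_cong) (use elim(3) in \<open>auto elim!: eventually_mono\<close>)
      show "op_Dcb \<Psi> f x = op_Dcb \<Psi>1 f x"
        by (rule op_Dcb_cong) (use \<Psi> in auto)
      show "op_Bb \<Psi> E' P f x = op_Bb \<Psi>1 (\<lambda>x y. 1 - E1 x y) P1 f x"
      proof (rule op_Bb_cong)
        have "AE z in lborel. 0 < x \<and> x < fst z + snd z \<and> 0 < fst z \<and> 0 < snd z \<longrightarrow>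
            P x (fst z) (snd z) * E' (fst z) (snd z) * \<Psi> (fst z) (snd z)
            = P1 x (fst z) (snd z) * (1 - E1 (fst z) (snd z)) * \<Psi>1 (fst z) (snd z)"
          using elim(1) both by eventually_elim auto
        from AE_shear[OF this]
        show "AE y in lborel. AE z in lborel. x < y \<and> 0 < z \<and> z < y \<longrightarrow>
          P x (y - z) z * E' (y - z) z * \<Psi> (y - z) z = P1 x (y - z) z * (1 - E1 (y - z) z) * \<Psi>1 (y - z) z"
          by eventually_elim (use x in \<open>auto elim!: eventually_mono\<close>)
      qed simp
    qed
  qed
qed

section \<open>Existence and uniqueness\<close>

theorem theorem2p3:
  fixes \<Psi> E E' :: "real \<Rightarrow> real \<Rightarrow> real"
    and P :: "real \<Rightarrow> real \<Rightarrow> real \<Rightarrow> real"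
    and N k \<sigma> \<tau>2 :: real
    and \<eta> k' g_in :: "real \<Rightarrow> real"
  assumes "collision_kernel \<Psi>"
    and "coagulation_breakage_probabilities E E'"
    and "distribution_function P N"
    and "0 \<le> k"
    and "0 < \<sigma>" and "\<sigma> < 1/2"
    and "\<And>\<mu> \<nu>. 0 < \<mu> \<Longrightarrow> 0 < \<nu> \<Longrightarrow> \<Psi> \<mu> \<nu> \<le> k / (\<mu> + \<nu>) powr \<sigma>"
    and "hyp_H2 E N \<eta>"
    and "hyp_H3 P \<eta>"
    and "hyp_H4 \<sigma> P"
    and "hyp_H5 \<sigma> P"
    and "hyp_H6 \<sigma> P \<tau>2 k'"
    and "g_in \<in> S_cone \<sigma>"
  shows "\<exists>g. global_weak_solution \<sigma> \<Psi> E E' P g_in g \<and>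
           (\<forall>h. global_weak_solution \<sigma> \<Psi> E E' P g_in h \<longrightarrow> (\<forall>t\<ge>0. S_eq (h t) (g t)))"
proof -
  have N: "2 \<le> N" using assms(3) by (simp add: distribution_function_def)
  have \<sigma>01: "(0::real) \<in> {0..<1}" "2 * \<sigma> \<in> {0..<1}" using assms(5,6) by auto
  define \<eta>' where "\<eta>' = max (\<eta> 0) (\<eta> (2 * \<sigma>))"
  have H2: "N \<le> \<eta> r" "x \<in> {0<..<1} \<Longrightarrow> y \<in> {0<..<1} \<Longrightarrow> (\<eta> r - 2) / (\<eta> r - 1) \<le> E x y"
    if "r \<in> {0..<1}" for r x y
    using assms(8) that unfolding hyp_H2_def by blast+
  have \<eta>': "2 \<le> \<eta>'" using H2(1)[OF \<sigma>01(1)] N by (simp add: \<eta>'_def)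
  (* E >= c on the unit square is the bound E + eta' (1 - E) <= 2 solved for E. *)
  define c where "c = (\<eta>' - 2) / (\<eta>' - 1)"
  have c: "c \<in> {0..1}" using \<eta>' by (auto simp: c_def)
  have c_le: "c \<le> E x y" if "x \<in> {0<..<1}" "y \<in> {0<..<1}" for x y
    using H2(2)[OF \<sigma>01(1) that] H2(2)[OF \<sigma>01(2) that] by (simp add: c_def \<eta>'_def max_def)
  obtain \<Psi>1 where \<Psi>1: "joint_borel \<Psi>1"
    "\<And>x y. 0 \<le> \<Psi>1 x y" "\<And>x y. \<Psi>1 x y = \<Psi>1 y x" "\<And>x y. \<not> (0 < x \<and> 0 < y) \<Longrightarrow> \<Psi>1 x y = 0"
    "\<And>x y. 0 < x \<Longrightarrow> 0 < y \<Longrightarrow> \<Psi>1 x y \<le> k * (x + y) powr (-\<sigma>)"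
    "AE z in lborel. 0 < fst z \<and> 0 < snd z \<longrightarrow> \<Psi>1 (fst z) (snd z) = \<Psi> (fst z) (snd z)"
    by (rule collision_kernel_Borel_version[OF assms(1,7,4)]) (assumption, assumption, rule that)
  obtain E1 where E1: "joint_borel E1"
    "\<And>x y. 0 \<le> E1 x y" "\<And>x y. E1 x y \<le> 1" "\<And>x y. x \<in> {0<..<1} \<Longrightarrow> y \<in> {0<..<1} \<Longrightarrow> c \<le> E1 x y"
    "AE z in lborel. 0 < fst z \<and> 0 < snd z \<longrightarrow> E1 (fst z) (snd z) = E (fst z) (snd z)"
    by (rule probabilities_Borel_version[OF assms(2) c c_le]) (assumption, assumption, rule that)
  obtain P1 where P1: "(\<lambda>(m, x, y). P1 m x y) \<in> borel_measurable (borel \<Otimes>\<^sub>M borel \<Otimes>\<^sub>M borel)"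
    "\<And>m x y. (0::real) \<le> P1 m x y" "\<And>m x y. \<not> (0 < m \<and> m < x + y) \<Longrightarrow> P1 m x y = 0"
    "\<And>x y. 0 < x \<Longrightarrow> 0 < y \<Longrightarrow> (\<integral>\<^sup>+m. ennreal (P1 m x y) \<partial>lborel) \<le> ennreal \<eta>'"
    "\<And>x y. 0 < x \<Longrightarrow> 0 < y \<Longrightarrow> (\<integral>\<^sup>+m. ennreal (m * P1 m x y) \<partial>lborel) \<le> ennreal (x + y)"
    "\<And>x y. 0 < x \<Longrightarrow> 0 < y \<Longrightarrow>
      (\<integral>\<^sup>+m. ennreal (m powr (-2 * \<sigma>) * P1 m x y) \<partial>lborel) \<le> ennreal (\<eta>' * (x + y) powr (-2 * \<sigma>))"
    "AE m in lborel. AE z in lborel. 0 < m \<and> m < fst z + snd z \<and> 0 < fst z \<and> 0 < snd z \<longrightarrow>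
      P1 m (fst z) (snd z) = P m (fst z) (snd z)"
    by (rule distribution_function_Borel_version[OF assms(3,9,5,6), of \<eta>']) (simp add: \<eta>'_def, simp add: \<eta>'_def, rule that)
  have agree: "AE x in lborel. 0 < x \<longrightarrow> operators_agree_at \<Psi> E E' P \<Psi>1 E1 (\<lambda>x y. 1 - E1 x y) P1 x"
    by (rule AE_operators_agree[OF assms(2) \<Psi>1(6) E1(5) P1(7)])
  have agree': "AE x in lborel. 0 < x \<longrightarrow> operators_agree_at \<Psi>1 E1 (\<lambda>x y. 1 - E1 x y) P1 \<Psi> E E' P x"
    using agree by eventually_elim (auto intro: operators_agree_at_sym)
  have g_S: "g_in \<in> S_space \<sigma>" and g_nn: "AE x in lborel. 0 < x \<longrightarrow> 0 \<le> g_in x"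
    using assms(13) by (auto simp: S_cone_def AE_completion_iff)
  obtain f where f: "f \<in> borel_measurable borel" "AE x in lborel. 0 < x \<longrightarrow> f x = g_in x"
    using S_space_Borel_version[OF g_S] .
  define f0 where "f0 x = max 0 (f x)" for x
  have f0 [measurable]: "f0 \<in> borel_measurable borel" using f(1) unfolding f0_def by measurable
  have f0_eq: "AE x in lborel. 0 < x \<longrightarrow> g_in x = f0 x"
    using f(2) g_nn by eventually_elim (auto simp: f0_def)
  have f0_eq': "AE x in lborel. 0 < x \<longrightarrow> f0 x = g_in x" using f0_eq by eventually_elim auto
  interpret collision_model_datum \<Psi>1 E1 P1 k \<sigma> \<eta>' f0
  proof
    show "E1 x y + \<eta>' * (1 - E1 x y) \<le> 2" if "0 < x" "x < 1" "0 < y" "y < 1" for x y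
    proof -
      have "c \<le> E1 x y" using E1(4) that by simp
      then have "\<eta>' - 2 \<le> E1 x y * (\<eta>' - 1)" using \<eta>' by (simp add: c_def field_simps)
      then show ?thesis by (simp add: algebra_simps)
    qed
    show "(\<integral>\<^sup>+x. ennreal (half_line_weight \<sigma> x) * ennreal (f0 x) \<partial>lborel) < \<infinity>"
      using S_norm_cong(2)[OF f0_eq g_S f0] by (simp add: S_space_iff_nn_integral f0_def)
  qed (fact assms(4,5,6) \<Psi>1 E1 P1 \<eta>' f0 | simp add: f0_def)+
  have sol: "global_weak_solution \<sigma> \<Psi> E E' P g_in sol"
    by (rule global_weak_solution_transfer[OF agree' f0_eq' sol_global_weak_solution])
  moreover have "S_eq (h t) (sol t)" if h: "global_weak_solution \<sigma> \<Psi> E E' P g_in h" and t: "0 \<le> t" for h t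
    by (rule weak_solution_unique[OF global_weak_solution_transfer[OF agree f0_eq h] sol_global_weak_solution t])
  ultimately show ?thesis by blast
qed

end
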